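(* For $(m,p)=(4,3)$ and Schubert data $\alpha^\bullet=((1,3,5),(1,3,5),(1,3,5),(1,3,5))$ for $\mathrm{Grass}(3,7)$, one has $d(4,3;\alpha^\bullet)=8$ and property $\mathrm{SG}(4,3;\alpha^\bullet)$ holds.
   Context: Let $n=m+p$. $\mathrm{Grass}(p,n)$ is the Grassmannian of complex $p$-planes in $\mathbb C^n$; a complete flag $K_\bullet$ is a chain $K_1\subset\cdots\subset K_n=\mathbb C^n$, $\dim K_i=i$. A Schubert condition is $\alpha=(1\le\alpha_1<\cdots<\alpha_p\le n)$, $|\alpha|=\sum_i(\alpha_i-i)$, and $\Omega_\alpha K_\bullet=\{X\in\mathrm{Grass}(p,n):\dim(X\cap K_{n+1-\alpha_i})\ge p+1-i\ \forall i\}$. Schubert data: a sequence $(\alpha^1,\dots,\alpha^k)$ with $\sum_j|\alpha^j|=mp$; $d(m,p;\alpha^\bullet)$ is the number of points in $\bigcap_j\Omega_{\alpha^j}F^j_\bullet$ for flags in general position. $K_\bullet(s)$ ($s\in\mathbb C$) is the flag with $K_i(s)$ the row span of the first $i$ rows of the $n\times n$ matrix with $(i,j)$ entry $\binom{j-1}{i-1}s^{j-i}$. Property $\mathrm{SG}(m,p;\alpha^\bullet)$: there is a nonzero real polynomial $f$ in $k$ variables such that for all distinct reals $s_1,\dots,s_k$ with $f(s_1,\dots,s_k)\ne0$, $\bigcap_j\Omega_{\alpha^j}K_\bullet(s_j)$ consists of exactly $d(m,p;\alpha^\bullet)$ points, all real. *)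

theory Defs
  imports Complex_Main "HOL-Library.Function_Algebras"
begin

text \<open>Vectors of C^n are represented as functions nat => complex vanishing at
  all indices >= n; coordinate i (1-based in the paper) is index i-1 here.\<close>

definition cscale :: "complex \<Rightarrow> (nat \<Rightarrow> complex) \<Rightarrow> (nat \<Rightarrow> complex)" where
  "cscale c v = (\<lambda>i. c * v i)"

interpretation cv: vector_space cscale
  by unfold_locales (auto simp: cscale_def fun_eq_iff algebra_simps)

definition cspace :: "nat \<Rightarrow> (nat \<Rightarrow> complex) set" where
  "cspace n = {v. \<forall>i\<ge>n. v i = 0}"

definition Grass :: "nat \<Rightarrow> nat \<Rightarrow> (nat \<Rightarrow> complex) set set" where
  "Grass p n = {X. cv.subspace X \<and> X \<subseteq> cspace n \<and> cv.dim X = p}"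

definition row_vec :: "nat \<Rightarrow> (nat \<Rightarrow> nat \<Rightarrow> complex) \<Rightarrow> nat \<Rightarrow> (nat \<Rightarrow> complex)" where
  "row_vec n M r = (\<lambda>j. if j < n then M r j else 0)"

definition flag_of_matrix :: "nat \<Rightarrow> (nat \<Rightarrow> nat \<Rightarrow> complex) \<Rightarrow> nat \<Rightarrow> (nat \<Rightarrow> complex) set" where
  "flag_of_matrix n M i = cv.span {row_vec n M r | r. r < i}"

text \<open>Schubert variety Omega_alpha K for alpha = (alpha_1 < ... < alpha_p),
  given as the list [alpha_1, ..., alpha_p].\<close>
definition schubert_var :: "nat \<Rightarrow> nat \<Rightarrow> nat list \<Rightarrow> (nat \<Rightarrow> (nat \<Rightarrow> complex) set)
    \<Rightarrow> (nat \<Rightarrow> complex) set set" where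
  "schubert_var p n \<alpha> K =
     {X \<in> Grass p n. \<forall>i\<in>{1..p}. p + 1 - i \<le> cv.dim (X \<inter> K (n + 1 - \<alpha> ! (i - 1)))}"

definition schubert_intersection :: "nat \<Rightarrow> nat \<Rightarrow> nat list list
    \<Rightarrow> (nat \<Rightarrow> nat \<Rightarrow> (nat \<Rightarrow> complex) set) \<Rightarrow> (nat \<Rightarrow> complex) set set" where
  "schubert_intersection p n \<alpha>s F =
     Grass p n \<inter> (\<Inter>j<length \<alpha>s. schubert_var p n (\<alpha>s ! j) (F j))"

inductive poly_fun :: "(('v \<Rightarrow> 'a::comm_ring_1) \<Rightarrow> 'a) \<Rightarrow> bool" where
  pf_const: "poly_fun (\<lambda>x. c)"
| pf_var: "poly_fun (\<lambda>x. x v)"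
| pf_add: "poly_fun p \<Longrightarrow> poly_fun q \<Longrightarrow> poly_fun (\<lambda>x. p x + q x)"
| pf_mult: "poly_fun p \<Longrightarrow> poly_fun q \<Longrightarrow> poly_fun (\<lambda>x. p x * q x)"

text \<open>For flags in general position (i.e. flags F^j = row-span flags of matrices
  g j whose entries avoid the zero set of some nonzero polynomial), the
  intersection consists of exactly d points.  Variable (j,r,c) is entry (r,c) of g j.\<close>
definition generic_count :: "nat \<Rightarrow> nat \<Rightarrow> nat list list \<Rightarrow> nat \<Rightarrow> bool" where
  "generic_count m p \<alpha>s d \<longleftrightarrow>
     (\<exists>P :: (nat \<times> nat \<times> nat \<Rightarrow> complex) \<Rightarrow> complex.
        poly_fun P \<and> P \<noteq> (\<lambda>_. 0) \<and>
        (\<forall>g :: nat \<Rightarrow> nat \<Rightarrow> nat \<Rightarrow> complex.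
           P (\<lambda>(j, r, c). g j r c) \<noteq> 0 \<longrightarrow>
           (let S = schubert_intersection p (m + p) \<alpha>s (\<lambda>j. flag_of_matrix (m + p) (g j))
            in finite S \<and> card S = d)))"

definition schubert_number :: "nat \<Rightarrow> nat \<Rightarrow> nat list list \<Rightarrow> nat" where
  "schubert_number m p \<alpha>s = (THE d. generic_count m p \<alpha>s d)"

text \<open>0-indexed version of the matrix with (i,j) entry binom(j-1,i-1) s^(j-i).\<close>
definition osc_matrix :: "real \<Rightarrow> nat \<Rightarrow> nat \<Rightarrow> complex" where
  "osc_matrix s i j = of_nat (j choose i) * (complex_of_real s) ^ (j - i)"

definition osc_flag :: "nat \<Rightarrow> real \<Rightarrow> nat \<Rightarrow> (nat \<Rightarrow> complex) set" where
  "osc_flag n s = flag_of_matrix n (osc_matrix s)"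

definition real_point :: "(nat \<Rightarrow> complex) set \<Rightarrow> bool" where
  "real_point X \<longleftrightarrow> (\<exists>B. (\<forall>v\<in>B. \<forall>i. v i \<in> \<real>) \<and> X = cv.span B)"

definition SG :: "nat \<Rightarrow> nat \<Rightarrow> nat list list \<Rightarrow> bool" where
  "SG m p \<alpha>s \<longleftrightarrow>
     (\<exists>f :: (nat \<Rightarrow> real) \<Rightarrow> real.
        poly_fun f \<and> f \<noteq> (\<lambda>_. 0) \<and>
        (\<forall>s :: nat \<Rightarrow> real.
           inj_on s {..<length \<alpha>s} \<and> f s \<noteq> 0 \<longrightarrow>
           (let S = schubert_intersection p (m + p) \<alpha>s (\<lambda>j. osc_flag (m + p) (s j))
            in finite S \<and> card S = schubert_number m p \<alpha>s \<and> (\<forall>X\<in>S. real_point X))))"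

end

(* A point X of the intersection lies in four hyperplanes, one from each of the pencils of
   hyperplanes through the 5-dimensional members of the flags, and meeting the 3-dimensional
   members imposes on the pencil parameters four equations, multilinear in three of them at a
   time.  Eliminating three parameters leaves a univariate equation of degree 8.  All genericity
   conditions used are non-vanishing conditions on regular functions of the flag matrices; they are
   verified by exact computation (Bezout identities) for the osculating flags at 0, 1, -1, 2, so
   they hold on a Zariski open set that meets the osculating flags.

   For osculating flags at arbitrary distinct real points the eight solutions can be written down:
   the parameters lie in quadratic extensions generated by square roots of sums of squares, two
   solutions being symmetric in the four points and two for each partition into pairs. *)
theory Submission
  imports Defs "Jordan_Normal_Form.Determinant" "Subresultants.Subresultant_Gcd"
    "HOL-Computational_Algebra.Field_as_Ring" "HOL-Computational_Algebra.Fundamental_Theorem_Algebra"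
begin

section \<open>Zariski neighbourhoods and regular functions\<close>

text \<open>Two normalisations keep the elimination small. The eight functionals that define the
  four 5-dimensional members live in a 7-dimensional dual space, so they satisfy a linear relation.
  Taking \<open>mu j\<close> as its part in the j-th pencil gives
  \<open>mu 0 + mu 1 + mu 2 + mu 3 = 0\<close>, which kills the top coefficient of every
  determinant. Adding multiples \<open>kap j * mu j\<close> to \<open>lam j\<close> kills three more
  coefficients and brings the degree of the eliminant down to 8. The determinants also vanish when
  all four hyperplanes are the \<open>mu j\<close>; these are dependent, and a 4 by 4 determinant
  excludes this spurious solution. In the osculating case a vector is a polynomial p of degree at
  most 6, and a hyperplane of the j-th pencil is p'(s_j) = 6 u_j p(s_j). That the explicit solutions
  are all solutions is not proved by algebra: the generic count is 8, so eight distinct real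
  solutions exhaust the intersection. The polynomial certifying the count stays nonzero when
  restricted to osculating flags, because the base point of the exact computation is osculating
  itself.\<close>

definition znear :: "('v \<Rightarrow> 'a::field) \<Rightarrow> (('v \<Rightarrow> 'a) \<Rightarrow> bool) \<Rightarrow> bool" where
  "znear x0 Q \<longleftrightarrow> (\<exists>D. poly_fun D \<and> D x0 \<noteq> 0 \<and> (\<forall>x. D x \<noteq> 0 \<longrightarrow> Q x))"

text \<open>Equality with a quotient is asked only off the zero set of \<open>D\<close>, so a
  construction that divides by something vanishing elsewhere, such as Cramer's rule, still counts as
  regular at \<open>x0\<close>.\<close>

definition zreg :: "('v \<Rightarrow> 'a::field) \<Rightarrow> (('v \<Rightarrow> 'a) \<Rightarrow> 'a) \<Rightarrow> bool" where
  "zreg x0 f \<longleftrightarrow> (\<exists>N D. poly_fun N \<and> poly_fun D \<and> D x0 \<noteq> 0 \<and> (\<forall>x. D x \<noteq> 0 \<longrightarrow> f x = N x / D x))"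

lemma poly_fun_minus: "poly_fun (f :: ('v \<Rightarrow> 'a::comm_ring_1) \<Rightarrow> 'a) \<Longrightarrow> poly_fun (\<lambda>x. - f x)"
  using pf_mult[OF pf_const[of "-1"], of f] by simp

lemma poly_fun_diff:
  "poly_fun (f :: ('v \<Rightarrow> 'a::comm_ring_1) \<Rightarrow> 'a) \<Longrightarrow> poly_fun g \<Longrightarrow> poly_fun (\<lambda>x. f x - g x)"
  using pf_add[OF _ poly_fun_minus, of f g] by simp

lemma poly_fun_power:
  "poly_fun (f :: ('v \<Rightarrow> 'a::comm_ring_1) \<Rightarrow> 'a) \<Longrightarrow> poly_fun (\<lambda>x. f x ^ n)"
  by (induction n) (auto intro: pf_const pf_mult)

lemmas poly_fun_intros = pf_const pf_var pf_add pf_mult poly_fun_minus poly_fun_diff poly_fun_power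

lemma znear_at: "znear x0 Q \<Longrightarrow> Q x0"
  by (auto simp: znear_def)

lemma znear_True [simp]: "znear x0 (\<lambda>x. True)"
  unfolding znear_def by (rule exI[of _ "\<lambda>_. 1"]) (auto intro: pf_const)

lemma znear_mono: "znear x0 Q \<Longrightarrow> (\<And>x. Q x \<Longrightarrow> R x) \<Longrightarrow> znear x0 R"
  unfolding znear_def by blast

lemma znear_conj:
  assumes "znear x0 Q" "znear x0 R"
  shows "znear x0 (\<lambda>x. Q x \<and> R x)"
proof -
  obtain D E where "poly_fun D" "D x0 \<noteq> 0" "\<And>x. D x \<noteq> 0 \<Longrightarrow> Q x"
    "poly_fun E" "E x0 \<noteq> 0" "\<And>x. E x \<noteq> 0 \<Longrightarrow> R x"
    using assms unfolding znear_def by blast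
  then show ?thesis
    unfolding znear_def by (intro exI[of _ "\<lambda>x. D x * E x"]) (auto intro: pf_mult)
qed

lemma znear_ball_finite:
  assumes "finite I" "\<And>i. i \<in> I \<Longrightarrow> znear x0 (Q i)"
  shows "znear x0 (\<lambda>x. \<forall>i\<in>I. Q i x)"
  using assms by (induction rule: finite_induct) (auto intro: znear_conj)

lemma znear_all_less:
  assumes "\<And>i. i < (n::nat) \<Longrightarrow> znear x0 (Q i)"
  shows "znear x0 (\<lambda>x. \<forall>i<n. Q i x)"
  using znear_ball_finite[of "{..<n}" x0 Q] assms by (simp add: Ball_def)

lemma poly_fun_zreg: "poly_fun f \<Longrightarrow> zreg x0 f"
  unfolding zreg_def by (intro exI[of _ f] exI[of _ "\<lambda>_. 1"]) (auto intro: pf_const)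

lemma zreg_const: "zreg x0 (\<lambda>x. c)"
  by (intro poly_fun_zreg pf_const)

lemma zreg_var: "zreg x0 (\<lambda>x. x v)"
  by (intro poly_fun_zreg pf_var)

lemma zreg_binop:
  assumes "zreg x0 f" "zreg x0 g"
  shows zreg_add: "zreg x0 (\<lambda>x. f x + g x)" and zreg_mult: "zreg x0 (\<lambda>x. f x * g x)"
proof -
  obtain N D M E where *: "poly_fun N" "poly_fun D" "D x0 \<noteq> 0" "\<And>x. D x \<noteq> 0 \<Longrightarrow> f x = N x / D x"
    "poly_fun M" "poly_fun E" "E x0 \<noteq> 0" "\<And>x. E x \<noteq> 0 \<Longrightarrow> g x = M x / E x"
    using assms unfolding zreg_def by blast
  show "zreg x0 (\<lambda>x. f x + g x)" unfolding zreg_def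
    by (rule exI[of _ "\<lambda>x. N x * E x + M x * D x"], rule exI[of _ "\<lambda>x. D x * E x"])
       (use * in \<open>auto intro!: poly_fun_intros simp: field_simps\<close>)
  show "zreg x0 (\<lambda>x. f x * g x)" unfolding zreg_def
    by (rule exI[of _ "\<lambda>x. N x * M x"], rule exI[of _ "\<lambda>x. D x * E x"])
       (use * in \<open>auto intro!: poly_fun_intros simp: field_simps\<close>)
qed

lemma zreg_uminus: "zreg x0 f \<Longrightarrow> zreg x0 (\<lambda>x. - f x)"
  using zreg_mult[OF zreg_const[of x0 "-1"], of f] by simp

lemma zreg_diff: "zreg x0 f \<Longrightarrow> zreg x0 g \<Longrightarrow> zreg x0 (\<lambda>x. f x - g x)"
  using zreg_add[OF _ zreg_uminus, of x0 f g] by simp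

lemma zreg_sum: "(\<And>i. i \<in> I \<Longrightarrow> zreg x0 (f i)) \<Longrightarrow> zreg x0 (\<lambda>x. \<Sum>i\<in>I. f i x)"
  by (induction I rule: infinite_finite_induct) (auto intro: zreg_const zreg_add)

lemma zreg_prod: "(\<And>i. i \<in> I \<Longrightarrow> zreg x0 (f i)) \<Longrightarrow> zreg x0 (\<lambda>x. \<Prod>i\<in>I. f i x)"
  by (induction I rule: infinite_finite_induct) (auto intro: zreg_const zreg_mult)

lemma zreg_inverse:
  assumes "zreg x0 f" "f x0 \<noteq> 0"
  shows "zreg x0 (\<lambda>x. inverse (f x))"
proof -
  obtain N D where *: "poly_fun N" "poly_fun D" "D x0 \<noteq> 0" "\<And>x. D x \<noteq> 0 \<Longrightarrow> f x = N x / D x"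
    using assms unfolding zreg_def by blast
  then have "N x0 \<noteq> 0" using assms(2) by auto
  note * = * this
  have "inverse (f x) = D x * D x / (N x * D x)" if "N x * D x \<noteq> 0" for x
    using *(4)[of x] that by auto
  then have "\<forall>x. N x * D x \<noteq> 0 \<longrightarrow> inverse (f x) = D x * D x / (N x * D x)" by blast
  then show ?thesis
    unfolding zreg_def using *(3,5) pf_mult[OF *(2,2)] pf_mult[OF *(1,2)] mult_eq_0_iff by blast
qed

lemma zreg_divide: "zreg x0 f \<Longrightarrow> zreg x0 g \<Longrightarrow> g x0 \<noteq> 0 \<Longrightarrow> zreg x0 (\<lambda>x. f x / g x)"
  unfolding divide_inverse by (intro zreg_mult zreg_inverse)

lemma zreg_if: "(b \<Longrightarrow> zreg x0 f) \<Longrightarrow> (\<not> b \<Longrightarrow> zreg x0 g) \<Longrightarrow> zreg x0 (\<lambda>x. if b then f x else g x)"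
  by (cases b) simp_all

lemmas zreg_intros = zreg_const zreg_var zreg_add zreg_mult zreg_uminus zreg_diff zreg_sum zreg_if

lemma znear_nonzero:
  assumes "zreg x0 f" "f x0 \<noteq> 0"
  shows "znear x0 (\<lambda>x. f x \<noteq> 0)"
proof -
  obtain N D where *: "poly_fun N" "poly_fun D" "D x0 \<noteq> 0" "\<And>x. D x \<noteq> 0 \<Longrightarrow> f x = N x / D x"
    using assms unfolding zreg_def by blast
  then have "N x0 \<noteq> 0" using assms(2) by auto
  then show ?thesis unfolding znear_def
    by (intro exI[of _ "\<lambda>x. N x * D x"]) (use * in \<open>auto intro: pf_mult\<close>)
qed

lemma zreg_det:
  assumes "\<And>i j. i < n \<Longrightarrow> j < n \<Longrightarrow> zreg x0 (\<lambda>x. M x i j)"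
  shows "zreg x0 (\<lambda>x. det (mat n n (\<lambda>(i,j). M x i j)))"
proof -
  have eq: "det (mat n n (\<lambda>(i,j). M x i j)) =
      (\<Sum>p \<in> {p. p permutes {0..<n}}. signof p * (\<Prod>i = 0..<n. M x i (p i)))" for x
    by (subst det_def') (auto intro!: sum.cong prod.cong simp: permutes_in_image)
  show ?thesis unfolding eq
  proof (intro zreg_sum zreg_mult zreg_prod zreg_const)
    fix p i assume "p \<in> {p. p permutes {0..<n}}" "i \<in> {0..<n}"
    then have "i < n" "p i < n" using permutes_in_image[of p "{0..<n}" i] by auto
    then show "zreg x0 (\<lambda>x. M x i (p i))" by (rule assms)
  qed
qed

lemma det_nz_inj:
  fixes M :: "nat \<Rightarrow> nat \<Rightarrow> 'a::field"
  assumes "det (mat n n (\<lambda>(i,j). M i j)) \<noteq> 0" "\<And>i. i < n \<Longrightarrow> (\<Sum>j<n. M i j * y j) = 0" "j < n"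
  shows "y j = 0"
proof (rule ccontr)
  assume "y j \<noteq> 0"
  let ?A = "mat n n (\<lambda>(i,j). M i j)" and ?v = "vec n y"
  have "?v \<noteq> 0\<^sub>v n" using \<open>y j \<noteq> 0\<close> \<open>j < n\<close> by (metis index_vec index_zero_vec(1))
  moreover have "?A *\<^sub>v ?v = 0\<^sub>v n"
    by (rule eq_vecI) (auto simp: scalar_prod_def assms(2) lessThan_atLeast0[symmetric])
  ultimately have "det ?A = 0"
    using det_0_iff_vec_prod_zero_field[of ?A n] vec_carrier[of n y] mat_carrier by blast
  with assms(1) show False by simp
qed

lemma inj_det_nz:
  fixes M :: "nat \<Rightarrow> nat \<Rightarrow> 'a::field"
  assumes "\<And>y. (\<And>i. i < n \<Longrightarrow> (\<Sum>j<n. M i j * y j) = 0) \<Longrightarrow> \<forall>j<n. y j = 0"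
  shows "det (mat n n (\<lambda>(i,j). M i j)) \<noteq> 0"
proof
  let ?A = "mat n n (\<lambda>(i,j). M i j)"
  assume "det ?A = 0"
  then obtain v where v: "v \<in> carrier_vec n" "v \<noteq> 0\<^sub>v n" "?A *\<^sub>v v = 0\<^sub>v n"
    using det_0_iff_vec_prod_zero_field[of ?A n] by auto
  have "(\<Sum>j<n. M i j * v $ j) = 0" if "i < n" for i
  proof -
    have "(?A *\<^sub>v v) $ i = 0" using v(3) that by simp
    then show ?thesis using that v(1) by (simp add: scalar_prod_def lessThan_atLeast0)
  qed
  then have "\<forall>j<n. v $ j = 0" by (rule assms)
  then have "v = 0\<^sub>v n" using v(1) by (intro eq_vecI) auto
  with v(2) show False by simp
qed

text \<open>Cramer's rule, with a determinant that is invertible near \<open>x0\<close>. The last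
  property identifies the solution at \<open>x0\<close> with an explicitly known one, so that exact
  computations at the base point apply to it.\<close>

lemma zreg_solve:
  fixes M :: "('v \<Rightarrow> 'a::field) \<Rightarrow> nat \<Rightarrow> nat \<Rightarrow> 'a"
  assumes M: "\<And>i j. i < n \<Longrightarrow> j < n \<Longrightarrow> zreg x0 (\<lambda>x. M x i j)"
    and b: "\<And>i. i < n \<Longrightarrow> zreg x0 (\<lambda>x. b x i)"
    and nz: "det (mat n n (\<lambda>(i,j). M x0 i j)) \<noteq> 0"
  obtains y where "\<And>j. zreg x0 (\<lambda>x. y x j)"
    "znear x0 (\<lambda>x. \<forall>i<n. (\<Sum>j<n. M x i j * y x j) = b x i)"
    "\<And>y' j. (\<And>i. i < n \<Longrightarrow> (\<Sum>j<n. M x0 i j * y' j) = b x0 i) \<Longrightarrow> j < n \<Longrightarrow> y x0 j = y' j"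
proof -
  define A where "A x = mat n n (\<lambda>(i,j). M x i j)" for x
  define y where "y x j = (if j < n then (\<Sum>i<n. adj_mat (A x) $$ (j,i) * b x i) / det (A x) else 0)" for x j
  have A: "A x \<in> carrier_mat n n" for x by (simp add: A_def)
  have detr: "zreg x0 (\<lambda>x. det (A x))"
    unfolding A_def using M by (rule zreg_det)
  have near: "znear x0 (\<lambda>x. det (A x) \<noteq> 0)"
    using znear_nonzero[OF detr] nz by (simp add: A_def)
  have cof: "zreg x0 (\<lambda>x. adj_mat (A x) $$ (j,i))" if "i < n" "j < n" for i j
  proof -
    have 1: "mat_delete (A x) i j = mat (n-1) (n-1) (\<lambda>(a,c). M x (if a < i then a else Suc a) (if c < j then c else Suc c))" for x
      using that unfolding mat_delete_def A_def by (intro eq_matI) auto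
    have "zreg x0 (\<lambda>x. (-1)^(i+j) * det (mat_delete (A x) i j))"
      unfolding 1 using that by (intro zreg_mult zreg_const zreg_det M) auto
    then show ?thesis using that by (simp add: adj_mat_def cofactor_def A_def)
  qed
  have "zreg x0 (\<lambda>x. y x j)" for j
    unfolding y_def using nz by (auto intro!: zreg_if zreg_const zreg_divide zreg_sum zreg_mult cof b detr simp: A_def)
  moreover have sol: "(\<Sum>j<n. M x i j * y x j) = b x i" if nz: "det (A x) \<noteq> 0" and "i < n" for x i
  proof -
    have "A x * adj_mat (A x) = det (A x) \<cdot>\<^sub>m 1\<^sub>m n" using adj_mat(2)[OF A] .
    then have "(A x * adj_mat (A x)) $$ (i,k) = (if i = k then det (A x) else 0)" if "k < n" for k
      using that \<open>i < n\<close> by simp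
    then have e: "(\<Sum>j<n. M x i j * adj_mat (A x) $$ (j,k)) = (if i = k then det (A x) else 0)" if "k < n" for k
      using that \<open>i < n\<close> adj_mat(1)[OF A, of x] by (simp add: scalar_prod_def A_def lessThan_atLeast0)
    have "(\<Sum>j<n. M x i j * y x j) * det (A x) = (\<Sum>j<n. \<Sum>k<n. M x i j * adj_mat (A x) $$ (j,k) * b x k)"
      using nz by (auto simp: y_def sum_distrib_right sum_distrib_left sum_divide_distrib mult.assoc intro!: sum.cong)
    also have "\<dots> = (\<Sum>k<n. (\<Sum>j<n. M x i j * adj_mat (A x) $$ (j,k)) * b x k)"
      by (subst sum.swap) (simp add: sum_distrib_right)
    also have "\<dots> = (\<Sum>k<n. (if i = k then det (A x) * b x k else 0))"
      by (intro sum.cong) (auto simp: e)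
    also have "\<dots> = det (A x) * b x i" using \<open>i < n\<close> by simp
    finally show ?thesis using nz by simp
  qed
  moreover have "y x0 j = y' j"
    if "\<And>i. i < n \<Longrightarrow> (\<Sum>j<n. M x0 i j * y' j) = b x0 i" "j < n" for y' j
  proof -
    have "y x0 j - y' j = 0"
      by (rule det_nz_inj[OF nz]) (use that sol[of x0] nz in \<open>auto simp: A_def right_diff_distrib sum_subtractf\<close>)
    then show ?thesis by simp
  qed
  ultimately show ?thesis using that znear_mono[OF near, of "\<lambda>x. \<forall>i<n. (\<Sum>j<n. M x i j * y x j) = b x i"] by blast
qed

text \<open>Nonzero polynomial functions have no zero divisors: restrict both to the line
  through a non-zero of either.\<close>

lemma poly_fun_line:
  fixes P :: "('v \<Rightarrow> complex) \<Rightarrow> complex"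
  assumes "poly_fun P"
  shows "\<exists>p. \<forall>z. poly p z = P (\<lambda>v. a v + z * b v)"
  using assms
proof induction
  case (pf_const c) show ?case by (rule exI[of _ "[:c:]"]) simp
next
  case (pf_var v) show ?case by (rule exI[of _ "[:a v, b v:]"]) simp
next
  case (pf_add p q)
  then obtain r s where "\<forall>z. poly r z = p (\<lambda>v. a v + z * b v)" "\<forall>z. poly s z = q (\<lambda>v. a v + z * b v)" by blast
  then show ?case by (intro exI[of _ "r + s"]) simp
next
  case (pf_mult p q)
  then obtain r s where "\<forall>z. poly r z = p (\<lambda>v. a v + z * b v)" "\<forall>z. poly s z = q (\<lambda>v. a v + z * b v)" by blast
  then show ?case by (intro exI[of _ "r * s"]) simp
qed

lemma poly_fun_common_nonzero:
  fixes P Q :: "('v \<Rightarrow> complex) \<Rightarrow> complex"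
  assumes "poly_fun P" "P \<noteq> (\<lambda>_. 0)" "poly_fun Q" "Q \<noteq> (\<lambda>_. 0)"
  obtains x where "P x \<noteq> 0" "Q x \<noteq> 0"
proof -
  obtain a b where ab: "P a \<noteq> 0" "Q b \<noteq> 0" using assms by (meson ext)
  obtain p where p: "\<And>z. poly p z = P (\<lambda>v. a v + z * (b v - a v))"
    using poly_fun_line[OF assms(1), of a "\<lambda>v. b v - a v"] by blast
  obtain q where q: "\<And>z. poly q z = Q (\<lambda>v. a v + z * (b v - a v))"
    using poly_fun_line[OF assms(3), of a "\<lambda>v. b v - a v"] by blast
  have "poly p 0 \<noteq> 0" "poly q 1 \<noteq> 0" using ab p[of 0] q[of 1] by simp_all
  then have "p * q \<noteq> 0" by auto
  then obtain z where "poly (p * q) z \<noteq> 0" using poly_all_0_iff_0[of "p * q"] by auto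
  then show ?thesis using that p q by auto
qed

section \<open>Families of polynomials with regular coefficients\<close>

text \<open>Because the degree bound holds at every point, attaining the degree m amounts to the
  nonvanishing of one regular coefficient.\<close>

definition zpoly :: "('v \<Rightarrow> 'a::field) \<Rightarrow> nat \<Rightarrow> (('v \<Rightarrow> 'a) \<Rightarrow> 'a poly) \<Rightarrow> bool" where
  "zpoly x0 m F \<longleftrightarrow> (\<forall>x. degree (F x) \<le> m) \<and> (\<forall>i. zreg x0 (\<lambda>x. coeff (F x) i))"

lemma zpoly_const:
  assumes "zreg x0 a"
  shows "zpoly x0 0 (\<lambda>x. [:a x:])"
proof -
  have "zreg x0 (\<lambda>x. coeff [:a x:] i)" for i
    using assms by (cases i) (simp_all add: zreg_const)
  then show ?thesis by (simp add: zpoly_def)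
qed

lemma zpoly_linear:
  assumes "zreg x0 a" "zreg x0 b"
  shows "zpoly x0 1 (\<lambda>x. [:a x, b x:])"
proof -
  have "zreg x0 (\<lambda>x. coeff [:a x, b x:] i)" for i
    using assms by (cases i; cases "i - 1") (simp_all add: zreg_const)
  then show ?thesis by (simp add: zpoly_def)
qed

lemma zpoly_weaken: "zpoly x0 m F \<Longrightarrow> m \<le> n \<Longrightarrow> zpoly x0 n F"
  by (auto simp: zpoly_def intro: order_trans)

lemma zpoly_add: "zpoly x0 m F \<Longrightarrow> zpoly x0 m G \<Longrightarrow> zpoly x0 m (\<lambda>x. F x + G x)"
  by (auto simp: zpoly_def intro: degree_add_le zreg_add)

lemma zpoly_diff: "zpoly x0 m F \<Longrightarrow> zpoly x0 m G \<Longrightarrow> zpoly x0 m (\<lambda>x. F x - G x)"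
  by (auto simp: zpoly_def intro: degree_diff_le zreg_diff)

lemma zpoly_mult: "zpoly x0 m F \<Longrightarrow> zpoly x0 n G \<Longrightarrow> zpoly x0 (m + n) (\<lambda>x. F x * G x)"
  by (auto simp: zpoly_def coeff_mult intro!: zreg_sum zreg_mult order_trans[OF degree_mult_le] add_mono)

lemma zpoly_pderiv:
  fixes x0 :: "'v \<Rightarrow> 'a::field_char_0"
  assumes "zpoly x0 m F"
  shows "zpoly x0 (m - 1) (\<lambda>x. pderiv (F x))"
  using assms by (auto simp: zpoly_def coeff_pderiv degree_pderiv diff_le_mono intro!: zreg_mult zreg_const
      simp del: of_nat_Suc)

lemma znear_degree:
  assumes "zpoly x0 m F" "degree (F x0) = m" "m > 0"
  shows "znear x0 (\<lambda>x. degree (F x) = m)"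
proof -
  have "znear x0 (\<lambda>x. coeff (F x) m \<noteq> 0)"
    using assms by (intro znear_nonzero) (auto simp: zpoly_def)
  then show ?thesis
    by (rule znear_mono) (use assms(1) in \<open>auto simp: zpoly_def intro: antisym le_degree\<close>)
qed

text \<open>The determinant of a Sylvester matrix of fixed format is a regular function. Both
  degrees stay exact near \<open>x0\<close>, so there this determinant is the true resultant, and
  where it is nonzero there is no common factor.\<close>

lemma znear_no_common_root:
  fixes x0 :: "'v \<Rightarrow> complex"
  assumes F: "zpoly x0 m F" "degree (F x0) = m" "m > 0"
    and G: "zpoly x0 n G" "degree (G x0) = n" "n > 0"
    and nc: "\<And>z. poly (F x0) z = 0 \<Longrightarrow> poly (G x0) z \<noteq> 0"
  shows "znear x0 (\<lambda>x. \<forall>z. poly (F x) z = 0 \<longrightarrow> poly (G x) z \<noteq> 0)"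
proof -
  define r where "r x = resultant_sub m n (F x) (G x)" for x
  have "degree (gcd (F x0) (G x0)) = 0"
  proof (rule ccontr)
    assume "degree (gcd (F x0) (G x0)) \<noteq> 0"
    then obtain z where "poly (gcd (F x0) (G x0)) z = 0"
      using fundamental_theorem_of_algebra[of "gcd (F x0) (G x0)"] by (auto simp: constant_degree)
    then have "poly (F x0) z = 0" "poly (G x0) z = 0"
      by (meson dvd_trans gcd_dvd1 gcd_dvd2 poly_eq_0_iff_dvd)+
    with nc show False by blast
  qed
  then have r0: "r x0 \<noteq> 0"
    unfolding r_def using resultant_0_gcd[of "F x0" "G x0"] F(2) G(2) by (simp add: resultant_sub)
  have "zreg x0 r"
    unfolding r_def resultant_sub_def sylvester_mat_sub_def
    by (rule zreg_det) (use F(1) G(1) in \<open>auto simp: zpoly_def intro!: zreg_if zreg_const\<close>)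
  then have "znear x0 (\<lambda>x. r x \<noteq> 0)" using r0 znear_nonzero[of x0 r] by simp
  then have "znear x0 (\<lambda>x. r x \<noteq> 0 \<and> degree (F x) = m \<and> degree (G x) = n)"
    by (intro znear_conj znear_degree[OF F] znear_degree[OF G(1,2,3)])
  then show ?thesis
  proof (rule znear_mono, intro allI impI notI)
    fix x z assume *: "r x \<noteq> 0 \<and> degree (F x) = m \<and> degree (G x) = n"
      and z: "poly (F x) z = 0" "poly (G x) z = 0"
    then have "degree (gcd (F x) (G x)) = 0"
      using resultant_0_gcd[of "F x" "G x"] by (auto simp: r_def resultant_sub)
    moreover have "[:-z,1:] dvd gcd (F x) (G x)" using z by (simp add: poly_eq_0_iff_dvd)
    moreover have "gcd (F x) (G x) \<noteq> 0" using * \<open>m > 0\<close> by auto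
    ultimately show False using dvd_imp_degree_le[of "[:-z,1:]" "gcd (F x) (G x)"] by simp
  qed
qed

lemma card_roots_squarefree:
  fixes p :: "complex poly"
  assumes "p \<noteq> 0" "\<And>z. poly p z = 0 \<Longrightarrow> poly (pderiv p) z \<noteq> 0"
  shows "card {z. poly p z = 0} = degree p"
proof -
  have sf: "rsquarefree p" using assms by (auto simp: rsquarefree_roots)
  have fin: "finite {z. poly p z = 0}" using assms(1) by (rule poly_roots_finite)
  have "degree p = degree (smult (lead_coeff p) (\<Prod>z|poly p z = 0. [:-z, 1:]))"
    using complex_poly_decompose_rsquarefree[OF sf] by simp
  also have "\<dots> = (\<Sum>z|poly p z = 0. degree [:-z, 1:])"
    using assms(1) by (subst degree_smult_eq, subst degree_prod_eq_sum_degree) auto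
  also have "\<dots> = card {z. poly p z = 0}" by simp
  finally show ?thesis by simp
qed

section \<open>Subspaces of \<open>\<complex>\<^sup>7\<close> cut out by linear functionals\<close>

definition ip :: "(nat \<Rightarrow> complex) \<Rightarrow> (nat \<Rightarrow> complex) \<Rightarrow> complex" where
  "ip w v = (\<Sum>i<7. w i * v i)"

lemma ip_add: "ip w (u + v) = ip w u + ip w v"
  by (simp add: ip_def distrib_left sum.distrib)

lemma ip_cscale: "ip w (cscale c v) = c * ip w v"
  by (simp add: ip_def cscale_def sum_distrib_left mult_ac)

lemma ip_lincomb: "ip (\<lambda>i. a * w i + b * w' i) v = a * ip w v + b * ip w' v"
  by (simp add: ip_def distrib_right sum.distrib sum_distrib_left mult.assoc)

lemma ip_zero [simp]: "ip w 0 = 0"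
  by (simp add: ip_def)

definition fd :: "(nat \<Rightarrow> complex) set \<Rightarrow> bool" where
  "fd X \<longleftrightarrow> (\<exists>B. finite B \<and> X \<subseteq> cv.span B)"

lemma fd_subset: "fd Y \<Longrightarrow> X \<subseteq> Y \<Longrightarrow> fd X"
  by (auto simp: fd_def)

lemma fd_basis:
  assumes "fd X"
  obtains B where "B \<subseteq> X" "cv.independent B" "X \<subseteq> cv.span B" "card B = cv.dim X" "finite B"
proof -
  obtain B where B: "B \<subseteq> X" "cv.independent B" "X \<subseteq> cv.span B" "card B = cv.dim X"
    using cv.basis_exists[of X] by blast
  obtain T where "finite T" "X \<subseteq> cv.span T" using assms by (auto simp: fd_def)
  then have "finite B" using cv.independent_span_bound[of T B] B by auto
  with B that show ?thesis by blast
qed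

lemma independent_card_le:
  assumes "fd X" "cv.independent C" "C \<subseteq> X"
  shows "finite C" "card C \<le> cv.dim X"
proof -
  obtain B where B: "X \<subseteq> cv.span B" "card B = cv.dim X" "finite B"
    using fd_basis[OF assms(1)] by metis
  then have "finite C \<and> card C \<le> card B"
    using cv.independent_span_bound[of B C] assms by auto
  with B show "finite C" "card C \<le> cv.dim X" by auto
qed

lemma dim_less:
  assumes "fd X" "cv.subspace Y" "Y \<subseteq> X" "v \<in> X" "v \<notin> Y"
  shows "cv.dim Y < cv.dim X"
proof -
  obtain B where B: "B \<subseteq> Y" "cv.independent B" "Y \<subseteq> cv.span B" "card B = cv.dim Y" "finite B"
    using fd_basis[OF fd_subset[OF assms(1,3)]] by metis
  have "v \<notin> cv.span B" using cv.span_minimal[OF B(1) assms(2)] assms(5) by auto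
  then have "cv.independent (insert v B)" "v \<notin> B" using B(2) by (auto simp: cv.independent_insert intro: cv.span_base)
  moreover have "insert v B \<subseteq> X" using B(1) assms(3,4) by auto
  ultimately have "card (insert v B) \<le> cv.dim X" using independent_card_le(2)[OF assms(1)] by blast
  then show ?thesis using B(4,5) \<open>v \<notin> B\<close> by simp
qed

lemma subspace_eqI:
  assumes "fd Y" "cv.subspace X" "X \<subseteq> Y" "cv.dim Y \<le> cv.dim X"
  shows "X = Y"
  using dim_less[OF assms(1,2,3)] assms(3,4) by force

lemma dim_ge_1_iff:
  assumes "fd X"
  shows "1 \<le> cv.dim X \<longleftrightarrow> (\<exists>v\<in>X. v \<noteq> 0)"
proof
  assume 1: "1 \<le> cv.dim X"
  show "\<exists>v\<in>X. v \<noteq> 0"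
  proof (rule ccontr)
    assume "\<not> ?thesis"
    then have "X \<subseteq> cv.span {}" by auto
    then have "cv.dim X \<le> card ({} :: (nat \<Rightarrow> complex) set)" by (intro cv.dim_le_card) auto
    with 1 show False by simp
  qed
next
  assume "\<exists>v\<in>X. v \<noteq> 0"
  then obtain v where "v \<in> X" "v \<noteq> 0" by blast
  then show "1 \<le> cv.dim X" using independent_card_le(2)[OF assms, of "{v}"] by simp
qed

lemma subspace_ip_kernel: "cv.subspace X \<Longrightarrow> cv.subspace {v \<in> X. ip w v = 0}"
  by (auto simp: cv.subspace_def ip_add ip_cscale)

lemma dim_ip_kernel:
  assumes "fd X" "cv.subspace X"
  shows "cv.dim X \<le> cv.dim {v \<in> X. ip w v = 0} + 1"
proof (cases "\<exists>v\<in>X. ip w v \<noteq> 0")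
  case False
  then have "{v \<in> X. ip w v = 0} = X" by auto
  then show ?thesis by simp
next
  case True
  then obtain u where u: "u \<in> X" "ip w u \<noteq> 0" by blast
  have "fd {v \<in> X. ip w v = 0}" using assms(1) by (rule fd_subset) auto
  then obtain B where B: "B \<subseteq> {v \<in> X. ip w v = 0}" "cv.independent B" "{v \<in> X. ip w v = 0} \<subseteq> cv.span B"
    "card B = cv.dim {v \<in> X. ip w v = 0}" "finite B"
    by (rule fd_basis)
  have "X \<subseteq> cv.span (insert u B)"
  proof
    fix v assume v: "v \<in> X"
    define c where "c = ip w v / ip w u"
    have "v - cscale c u \<in> {v \<in> X. ip w v = 0}"
    proof -
      have e: "v - cscale c u = v + cscale (-c) u" by (auto simp: cscale_def fun_eq_iff)
      have "v - cscale c u \<in> X" unfolding e using v u assms(2) unfolding cv.subspace_def by blast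
      moreover have "ip w (v - cscale c u) = 0" unfolding e ip_add ip_cscale using u by (simp add: c_def)
      ultimately show ?thesis by simp
    qed
    then have "v - cscale c u \<in> cv.span B" using B(3) by blast
    then show "v \<in> cv.span (insert u B)" using cv.span_breakdown_eq by blast
  qed
  then have "cv.dim X \<le> card (insert u B)" by (rule cv.dim_le_card) (use B in auto)
  also have "\<dots> \<le> card B + 1" using B(5) by (simp add: card_insert_if)
  finally show ?thesis using B(4) by simp
qed

lemma dim_ip_kernels:
  assumes "fd X" "cv.subspace X"
  shows "cv.subspace {v \<in> X. \<forall>j<k. ip (w j) v = 0} \<and>
    cv.dim X \<le> cv.dim {v \<in> X. \<forall>j<(k::nat). ip (w j) v = 0} + k"
proof (induction k)
  case 0 then show ?case using assms by simp
next
  case (Suc k)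
  let ?Y = "{v \<in> X. \<forall>j<k. ip (w j) v = 0}"
  have e: "{v \<in> X. \<forall>j<Suc k. ip (w j) v = 0} = {v \<in> ?Y. ip (w k) v = 0}"
    by (auto simp: less_Suc_eq)
  have "fd ?Y" using assms(1) by (rule fd_subset) auto
  then show ?case using dim_ip_kernel[of ?Y "w k"] Suc subspace_ip_kernel[of ?Y "w k"] unfolding e by simp
qed

lemma dim_le_if_injective:
  assumes "fd X" "cv.subspace X" "\<And>v. v \<in> X \<Longrightarrow> \<forall>j<k. ip (w j) v = 0 \<Longrightarrow> v = 0"
  shows "cv.dim X \<le> k"
proof -
  have "{v \<in> X. \<forall>j<k. ip (w j) v = 0} \<subseteq> cv.span {}" using assms(3) by auto
  then have "cv.dim {v \<in> X. \<forall>j<k. ip (w j) v = 0} \<le> card ({} :: (nat \<Rightarrow> complex) set)"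
    by (intro cv.dim_le_card) auto
  then show ?thesis using dim_ip_kernels[OF assms(1,2), of k w] by simp
qed

lemma subspace_cspace: "cv.subspace (cspace n)"
  by (auto simp: cv.subspace_def cspace_def cscale_def)

lemma fd_cspace: "fd (cspace n)" and dim_cspace_ge: "n \<le> cv.dim (cspace n)"
proof -
  let ?e = "\<lambda>k i. if i = k then 1 else (0::complex)"
  have span: "cspace n \<subseteq> cv.span (?e ` {..<n})" for n
  proof (induction n)
    case 0 then show ?case by (auto simp: cspace_def fun_eq_iff)
  next
    case (Suc n)
    show ?case
    proof
      fix v assume v: "v \<in> cspace (Suc n)"
      have "v - cscale (v n) (?e n) \<in> cspace n"
        using v by (auto simp: cspace_def cscale_def)
      then have "v - cscale (v n) (?e n) \<in> cv.span (?e ` {..<n})" using Suc by auto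
      then have "v \<in> cv.span (insert (?e n) (?e ` {..<n}))" using cv.span_breakdown_eq by blast
      then show "v \<in> cv.span (?e ` {..<Suc n})" by (simp add: lessThan_Suc)
    qed
  qed
  show fd: "fd (cspace n)" for n using span[of n] unfolding fd_def by blast
  show "n \<le> cv.dim (cspace n)"
  proof (induction n)
    case (Suc n)
    have "cv.dim (cspace n) < cv.dim (cspace (Suc n))"
      by (rule dim_less[OF fd subspace_cspace, of _ _ "?e n"]) (auto simp: cspace_def)
    with Suc show ?case by simp
  qed simp
qed

section \<open>Three by three determinants\<close>

definition d3 :: "(nat \<Rightarrow> 'a::comm_ring_1) \<Rightarrow> (nat \<Rightarrow> 'a) \<Rightarrow> (nat \<Rightarrow> 'a) \<Rightarrow> 'a" where
  "d3 a b c = a 0 * (b 1 * c 2 - b 2 * c 1) - a 1 * (b 0 * c 2 - b 2 * c 0) + a 2 * (b 0 * c 1 - b 1 * c 0)"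

lemma less_3_iff: "k < (3::nat) \<longleftrightarrow> k = 0 \<or> k = 1 \<or> k = 2"
  by auto

lemma sum_less_3: "(\<Sum>k<(3::nat). f k) = f 0 + f 1 + (f 2 :: 'a::comm_monoid_add)"
  by (simp add: numeral_eq_Suc)

lemma d3_kernel:
  fixes a b c z :: "nat \<Rightarrow> complex"
  assumes "\<exists>k<3. z k \<noteq> 0" "(\<Sum>k<3. a k * z k) = 0" "(\<Sum>k<3. b k * z k) = 0" "(\<Sum>k<3. c k * z k) = 0"
  shows "d3 a b c = 0"
proof -
  have e: "a 0 * z 0 + a 1 * z 1 + a 2 * z 2 = 0" "b 0 * z 0 + b 1 * z 1 + b 2 * z 2 = 0"
    "c 0 * z 0 + c 1 * z 1 + c 2 * z 2 = 0" using assms(2-4) by (simp_all add: sum_less_3)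
  have "d3 a b c * z 0 = 0" unfolding d3_def using e by Groebner_Basis.algebra
  moreover have "d3 a b c * z 1 = 0" unfolding d3_def using e by Groebner_Basis.algebra
  moreover have "d3 a b c * z 2 = 0" unfolding d3_def using e by Groebner_Basis.algebra
  ultimately show ?thesis using assms(1) by (auto simp: less_3_iff)
qed

text \<open>Serves the rank one case of \<open>d3_eq_0_kernel_aux\<close>; being parallel to the
  nonzero vector is expressed by vanishing 2 by 2 minors.\<close>

lemma parallel_kernel:
  fixes n0 n1 n2 :: complex
  assumes "n0 \<noteq> 0 \<or> n1 \<noteq> 0 \<or> n2 \<noteq> 0"
  obtains x y z where "x \<noteq> 0 \<or> y \<noteq> 0 \<or> z \<noteq> 0"
    "\<And>u0 u1 u2. u0 * n1 = u1 * n0 \<Longrightarrow> u0 * n2 = u2 * n0 \<Longrightarrow> u1 * n2 = u2 * n1 \<Longrightarrow> u0 * x + u1 * y + u2 * z = 0"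
proof (cases "n0 = 0 \<and> n1 = 0")
  case True
  then have "n2 \<noteq> 0" using assms by simp
  then show ?thesis using that[of 1 0 0] True by simp
next
  case False
  then show ?thesis using that[of "- n1" n0 0] by auto
qed

text \<open>A nonzero cross product of two rows is orthogonal to these rows, and to the third one
  because the determinant vanishes. If all cross products vanish, either some nonzero row has the
  others parallel to it or all rows are zero.\<close>

lemma d3_eq_0_kernel_aux:
  fixes a0 a1 a2 b0 b1 b2 c0 c1 c2 :: complex
  assumes d: "a0 * (b1 * c2 - b2 * c1) - a1 * (b0 * c2 - b2 * c0) + a2 * (b0 * c1 - b1 * c0) = 0"
  shows "\<exists>x y z. (x \<noteq> 0 \<or> y \<noteq> 0 \<or> z \<noteq> 0) \<and> a0 * x + a1 * y + a2 * z = 0 \<and>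
    b0 * x + b1 * y + b2 * z = 0 \<and> c0 * x + c1 * y + c2 * z = 0"
proof -
  let ?K = "\<lambda>x y z. a0 * x + a1 * y + a2 * z = 0 \<and> b0 * x + b1 * y + b2 * z = 0 \<and> c0 * x + c1 * y + c2 * z = 0"
  have cross1: "?K (b1 * c2 - b2 * c1) (b2 * c0 - b0 * c2) (b0 * c1 - b1 * c0)"
    using d by (simp add: algebra_simps)
  have cross2: "?K (a1 * c2 - a2 * c1) (a2 * c0 - a0 * c2) (a0 * c1 - a1 * c0)"
    using d by (simp add: algebra_simps)
  have cross3: "?K (a1 * b2 - a2 * b1) (a2 * b0 - a0 * b2) (a0 * b1 - a1 * b0)"
    using d by (simp add: algebra_simps)
  show ?thesis
  proof (cases "b1 * c2 - b2 * c1 = 0 \<and> b2 * c0 - b0 * c2 = 0 \<and> b0 * c1 - b1 * c0 = 0 \<and>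
      a1 * c2 - a2 * c1 = 0 \<and> a2 * c0 - a0 * c2 = 0 \<and> a0 * c1 - a1 * c0 = 0 \<and>
      a1 * b2 - a2 * b1 = 0 \<and> a2 * b0 - a0 * b2 = 0 \<and> a0 * b1 - a1 * b0 = 0")
    case False
    then show ?thesis using cross1 cross2 cross3 by blast
  next
    case True
    then have par: "b1 * c2 = b2 * c1" "b0 * c2 = b2 * c0" "b0 * c1 = b1 * c0"
      "a1 * c2 = a2 * c1" "a0 * c2 = a2 * c0" "a0 * c1 = a1 * c0"
      "a1 * b2 = a2 * b1" "a0 * b2 = a2 * b0" "a0 * b1 = a1 * b0"
      "c1 * b2 = c2 * b1" "c0 * b2 = c2 * b0" "c0 * b1 = c1 * b0"
      "c1 * a2 = c2 * a1" "c0 * a2 = c2 * a0" "c0 * a1 = c1 * a0"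
      "b1 * a2 = b2 * a1" "b0 * a2 = b2 * a0" "b0 * a1 = b1 * a0"
      by (auto simp: mult.commute)
    have ker: "\<exists>x y z. (x \<noteq> 0 \<or> y \<noteq> 0 \<or> z \<noteq> 0) \<and> p0 * x + p1 * y + p2 * z = 0 \<and> q0 * x + q1 * y + q2 * z = 0 \<and> r0 * x + r1 * y + r2 * z = 0"
      if p: "p0 \<noteq> 0 \<or> p1 \<noteq> 0 \<or> p2 \<noteq> 0" and q: "q0 * p1 = q1 * p0" "q0 * p2 = q2 * p0" "q1 * p2 = q2 * p1"
        and r: "r0 * p1 = r1 * p0" "r0 * p2 = r2 * p0" "r1 * p2 = r2 * p1" for p0 p1 p2 q0 q1 q2 r0 r1 r2 :: complex
    proof -
      obtain x y z where nz: "x \<noteq> 0 \<or> y \<noteq> 0 \<or> z \<noteq> 0"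
        and u: "\<And>u0 u1 u2. u0 * p1 = u1 * p0 \<Longrightarrow> u0 * p2 = u2 * p0 \<Longrightarrow> u1 * p2 = u2 * p1 \<Longrightarrow> u0 * x + u1 * y + u2 * z = 0"
        using parallel_kernel[OF p] by blast
      have "p0 * x + p1 * y + p2 * z = 0" by (rule u) (simp_all add: mult.commute)
      with nz u[OF q] u[OF r] show ?thesis by blast
    qed
    consider "a0 \<noteq> 0 \<or> a1 \<noteq> 0 \<or> a2 \<noteq> 0" | "b0 \<noteq> 0 \<or> b1 \<noteq> 0 \<or> b2 \<noteq> 0" | "c0 \<noteq> 0 \<or> c1 \<noteq> 0 \<or> c2 \<noteq> 0"
      | "a0 = 0" "a1 = 0" "a2 = 0" "b0 = 0" "b1 = 0" "b2 = 0" "c0 = 0" "c1 = 0" "c2 = 0" by blast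
    then show ?thesis
    proof cases
      case 1 show ?thesis by (rule ker[OF 1]) (fact par)+
    next
      case 2
      have "\<exists>x y z. (x \<noteq> 0 \<or> y \<noteq> 0 \<or> z \<noteq> 0) \<and> b0 * x + b1 * y + b2 * z = 0 \<and> a0 * x + a1 * y + a2 * z = 0 \<and> c0 * x + c1 * y + c2 * z = 0"
        by (rule ker[OF 2]) (fact par)+
      then show ?thesis by blast
    next
      case 3
      have "\<exists>x y z. (x \<noteq> 0 \<or> y \<noteq> 0 \<or> z \<noteq> 0) \<and> c0 * x + c1 * y + c2 * z = 0 \<and> a0 * x + a1 * y + a2 * z = 0 \<and> b0 * x + b1 * y + b2 * z = 0"
        by (rule ker[OF 3]) (fact par)+
      then show ?thesis by blast
    next
      case 4
      then show ?thesis by (intro exI[of _ 1]) auto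
    qed
  qed
qed

lemma d3_eq_0_kernel:
  fixes a b c :: "nat \<Rightarrow> complex"
  assumes "d3 a b c = 0"
  obtains z where "\<exists>k<3. z k \<noteq> 0" "(\<Sum>k<3. a k * z k) = 0" "(\<Sum>k<3. b k * z k) = 0" "(\<Sum>k<3. c k * z k) = 0"
proof -
  obtain x y z where *: "x \<noteq> 0 \<or> y \<noteq> 0 \<or> z \<noteq> 0" "a 0 * x + a 1 * y + a 2 * z = 0"
    "b 0 * x + b 1 * y + b 2 * z = 0" "c 0 * x + c 1 * y + c 2 * z = 0"
    using d3_eq_0_kernel_aux[OF assms[unfolded d3_def]] by blast
  let ?z = "\<lambda>k::nat. if k = 0 then x else if k = 1 then y else (z::complex)"
  show ?thesis
  proof (rule that)
    show "\<exists>k<3. ?z k \<noteq> 0" using *(1)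
      by (elim disjE) (rule exI[of _ 0], simp, rule exI[of _ 1], simp, rule exI[of _ 2], simp)
  qed (use * in \<open>auto simp: sum_less_3\<close>)
qed

section \<open>Elimination\<close>

text \<open>The three bilinear equations \<open>A3 + B3 y1 + C3 y2 + y1 y2 = 0\<close>,
  \<open>A2 + B2 y1 + C2 y3 + y1 y3 = 0\<close>, \<open>A1 + B1 y2 + C1 y3 + y2 y3 = 0\<close> have in general two
  common solutions; \<open>yi\<close> runs over the roots of \<open>Gi y^2 + ei y + fi\<close>, and \<open>Gi yi\<close> differs from
  \<open>G3 y3\<close> by a constant.  The polynomial \<open>elim_res\<close> is \<open>G1 G2 G3\<close> times the product of the values of
  \<open>K0 + K1 y1 + K2 y2 + K3 y3\<close> at these two solutions.\<close>

locale elim =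
  fixes A1 B1 C1 A2 B2 C2 A3 B3 C3 :: "'a::comm_ring_1"
begin

definition G1 where "G1 = B1 * B3 + C1 * B2 - B3 * B2 - A1"
definition G2 where "G2 = B2 * C3 + C2 * B1 - C3 * B1 - A2"
definition G3 where "G3 = B3 * C2 + C3 * C1 - C2 * C1 - A3"
definition k1 where "k1 = B3 * A2 + C3 * A1 - B2 * A3 - C2 * A1"
definition k2 where "k2 = B3 * A2 + C3 * A1 - B1 * A3 - C1 * A2"
definition e3 where "e3 = B2 * G3 + C2 * G1 + k2"
definition e2 where "e2 = e3 - (k1 + k1)"
definition e1 where "e1 = e3 - (k2 + k2)"
definition f3 where "f3 = B3 * A2 * B1 + C3 * A1 * B2 - A3 * B1 * B2 - A1 * A2"
definition f2 where "f2 = B2 * A3 * C1 + C2 * A1 * B3 - A2 * B3 * C1 - A3 * A1"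
definition f1 where "f1 = B1 * A3 * C2 + C1 * A2 * C3 - A1 * C2 * C3 - A2 * A3"
definition h12 where "h12 = f3 * G3 + f3 * G3 - (k1 + k2) * e3 + (k1 * k2 + k1 * k2)"
definition h13 where "h13 = f3 * G3 + f3 * G3 - k2 * e3"
definition h23 where "h23 = f3 * G3 + f3 * G3 - k1 * e3"

definition elim_res where
  "elim_res K0 K1 K2 K3 = K0 * K0 * (G1 * G2 * G3)
     + K3 * K3 * (f3 * G1 * G2) + K2 * K2 * (f2 * G1 * G3) + K1 * K1 * (f1 * G2 * G3)
     - K0 * (K3 * (e3 * G1 * G2) + K2 * (e2 * G1 * G3) + K1 * (e1 * G2 * G3))
     + K1 * K2 * (G3 * h12) + K1 * K3 * (G2 * h13) + K2 * K3 * (G1 * h23)"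

definition elim_lin where
  "elim_lin K1 K2 K3 = K1 * (G2 * G3) + K2 * (G1 * G3) + K3 * (G1 * G2)"

lemmas defs = G1_def G2_def G3_def k1_def k2_def e3_def e2_def e1_def f3_def f2_def f1_def h12_def h13_def h23_def

end

locale elim_field = elim A1 B1 C1 A2 B2 C2 A3 B3 C3
  for A1 B1 C1 A2 B2 C2 A3 B3 C3 :: "'a::field"
begin

text \<open>If Y and Y' are the two values of \<open>G3 * y3\<close>, with sum \<open>- e3\<close>
  and product \<open>f3 * G3\<close>, the right side is the product of the shifted values Y +
  \<open>k2\<close> and Y' + \<open>k2\<close>, which are the two values of
  \<open>G1 * y1\<close>.\<close>

lemma f1_G1: "f1 * G1 = f3 * G3 - e3 * k2 + k2 * k2"
  unfolding defs by Groebner_Basis.algebra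

lemma f2_G2: "f2 * G2 = f3 * G3 - e3 * k1 + k1 * k1"
  unfolding defs by Groebner_Basis.algebra

context
  fixes y1 y2 y3
  assumes D: "A3 + B3 * y1 + C3 * y2 + y1 * y2 = 0" "A2 + B2 * y1 + C2 * y3 + y1 * y3 = 0"
    "A1 + B1 * y2 + C1 * y3 + y2 * y3 = 0"
begin

lemma G_y: "G1 * y1 = G3 * y3 + k2" "G2 * y2 = G3 * y3 + k1"
  unfolding defs using D by Groebner_Basis.algebra+

lemma quadratics:
  "f3 = - y3 * (G3 * y3 + e3)" "f2 = - y2 * (G2 * y2 + e2)" "f1 = - y1 * (G1 * y1 + e1)"
  unfolding defs using D by Groebner_Basis.algebra+

lemma elim_res_eq_0:
  assumes L: "K0 + K1 * y1 + K2 * y2 + K3 * y3 = 0"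
  shows "elim_res K0 K1 K2 K3 = 0"
proof -
  \<comment> \<open>By Vieta \<open>wi\<close> is \<open>Gi\<close> times the other root of the i-th
    quadratic. The second factor in the final product is therefore the linear form at the conjugate
    solution, cleared of denominators.\<close>
  define w3 where "w3 = - e3 - G3 * y3"
  define w2 where "w2 = - e2 - G2 * y2"
  define w1 where "w1 = - e1 - G1 * y1"
  have e: "e3 = - (G3 * y3 + w3)" "e2 = - (G2 * y2 + w2)" "e1 = - (G1 * y1 + w1)"
    by (simp_all add: w1_def w2_def w3_def)
  have f: "f3 = y3 * w3" "f2 = y2 * w2" "f1 = y1 * w1"
    unfolding w1_def w2_def w3_def using quadratics by Groebner_Basis.algebra+
  have w: "w1 = w3 + k2" "w2 = w3 + k1"
    using G_y by (simp_all add: w1_def w2_def w3_def e1_def e2_def algebra_simps)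
  have h: "h12 = G1 * y1 * w2 + G2 * y2 * w1" "h13 = G1 * y1 * w3 + G3 * y3 * w1" "h23 = G2 * y2 * w3 + G3 * y3 * w2"
    unfolding h12_def h13_def h23_def f(1) e(1) w G_y by (simp_all add: algebra_simps)
  have "elim_res K0 K1 K2 K3 = (K0 + K1 * y1 + K2 * y2 + K3 * y3) *
    (K0 * (G1 * G2 * G3) + K1 * w1 * (G2 * G3) + K2 * w2 * (G1 * G3) + K3 * w3 * (G1 * G2))"
    unfolding elim_res_def h e f by (simp add: algebra_simps)
  with L show ?thesis by simp
qed

lemma elim_y3:
  assumes L: "K0 + K1 * y1 + K2 * y2 + K3 * y3 = 0"
  shows "elim_lin K1 K2 K3 * y3 = - (K0 * G1 * G2 + K1 * k2 * G2 + K2 * k1 * G1)"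
  using L G_y unfolding elim_lin_def by Groebner_Basis.algebra

end

text \<open>Expressing \<open>y1\<close> and \<open>y2\<close> through \<open>y3\<close> turns the
  linear equation into \<open>m * y3 + n = 0\<close>. Up to the factor \<open>G1 * G2\<close> the
  eliminant is the quadratic for \<open>y3\<close>, homogenised at (- n : m), so the common root is
  - n / m and no square root has to be extracted.\<close>

lemma elim_solve:
  assumes R: "elim_res K0 K1 K2 K3 = 0" and G: "G1 \<noteq> 0" "G2 \<noteq> 0" "G3 \<noteq> 0" and m: "elim_lin K1 K2 K3 \<noteq> 0"
  obtains y1 y2 y3 where "A3 + B3 * y1 + C3 * y2 + y1 * y2 = 0" "A2 + B2 * y1 + C2 * y3 + y1 * y3 = 0"
    "A1 + B1 * y2 + C1 * y3 + y2 * y3 = 0" "K0 + K1 * y1 + K2 * y2 + K3 * y3 = 0"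
proof -
  define m where "m = elim_lin K1 K2 K3"
  define n where "n = K0 * G1 * G2 + K1 * k2 * G2 + K2 * k1 * G1"
  define y3 where "y3 = - n / m"
  define y2 where "y2 = (G3 * y3 + k1) / G2"
  define y1 where "y1 = (G3 * y3 + k2) / G1"
  have y1: "G1 * y1 = G3 * y3 + k2" and y2: "G2 * y2 = G3 * y3 + k1" and y3: "m * y3 = - n"
    using G m by (simp_all add: y1_def y2_def y3_def m_def)
  have "G1 * G2 * elim_res K0 K1 K2 K3 = G3 * n\<^sup>2 - e3 * n * m + f3 * m\<^sup>2"
    unfolding elim_res_def m_def elim_lin_def n_def h12_def h13_def h23_def e1_def e2_def
    using f1_G1 f2_G2 by Groebner_Basis.algebra
  then have "m\<^sup>2 * (G3 * y3\<^sup>2 + e3 * y3 + f3) = 0"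
    using R y3 by Groebner_Basis.algebra
  then have Q: "G3 * y3\<^sup>2 + e3 * y3 + f3 = 0" using assms(5) by (simp add: m_def)
  have "G1 * (A2 + B2 * y1 + C2 * y3 + y1 * y3) = G3 * y3\<^sup>2 + e3 * y3 + f3"
    using y1 unfolding defs by Groebner_Basis.algebra
  then have D2: "A2 + B2 * y1 + C2 * y3 + y1 * y3 = 0" using Q G by simp
  have "G2 * (A1 + B1 * y2 + C1 * y3 + y2 * y3) = G3 * y3\<^sup>2 + e3 * y3 + f3"
    using y2 unfolding defs by Groebner_Basis.algebra
  then have D1: "A1 + B1 * y2 + C1 * y3 + y2 * y3 = 0" using Q G by simp
  have "G1 * G2 * (A3 + B3 * y1 + C3 * y2 + y1 * y2) =
      (G3 * y3)\<^sup>2 + (G2 * B3 + G1 * C3 + k1 + k2) * (G3 * y3) + (G1 * G2 * A3 + G2 * B3 * k2 + G1 * C3 * k1 + k1 * k2)"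
    using y1 y2 by Groebner_Basis.algebra
  also have "G2 * B3 + G1 * C3 + k1 + k2 = e3" unfolding defs by Groebner_Basis.algebra
  also have "G1 * G2 * A3 + G2 * B3 * k2 + G1 * C3 * k1 + k1 * k2 = G3 * f3" unfolding defs by Groebner_Basis.algebra
  also have "(G3 * y3)\<^sup>2 + e3 * (G3 * y3) + G3 * f3 = G3 * (G3 * y3\<^sup>2 + e3 * y3 + f3)" by Groebner_Basis.algebra
  finally have "G1 * G2 * (A3 + B3 * y1 + C3 * y2 + y1 * y2) = G3 * (G3 * y3\<^sup>2 + e3 * y3 + f3)" .
  then have D3: "A3 + B3 * y1 + C3 * y2 + y1 * y2 = 0" using Q G by simp
  have "G1 * G2 * (K0 + K1 * y1 + K2 * y2 + K3 * y3) = m * y3 + n"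
    using y1 y2 unfolding m_def n_def elim_lin_def by Groebner_Basis.algebra
  then have "K0 + K1 * y1 + K2 * y2 + K3 * y3 = 0" using y3 G by simp
  then show ?thesis by (rule that[OF D3 D2 D1])
qed

end

section \<open>The Schubert problem as a system of four multilinear equations\<close>

lemma mem_schubert_intersection_iff:
  assumes "\<And>j. j < 4 \<Longrightarrow> F j 7 = cspace 7"
  shows "X \<in> schubert_intersection 3 7 (replicate 4 [1,3,5]) F \<longleftrightarrow>
    cv.subspace X \<and> X \<subseteq> cspace 7 \<and> cv.dim X = 3 \<and>
    (\<forall>j<4. 2 \<le> cv.dim (X \<inter> F j 5) \<and> 1 \<le> cv.dim (X \<inter> F j 3))"
proof -
  have 1: "{1..3::nat} = {1,2,3}" by auto
  have 2: "(\<forall>i\<in>{1..3}. 3 + 1 - i \<le> cv.dim (X \<inter> K (7 + 1 - [1,3,5] ! (i - 1)))) \<longleftrightarrow>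
    3 \<le> cv.dim (X \<inter> K 7) \<and> 2 \<le> cv.dim (X \<inter> K 5) \<and> 1 \<le> cv.dim (X \<inter> K 3)" for K :: "nat \<Rightarrow> _"
    unfolding 1 by simp
  have 3: "X \<in> schubert_var 3 7 [1,3,5] (F j) \<longleftrightarrow>
    X \<in> Grass 3 7 \<and> 2 \<le> cv.dim (X \<inter> F j 5) \<and> 1 \<le> cv.dim (X \<inter> F j 3)" if "j < 4" for j
    unfolding schubert_var_def mem_Collect_eq 2 using assms[OF that] by (auto simp: Grass_def Int_absorb2)
  show ?thesis
    unfolding schubert_intersection_def using 3 by (auto simp: Grass_def)
qed

lemma d3_add_scale:
  "d3 (\<lambda>k. a1 * u1 k + b1 * v1 k) (\<lambda>k. a2 * u2 k + b2 * v2 k) (\<lambda>k. a3 * u3 k + b3 * v3 k) =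
    a1 * a2 * a3 * d3 u1 u2 u3 + b1 * a2 * a3 * d3 v1 u2 u3 + a1 * b2 * a3 * d3 u1 v2 u3
    + a1 * a2 * b3 * d3 u1 u2 v3 + b1 * b2 * a3 * d3 v1 v2 u3 + b1 * a2 * b3 * d3 v1 u2 v3
    + a1 * b2 * b3 * d3 u1 v2 v3 + b1 * b2 * b3 * d3 v1 v2 v3"
  unfolding d3_def by (simp add: algebra_simps)

lemma subspace_kernel: "cv.subspace {v \<in> cspace n. \<forall>j<(k::nat). ip (w j) v = 0}"
  using dim_ip_kernels[OF fd_cspace[of n] subspace_cspace[of n], of k w] by simp

locale four_flags =
  fixes g :: "nat \<Rightarrow> nat \<Rightarrow> nat \<Rightarrow> complex" and lam mu :: "nat \<Rightarrow> nat \<Rightarrow> complex"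
  assumes K7: "\<And>j. j < 4 \<Longrightarrow> flag_of_matrix 7 (g j) 7 = cspace 7"
    and K5: "\<And>j v. j < 4 \<Longrightarrow> v \<in> cspace 7 \<Longrightarrow>
      v \<in> flag_of_matrix 7 (g j) 5 \<longleftrightarrow> ip (lam j) v = 0 \<and> ip (mu j) v = 0"
    and rows_indep: "\<And>j z k. j < 4 \<Longrightarrow> (\<Sum>k<3. cscale (z k) (row_vec 7 (g j) k)) = 0 \<Longrightarrow> k < 3 \<Longrightarrow> z k = 0"
begin

abbreviation grow where "grow j k \<equiv> row_vec 7 (g j) k"
abbreviation S where "S \<equiv> schubert_intersection 3 7 (replicate 4 [1,3,5]) (\<lambda>j. flag_of_matrix 7 (g j))"

definition L where "L j i k = ip (lam i) (grow j k)"
definition M where "M j i k = ip (mu i) (grow j k)"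

lemma row_cspace: "grow j k \<in> cspace 7"
  by (simp add: row_vec_def cspace_def)

lemma sum_row_cspace: "(\<Sum>k<3. cscale (z k) (grow j k)) \<in> cspace 7"
  by (rule cv.subspace_sum[OF subspace_cspace]) (metis cv.subspace_scale row_cspace subspace_cspace)

lemma K3: "v \<in> flag_of_matrix 7 (g j) 3 \<longleftrightarrow> (\<exists>z. v = (\<Sum>k<3. cscale (z k) (grow j k)))"
proof
  let ?V = "{\<Sum>k<3. cscale (z k) (grow j k) |z. True}"
  have "cv.subspace ?V"
  proof (rule cv.subspaceI)
    show "0 \<in> ?V" by (auto intro!: exI[of _ "\<lambda>k. 0"])
    fix x y c assume "x \<in> ?V" "y \<in> ?V"
    then obtain z z' where z: "x = (\<Sum>k<3. cscale (z k) (grow j k))" "y = (\<Sum>k<3. cscale (z' k) (grow j k))" by blast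
    have "x + y = (\<Sum>k<3. cscale (z k + z' k) (grow j k))"
      unfolding z by (simp add: cv.scale_left_distrib sum.distrib)
    then show "x + y \<in> ?V" by (auto intro!: exI[of _ "\<lambda>k. z k + z' k"])
    have "cscale c x = (\<Sum>k<3. cscale (c * z k) (grow j k))"
      unfolding z by (simp add: cv.scale_sum_right)
    then show "cscale c x \<in> ?V" by (auto intro!: exI[of _ "\<lambda>k. c * z k"])
  qed
  moreover have "{grow j r |r. r < 3} \<subseteq> ?V"
  proof clarify
    fix r :: nat assume "r < 3"
    have "grow j r = (\<Sum>k<3. cscale (if k = r then 1 else 0) (grow j k))"
      using \<open>r < 3\<close> by (auto simp: sum_less_3 less_3_iff)
    then show "\<exists>z. grow j r = (\<Sum>k<3. cscale (z k) (grow j k)) \<and> True"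
      by (intro exI[of _ "\<lambda>k. if k = r then 1 else 0"]) simp
  qed
  ultimately have "flag_of_matrix 7 (g j) 3 \<subseteq> ?V"
    unfolding flag_of_matrix_def by (rule cv.span_minimal[rotated])
  moreover assume "v \<in> flag_of_matrix 7 (g j) 3"
  ultimately show "\<exists>z. v = (\<Sum>k<3. cscale (z k) (grow j k))" by blast
next
  assume "\<exists>z. v = (\<Sum>k<3. cscale (z k) (grow j k))"
  then obtain z where "v = (\<Sum>k<3. cscale (z k) (grow j k))" ..
  moreover have "(\<Sum>k<3. cscale (z k) (grow j k)) \<in> flag_of_matrix 7 (g j) 3"
    unfolding flag_of_matrix_def by (intro cv.span_sum cv.span_scale cv.span_base) auto
  ultimately show "v \<in> flag_of_matrix 7 (g j) 3" by simp
qed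

lemma ip_sum_row: "ip w (\<Sum>k<3. cscale (z k) (grow j k)) = (\<Sum>k<3. ip w (grow j k) * z k)"
  by (simp add: sum_less_3 ip_add ip_cscale mult.commute)

lemma LM_diag:
  assumes "j < 4" "k < 3"
  shows "L j j k = 0" "M j j k = 0"
proof -
  have "grow j k \<in> flag_of_matrix 7 (g j) 5"
    unfolding flag_of_matrix_def using assms by (intro cv.span_base) auto
  then show "L j j k = 0" "M j j k = 0" using K5[OF assms(1) row_cspace] by (auto simp: L_def M_def)
qed

lemma K3_witness:
  assumes "fd X" "1 \<le> cv.dim (X \<inter> flag_of_matrix 7 (g j) 3)"
  obtains z where "(\<Sum>k<3. cscale (z k) (grow j k)) \<in> X" "\<exists>k<3. z k \<noteq> 0"
proof -
  have "fd (X \<inter> flag_of_matrix 7 (g j) 3)" using assms(1) by (rule fd_subset) auto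
  then obtain v where v: "v \<in> X" "v \<in> flag_of_matrix 7 (g j) 3" "v \<noteq> 0" using assms(2) dim_ge_1_iff by auto
  then obtain z where z: "v = (\<Sum>k<3. cscale (z k) (grow j k))" using K3 by blast
  have "\<exists>k<3. z k \<noteq> 0"
  proof (rule ccontr)
    assume "\<not> ?thesis"
    then have "v = 0" unfolding z by (intro sum.neutral) auto
    then show False using v(3) by simp
  qed
  with v(1) that show ?thesis unfolding z by blast
qed

text \<open>The hyperplane of index j contains the 5-dimensional and hence the 3-dimensional member
  of flag j. Only the other three hyperplanes restrict the latter, and this is their determinant in
  the basis \<open>grow j\<close>.\<close>

definition Dh where
  "Dh j i1 i2 i3 a b = d3 (\<lambda>k. a i1 * L j i1 k + b i1 * M j i1 k)
    (\<lambda>k. a i2 * L j i2 k + b i2 * M j i2 k) (\<lambda>k. a i3 * L j i3 k + b i3 * M j i3 k)"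

text \<open>If the pair \<open>lam j\<close>, \<open>mu j\<close> has a kernel of dimension at least
  2 on the 3-dimensional X, its rank there is at most 1, so a member of the pencil vanishes on
  X.\<close>

lemma S_dest:
  assumes "X \<in> S"
  obtains a b where "\<And>j. j < 4 \<Longrightarrow> a j \<noteq> 0 \<or> b j \<noteq> 0"
    "\<And>j v. j < 4 \<Longrightarrow> v \<in> X \<Longrightarrow> a j * ip (lam j) v + b j * ip (mu j) v = 0"
    "\<And>j i1 i2 i3. j < 4 \<Longrightarrow> i1 < 4 \<Longrightarrow> i2 < 4 \<Longrightarrow> i3 < 4 \<Longrightarrow> Dh j i1 i2 i3 a b = 0"
proof -
  have X: "cv.subspace X" "X \<subseteq> cspace 7" "cv.dim X = 3"
    "\<And>j. j < 4 \<Longrightarrow> 2 \<le> cv.dim (X \<inter> flag_of_matrix 7 (g j) 5)" "\<And>j. j < 4 \<Longrightarrow> 1 \<le> cv.dim (X \<inter> flag_of_matrix 7 (g j) 3)"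
    using assms K7 by (subst (asm) mem_schubert_intersection_iff; simp)+
  have fdX: "fd X" using fd_cspace X(2) by (rule fd_subset)
  have "\<exists>a b. (a \<noteq> 0 \<or> b \<noteq> 0) \<and> (\<forall>v\<in>X. a * ip (lam j) v + b * ip (mu j) v = 0)" if j: "j < 4" for j
  proof (cases "\<forall>v\<in>X. ip (lam j) v = 0")
    case True
    then show ?thesis by (intro exI[of _ 1] exI[of _ 0]) simp
  next
    case False
    then obtain u where u: "u \<in> X" "ip (lam j) u \<noteq> 0" by blast
    let ?Y = "{v \<in> X. ip (lam j) v = 0}"
    have Y: "cv.subspace ?Y" by (rule subspace_ip_kernel[OF X(1)])
    have fdY: "fd ?Y" using fdX by (rule fd_subset) auto
    have dY: "cv.dim ?Y < cv.dim X" by (rule dim_less[OF fdX Y _ u(1)]) (use u in auto)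
    have e: "X \<inter> flag_of_matrix 7 (g j) 5 = {v \<in> ?Y. ip (mu j) v = 0}"
      using K5[OF j] X(2) by auto
    have "ip (mu j) v = 0" if v: "v \<in> ?Y" for v
    proof (rule ccontr)
      assume "ip (mu j) v \<noteq> 0"
      then have "cv.dim (X \<inter> flag_of_matrix 7 (g j) 5) < cv.dim ?Y"
        unfolding e by (intro dim_less[OF fdY subspace_ip_kernel[OF Y], of _ v]) (use v in auto)
      then show False using X(4)[OF j] X(3) dY by simp
    qed
    note muY = this
    define c where "c = ip (mu j) u / ip (lam j) u"
    have "- c * ip (lam j) v + 1 * ip (mu j) v = 0" if v: "v \<in> X" for v
    proof -
      define d where "d = ip (lam j) v / ip (lam j) u"
      have "v + cscale (- d) u \<in> X" using X(1) v u(1) unfolding cv.subspace_def by blast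
      moreover have "ip (lam j) (v + cscale (- d) u) = 0" unfolding ip_add ip_cscale using u by (simp add: d_def)
      ultimately have "ip (mu j) (v + cscale (- d) u) = 0" by (intro muY) simp
      then show ?thesis unfolding ip_add ip_cscale c_def d_def using u by (simp add: field_simps)
    qed
    then show ?thesis by (intro exI[of _ "- c"] exI[of _ 1]) simp
  qed
  then obtain a b where ab: "\<And>j. j < 4 \<Longrightarrow> a j \<noteq> 0 \<or> b j \<noteq> 0"
    "\<And>j v. j < 4 \<Longrightarrow> v \<in> X \<Longrightarrow> a j * ip (lam j) v + b j * ip (mu j) v = 0"
    by metis
  have "Dh j i1 i2 i3 a b = 0" if j: "j < 4" and i: "i1 < 4" "i2 < 4" "i3 < 4" for j i1 i2 i3
  proof -
    obtain z where z: "(\<Sum>k<3. cscale (z k) (grow j k)) \<in> X" "\<exists>k<3. z k \<noteq> 0" by (rule K3_witness[OF fdX X(5)[OF j]])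
    have "(\<Sum>k<3. (a i * L j i k + b i * M j i k) * z k) = 0" if "i < 4" for i
      using ab(2)[OF that z(1)] unfolding ip_sum_row L_def M_def
      by (simp add: sum_less_3 algebra_simps)
    with z(2) show ?thesis unfolding Dh_def using i by (intro d3_kernel) auto
  qed
  with ab that show ?thesis by blast
qed

text \<open>Four hyperplanes leave dimension at least 3, and the three functionals \<open>w\<close>
  without common zero on X bound it by 3. Since one combination of \<open>lam j\<close> and
  \<open>mu j\<close> already vanishes on X, the 5-dimensional member of flag j imposes a single
  further equation, whence dimension at least 2.\<close>

lemma S_intro:
  assumes ab: "\<And>j. j < 4 \<Longrightarrow> a j \<noteq> 0 \<or> b j \<noteq> 0"
    and X: "X = {v \<in> cspace 7. \<forall>j<4. a j * ip (lam j) v + b j * ip (mu j) v = 0}"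
    and w: "\<And>v. v \<in> X \<Longrightarrow> \<forall>j<(3::nat). ip (w j) v = 0 \<Longrightarrow> v = 0"
    and D: "Dh 0 1 2 3 a b = 0" "Dh 1 0 2 3 a b = 0" "Dh 2 0 1 3 a b = 0" "Dh 3 0 1 2 a b = 0"
  shows "X \<in> S"
proof -
  let ?p = "\<lambda>j i. a j * lam j i + b j * mu j i"
  have ipp: "ip (?p j) v = a j * ip (lam j) v + b j * ip (mu j) v" for j v by (rule ip_lincomb)
  have X': "X = {v \<in> cspace 7. \<forall>j<4. ip (?p j) v = 0}" unfolding X ipp ..
  have sub: "cv.subspace X" unfolding X' by (rule subspace_kernel)
  have XC: "X \<subseteq> cspace 7" unfolding X by auto
  have fdX: "fd X" using fd_cspace XC by (rule fd_subset)
  have "cv.dim X \<le> 3" by (rule dim_le_if_injective[OF fdX sub w]) auto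
  moreover have "7 \<le> cv.dim X + 4"
    using dim_ip_kernels[OF fd_cspace[of 7] subspace_cspace[of 7], of 4 ?p] dim_cspace_ge[of 7] unfolding X' by linarith
  ultimately have dim: "cv.dim X = 3" by simp
  have "2 \<le> cv.dim (X \<inter> flag_of_matrix 7 (g j) 5)" if j: "j < 4" for j
  proof -
    have "\<exists>q. X \<inter> flag_of_matrix 7 (g j) 5 = {v \<in> X. ip q v = 0}"
    proof (cases "a j = 0")
      case True
      have "X \<inter> flag_of_matrix 7 (g j) 5 = {v \<in> X. ip (lam j) v = 0}"
        using K5[OF j] ab[OF j] j True unfolding X by auto
      then show ?thesis by blast
    next
      case False
      have "X \<inter> flag_of_matrix 7 (g j) 5 = {v \<in> X. ip (mu j) v = 0}"
        using K5[OF j] j False unfolding X by auto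
      then show ?thesis by blast
    qed
    then obtain q where q: "X \<inter> flag_of_matrix 7 (g j) 5 = {v \<in> X. ip q v = 0}" by blast
    show ?thesis using dim_ip_kernel[OF fdX sub, of q] dim unfolding q by simp
  qed
  moreover have "1 \<le> cv.dim (X \<inter> flag_of_matrix 7 (g j) 3)" if j: "j < 4" for j
  proof -
    obtain i1 i2 i3 where i: "Dh j i1 i2 i3 a b = 0" "{..<4} = {j, i1, i2, i3}"
    proof -
      have "j = 0 \<or> j = 1 \<or> j = 2 \<or> j = 3" using j by auto
      moreover have "{..<4} = {0,1,2,3::nat}" by auto
      ultimately show ?thesis using that[of 1 2 3] that[of 0 2 3] that[of 0 1 3] that[of 0 1 2] D by auto
    qed
    obtain z where z: "\<exists>k<3. z k \<noteq> 0" "(\<Sum>k<3. (a i1 * L j i1 k + b i1 * M j i1 k) * z k) = 0"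
      "(\<Sum>k<3. (a i2 * L j i2 k + b i2 * M j i2 k) * z k) = 0" "(\<Sum>k<3. (a i3 * L j i3 k + b i3 * M j i3 k) * z k) = 0"
      using d3_eq_0_kernel[OF i(1)[unfolded Dh_def]] by blast
    define v where "v = (\<Sum>k<3. cscale (z k) (grow j k))"
    have e: "a i * ip (lam i) v + b i * ip (mu i) v = (\<Sum>k<3. (a i * L j i k + b i * M j i k) * z k)" for i
      unfolding v_def ip_sum_row L_def M_def by (simp add: sum_less_3 algebra_simps)
    have "a i * ip (lam i) v + b i * ip (mu i) v = 0" if "i < 4" for i
    proof -
      have "i = j \<or> i = i1 \<or> i = i2 \<or> i = i3" using that i(2) by auto
      moreover have "a j * ip (lam j) v + b j * ip (mu j) v = 0"
        unfolding e using LM_diag[OF j] by simp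
      ultimately show ?thesis using z e by auto
    qed
    then have "v \<in> X" unfolding X using sum_row_cspace v_def by auto
    moreover have "v \<in> flag_of_matrix 7 (g j) 3" unfolding K3 v_def by blast
    moreover have "v \<noteq> 0" using rows_indep[OF j, of z] z(1) unfolding v_def by auto
    moreover have "fd (X \<inter> flag_of_matrix 7 (g j) 3)" using fdX by (rule fd_subset) auto
    ultimately show ?thesis using dim_ge_1_iff by auto
  qed
  ultimately show ?thesis
    using K7 sub XC dim by (subst mem_schubert_intersection_iff) auto
qed

end

text \<open>These are the coefficients of the multilinear form \<open>Dh\<close>:
  \<open>True\<close> selects \<open>mu\<close>, that is the variable \<open>b\<close>, in its slot,
  and \<open>False\<close> selects \<open>lam\<close> and \<open>a\<close>.\<close>

definition tri :: "(nat \<Rightarrow> nat \<Rightarrow> nat \<Rightarrow> complex) \<Rightarrow> (nat \<Rightarrow> nat \<Rightarrow> nat \<Rightarrow> complex) \<Rightarrow>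
    nat \<Rightarrow> nat \<Rightarrow> nat \<Rightarrow> nat \<Rightarrow> bool \<Rightarrow> bool \<Rightarrow> bool \<Rightarrow> complex" where
  "tri L M j i1 i2 i3 b1 b2 b3 =
     d3 (if b1 then M j i1 else L j i1) (if b2 then M j i2 else L j i2) (if b3 then M j i3 else L j i3)"

text \<open>The cross product of the two \<open>M\<close>-rows gives the point of the 3-dimensional
  member of flag j where all \<open>mu i\<close> vanish, as \<open>mu j\<close> is zero on that
  member and the four sum to zero. The entry is the value of \<open>lam l\<close> at this
  point.\<close>

definition zmat :: "(nat \<Rightarrow> nat \<Rightarrow> nat \<Rightarrow> complex) \<Rightarrow> (nat \<Rightarrow> nat \<Rightarrow> nat \<Rightarrow> complex) \<Rightarrow> nat \<Rightarrow> nat \<Rightarrow> complex" where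
  "zmat L M j l = d3 (L j l) (M j (if j = 0 then 1 else 0)) (M j (if j \<le> 1 then 2 else 1))"

text \<open>Both z and the cross product of \<open>n1\<close> and \<open>n2\<close> are killed by
  these two functionals. Hypothesis \<open>u\<close> makes the cross product nonzero, so the two
  functionals are independent and their kernel is a line.\<close>

lemma cross_proportional:
  fixes z n1 n2 :: "nat \<Rightarrow> complex"
  assumes z: "(\<Sum>k<3. n1 k * z k) = 0" "(\<Sum>k<3. n2 k * z k) = 0" and nz: "\<exists>k<3. z k \<noteq> 0" and u: "d3 u n1 n2 \<noteq> 0"
  obtains r where "r \<noteq> 0" "\<And>l. (\<Sum>k<3. l k * z k) = r * d3 l n1 n2"
proof -
  define w where "w k = (if k = 0 then n1 1 * n2 2 - n1 2 * n2 1 else if k = 1 then n1 2 * n2 0 - n1 0 * n2 2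
    else n1 0 * n2 1 - n1 1 * n2 (0::nat))" for k :: nat
  have d: "d3 l n1 n2 = l 0 * w 0 + l 1 * w 1 + l 2 * w 2" for l
    by (simp add: d3_def w_def algebra_simps)
  have z': "n1 0 * z 0 + n1 1 * z 1 + n1 2 * z 2 = 0" "n2 0 * z 0 + n2 1 * z 1 + n2 2 * z 2 = 0"
    using z by (simp_all add: sum_less_3)
  have "z 0 * (n1 2 * n2 0 - n1 0 * n2 2) = z 1 * (n1 1 * n2 2 - n1 2 * n2 1)"
    using z' by Groebner_Basis.algebra
  moreover have "z 0 * (n1 0 * n2 1 - n1 1 * n2 0) = z 2 * (n1 1 * n2 2 - n1 2 * n2 1)"
    using z' by Groebner_Basis.algebra
  moreover have "z 1 * (n1 0 * n2 1 - n1 1 * n2 0) = z 2 * (n1 2 * n2 0 - n1 0 * n2 2)"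
    using z' by Groebner_Basis.algebra
  ultimately have c: "z 0 * w 1 = z 1 * w 0" "z 0 * w 2 = z 2 * w 0" "z 1 * w 2 = z 2 * w 1"
    by (simp_all add: w_def)
  have "w 0 \<noteq> 0 \<or> w 1 \<noteq> 0 \<or> w 2 \<noteq> 0" using u unfolding d by auto
  then obtain r where r: "z 0 = r * w 0" "z 1 = r * w 1" "z 2 = r * w 2"
  proof (elim disjE)
    assume "w 0 \<noteq> 0" then show ?thesis using c that[of "z 0 / w 0"] by (simp add: field_simps)
  next
    assume "w 1 \<noteq> 0" then show ?thesis using c that[of "z 1 / w 1"] by (simp add: field_simps)
  next
    assume "w 2 \<noteq> 0" then show ?thesis using c that[of "z 2 / w 2"] by (simp add: field_simps)
  qed
  have "r \<noteq> 0" using nz r by (auto simp: less_3_iff)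
  then show ?thesis by (rule that) (unfold d sum_less_3 r, simp add: algebra_simps)
qed

text \<open>The relation is between indexed vectors, so a repetition among them has to be treated as
  a relation of its own.\<close>

lemma linear_relation:
  assumes "fd X" "cv.dim X < n" "\<And>j. j < n \<Longrightarrow> a j \<in> X"
  obtains c where "\<exists>j<n. c j \<noteq> 0" "(\<Sum>j<n. cscale (c j) (a j)) = 0"
proof (cases "inj_on a {..<n}")
  case True
  have "cv.dependent (a ` {..<n})"
  proof (rule ccontr)
    assume "\<not> ?thesis"
    then have "card (a ` {..<n}) \<le> cv.dim X" using independent_card_le(2)[OF assms(1)] assms(3) by blast
    then show False using assms(2) card_image[OF True] by simp
  qed
  then obtain u where u: "\<exists>v\<in>a ` {..<n}. u v \<noteq> 0" "(\<Sum>v\<in>a ` {..<n}. cscale (u v) v) = 0"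
    using cv.dependent_finite[of "a ` {..<n}"] by auto
  then show ?thesis using that[of "\<lambda>j. u (a j)"] by (auto simp: sum.reindex[OF True])
next
  case False
  then obtain i j where ij: "i < n" "j < n" "i \<noteq> j" "a i = a j" by (auto simp: inj_on_def)
  let ?c = "\<lambda>k. if k = i then 1 else if k = j then -1 else (0::complex)"
  have "(\<Sum>k<n. cscale (?c k) (a k)) = (\<Sum>k\<in>{i,j}. cscale (?c k) (a k))"
    by (rule sum.mono_neutral_right) (use ij in auto)
  also have "\<dots> = 0" using ij by (simp add: cv.scale_minus_left)
  finally have "(\<Sum>k<n. cscale (?c k) (a k)) = 0" .
  moreover have "\<exists>k<n. ?c k \<noteq> 0" using ij(1) by (intro exI[of _ i]) simp
  ultimately show ?thesis by (rule that[of ?c, rotated])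
qed

section \<open>Coefficients of the normalised system and its eliminant\<close>

locale system_coeffs =
  fixes L M :: "nat \<Rightarrow> nat \<Rightarrow> nat \<Rightarrow> complex"
begin

abbreviation t0 where "t0 \<equiv> tri L M 0 1 2 3"
abbreviation t1 where "t1 \<equiv> tri L M 1 0 2 3"
abbreviation t2 where "t2 \<equiv> tri L M 2 0 1 3"
abbreviation t3 where "t3 \<equiv> tri L M 3 0 1 2"

definition "N1 b1 b2 b3 = t1 b1 b2 b3 / t1 False True True"
definition "N2 b1 b2 b3 = t2 b1 b2 b3 / t2 False True True"
definition "N3 b1 b2 b3 = t3 b1 b2 b3 / t3 False True True"

text \<open>Coefficients of the equations of flags 1, 2, 3 as polynomials in z =
  \<open>b 0 / a 0\<close>, made monic in the product of the two remaining unknowns.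
  \<open>pA1\<close>, \<open>pA2\<close>, \<open>pA3\<close> are constant because the shift of the
  \<open>lam j\<close> annihilates the coefficients \<open>True False False\<close>.\<close>

definition "pA1 = [:N1 False False False:]"
definition "pB1 = [:N1 False True False, N1 True True False:]"
definition "pC1 = [:N1 False False True, N1 True False True:]"
definition "pA2 = [:N2 False False False:]"
definition "pB2 = [:N2 False True False, N2 True True False:]"
definition "pC2 = [:N2 False False True, N2 True False True:]"
definition "pA3 = [:N3 False False False:]"
definition "pB3 = [:N3 False True False, N3 True True False:]"
definition "pC3 = [:N3 False False True, N3 True False True:]"
text \<open>With \<open>pK1\<close>, \<open>pK2\<close>, \<open>pK3\<close> this is the equation of
  flag 0 after its products of two unknowns are replaced by means of the other three equations; what
  remains is linear in the unknowns.\<close>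

definition "pK0 = [:t0 False False False - t0 True True False * N3 False False False
   - t0 True False True * N2 False False False - t0 False True True * N1 False False False:]"
definition "pK1 = [:t0 True False False - t0 True True False * N3 False True False - t0 True False True * N2 False True False,
   - (t0 True True False * N3 True True False) - t0 True False True * N2 True True False:]"
definition "pK2 = [:t0 False True False - t0 True True False * N3 False False True - t0 False True True * N1 False True False,
   - (t0 True True False * N3 True False True) - t0 False True True * N1 True True False:]"
definition "pK3 = [:t0 False False True - t0 True False True * N2 False False True - t0 False True True * N1 False False True,
   - (t0 True False True * N2 True False True) - t0 False True True * N1 True False True:]"

definition "pG1 = elim.G1 pA1 pB1 pC1 pB2 pB3"
definition "pG2 = elim.G2 pB1 pA2 pB2 pC2 pC3"
definition "pG3 = elim.G3 pC1 pC2 pA3 pB3 pC3"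
definition "pR = elim.elim_res pA1 pB1 pC1 pA2 pB2 pC2 pA3 pB3 pC3 pK0 pK1 pK2 pK3"
definition "pm = elim.elim_lin pA1 pB1 pC1 pA2 pB2 pC2 pA3 pB3 pC3 pK1 pK2 pK3"

text \<open>Up to sign the determinant of the linear system for b1/a1, b2/a2, b3/a3 to which flags
  1, 2, 3 reduce when \<open>a 0 = 0\<close>; the same matrix reappears as
  \<open>kmat\<close>.\<close>

definition "dinf = t3 True True False * t2 True False True * t1 True True False
   + t3 True False True * t2 True True False * t1 True False True"

definition generic where
  "generic \<longleftrightarrow> t1 False True True \<noteq> 0 \<and> t2 False True True \<noteq> 0 \<and> t3 False True True \<noteq> 0 \<and>
    t3 True True False \<noteq> 0 \<and> t3 True False True \<noteq> 0 \<and> t2 True True False \<noteq> 0 \<and> t2 True False True \<noteq> 0 \<and>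
    t1 True True False \<noteq> 0 \<and> t1 True False True \<noteq> 0 \<and>
    t0 False False False \<noteq> 0 \<and> dinf \<noteq> 0 \<and>
    det (mat 4 4 (\<lambda>(l,j). zmat L M j l)) \<noteq> 0 \<and> degree pR = 8 \<and>
    (\<forall>z. poly pR z = 0 \<longrightarrow> poly (pderiv pR) z \<noteq> 0) \<and>
    (\<forall>z. poly pR z = 0 \<longrightarrow> poly pG1 z \<noteq> 0) \<and> (\<forall>z. poly pR z = 0 \<longrightarrow> poly pG2 z \<noteq> 0) \<and>
    (\<forall>z. poly pR z = 0 \<longrightarrow> poly pG3 z \<noteq> 0) \<and> (\<forall>z. poly pR z = 0 \<longrightarrow> poly pm z \<noteq> 0)"

end

locale schubert_system = four_flags +
  assumes sum_mu: "\<And>v. ip (mu 0) v + ip (mu 1) v + ip (mu 2) v + ip (mu 3) v = 0"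
    and inj: "\<And>v. v \<in> cspace 7 \<Longrightarrow> (\<And>j. j < 4 \<Longrightarrow> ip (lam j) v = 0) \<Longrightarrow> (\<And>j. j < 4 \<Longrightarrow> ip (mu j) v = 0) \<Longrightarrow> v = 0"
begin

sublocale system_coeffs L M .

lemma sum_M: "M j 0 k + M j 1 k + M j 2 k + M j 3 k = 0"
  unfolding M_def by (rule sum_mu)

text \<open>On the 3-dimensional member of flag j the functional \<open>mu j\<close> vanishes, so
  the other three sum to zero there and are dependent.\<close>

lemma tri_TTT: "t0 True True True = 0" "t1 True True True = 0" "t2 True True True = 0" "t3 True True True = 0"
proof -
  have *: "d3 u v w = 0" if "\<And>k. k < 3 \<Longrightarrow> u k + v k + w k = 0" for u v w :: "nat \<Rightarrow> complex"
    using that[of 0] that[of 1] that[of 2] unfolding d3_def by simp Groebner_Basis.algebra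
  have **: "M 0 1 k + M 0 2 k + M 0 3 k = 0" "M 1 0 k + M 1 2 k + M 1 3 k = 0"
    "M 2 0 k + M 2 1 k + M 2 3 k = 0" "M 3 0 k + M 3 1 k + M 3 2 k = 0" if "k < 3" for k
    using sum_M[of 0 k] sum_M[of 1 k] sum_M[of 2 k] sum_M[of 3 k] that by (simp_all add: LM_diag del: One_nat_def)
  show "t0 True True True = 0" "t1 True True True = 0" "t2 True True True = 0" "t3 True True True = 0"
    unfolding tri_def if_True by (rule *, erule **)+
qed

lemma Dh_expand:
  assumes "tri L M j i1 i2 i3 True True True = 0"
  shows "Dh j i1 i2 i3 a b =
    a i1 * a i2 * a i3 * tri L M j i1 i2 i3 False False False + b i1 * a i2 * a i3 * tri L M j i1 i2 i3 True False False
    + a i1 * b i2 * a i3 * tri L M j i1 i2 i3 False True False + a i1 * a i2 * b i3 * tri L M j i1 i2 i3 False False True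
    + b i1 * b i2 * a i3 * tri L M j i1 i2 i3 True True False + b i1 * a i2 * b i3 * tri L M j i1 i2 i3 True False True
    + a i1 * b i2 * b i3 * tri L M j i1 i2 i3 False True True"
  using assms unfolding Dh_def d3_add_scale by (simp add: tri_def)

text \<open>Otherwise X would contain, for each flag, a nonzero point of its 3-dimensional member
  killed by all \<open>mu i\<close>. The \<open>lam\<close>-values of these four points form
  \<open>zmat\<close> up to nonzero column factors, so the points would be independent in a
  3-dimensional space.\<close>

lemma mu_nonzero_on:
  assumes X: "X \<in> S" and Z: "det (mat 4 4 (\<lambda>(l,j). zmat L M j l)) \<noteq> 0"
    and mu0: "\<And>j v. j < 4 \<Longrightarrow> v \<in> X \<Longrightarrow> ip (mu j) v = 0"
  shows False
proof -
  have X': "cv.subspace X" "X \<subseteq> cspace 7" "cv.dim X = 3"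
    "\<And>j. j < 4 \<Longrightarrow> 1 \<le> cv.dim (X \<inter> flag_of_matrix 7 (g j) 3)"
    using X K7 by (subst (asm) mem_schubert_intersection_iff; simp)+
  have fdX: "fd X" using fd_cspace X'(2) by (rule fd_subset)
  have "\<forall>j\<in>{..<4}. \<exists>p. fst p \<in> X \<and> snd p \<noteq> 0 \<and> (\<forall>l<4. ip (lam l) (fst p) = snd p * zmat L M j l)"
  proof
    fix j :: nat assume "j \<in> {..<4}"
    then have j: "j < 4" by simp
    obtain z where z: "(\<Sum>k<3. cscale (z k) (grow j k)) \<in> X" and nz: "\<exists>k<3. z k \<noteq> 0"
      by (rule K3_witness[OF fdX X'(4)[OF j]])
    let ?v = "\<Sum>k<3. cscale (z k) (grow j k)"
    have M0: "(\<Sum>k<3. M j i k * z k) = 0" if "i < 4" for i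
      using mu0[OF that z] unfolding ip_sum_row M_def .
    have "\<exists>l<4. zmat L M j l \<noteq> 0"
    proof (rule ccontr)
      assume "\<not> ?thesis"
      then have "(if j = j then 1 else 0) = (0::complex)"
        by (intro det_nz_inj[OF Z, of "\<lambda>i. if i = j then 1 else 0"] sum.neutral) (use j in auto)
      then show False by simp
    qed
    then obtain l0 where l0: "zmat L M j l0 \<noteq> 0" by blast
    let ?i1 = "if j = 0 then 1 else 0::nat" and ?i2 = "if j \<le> 1 then 2 else 1::nat"
    have 1: "(\<Sum>k<3. M j ?i1 k * z k) = 0" and 2: "(\<Sum>k<3. M j ?i2 k * z k) = 0" by (intro M0, simp)+
    obtain r where r: "r \<noteq> 0" "\<And>l. (\<Sum>k<3. l k * z k) = r * d3 l (M j ?i1) (M j ?i2)"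
      by (rule cross_proportional[OF 1 2 nz l0[unfolded zmat_def]]) blast
    have "ip (lam l) ?v = r * zmat L M j l" for l
      using r(2)[of "L j l"] unfolding ip_sum_row zmat_def by (simp add: L_def)
    then show "\<exists>p. fst p \<in> X \<and> snd p \<noteq> 0 \<and> (\<forall>l<4. ip (lam l) (fst p) = snd p * zmat L M j l)"
      using z r(1) by (intro exI[of _ "(?v, r)"]) simp
  qed
  from bchoice[OF this] obtain p where p: "\<forall>j\<in>{..<4}. fst (p j) \<in> X \<and> snd (p j) \<noteq> 0 \<and>
    (\<forall>l<4. ip (lam l) (fst (p j)) = snd (p j) * zmat L M j l)" ..
  define v where "v j = fst (p j)" for j
  define r where "r j = snd (p j)" for j
  have vr: "\<And>j. j < 4 \<Longrightarrow> v j \<in> X" "\<And>j. j < 4 \<Longrightarrow> r j \<noteq> 0"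
    "\<And>j l. j < 4 \<Longrightarrow> l < 4 \<Longrightarrow> ip (lam l) (v j) = r j * zmat L M j l"
    using p by (simp_all add: v_def r_def)
  obtain c where c: "\<exists>j<4. c j \<noteq> 0" "(\<Sum>j<4. cscale (c j) (v j)) = 0"
    using linear_relation[OF fdX, of 4 v] X'(3) vr(1) by auto
  have ips: "ip w (\<Sum>j<n. cscale (c j) (v j)) = (\<Sum>j<n. c j * ip w (v j))" for w and n :: nat
  proof (induction n)
    case 0 show ?case by (simp only: lessThan_0 sum.empty ip_zero)
  next
    case (Suc n) then show ?case by (simp only: sum.lessThan_Suc ip_add ip_cscale)
  qed
  have "c j * r j = 0" if "j < 4" for j
  proof (rule det_nz_inj[OF Z _ that])
    fix l :: nat assume l: "l < 4"
    have "0 = (\<Sum>j<4. c j * ip (lam l) (v j))" using ips[of "lam l" 4] c(2) by simp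
    also have "\<dots> = (\<Sum>j<4. zmat L M j l * (c j * r j))" using vr(3) l by (intro sum.cong) auto
    finally show "(\<Sum>j<4. zmat L M j l * (c j * r j)) = 0" by simp
  qed
  with c(1) vr(2) show False by auto
qed

end

context system_coeffs
begin

lemmas p_defs = pA1_def pB1_def pC1_def pA2_def pB2_def pC2_def pA3_def pB3_def pC3_def
  pK0_def pK1_def pK2_def pK3_def
lemmas elim_defs = elim.G1_def elim.G2_def elim.G3_def elim.k1_def elim.k2_def elim.e3_def elim.e2_def elim.e1_def
  elim.f3_def elim.f2_def elim.f1_def elim.h12_def elim.h13_def elim.h23_def

context
  fixes z :: complex
begin

interpretation E: elim_field "poly pA1 z" "poly pB1 z" "poly pC1 z" "poly pA2 z" "poly pB2 z" "poly pC2 z"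
  "poly pA3 z" "poly pB3 z" "poly pC3 z" .

text \<open>Evaluation at z is a ring homomorphism. This is why the eliminants are defined over any
  commutative ring and used both for polynomials and for their values.\<close>

lemma poly_pG: "poly pG1 z = E.G1" "poly pG2 z = E.G2" "poly pG3 z = E.G3"
  by (simp_all add: pG1_def pG2_def pG3_def elim_defs)

lemma poly_pR: "poly pR z = E.elim_res (poly pK0 z) (poly pK1 z) (poly pK2 z) (poly pK3 z)"
  by (simp add: pR_def elim.elim_res_def elim_defs)

lemma poly_pm: "poly pm z = E.elim_lin (poly pK1 z) (poly pK2 z) (poly pK3 z)"
  by (simp add: pm_def elim.elim_lin_def elim_defs)

end

end

context schubert_system
begin

context
  fixes z :: complex and a b :: "nat \<Rightarrow> complex"
  assumes nz: "t1 False True True \<noteq> 0" "t2 False True True \<noteq> 0" "t3 False True True \<noteq> 0"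
    and shift: "t1 True False False = 0" "t2 True False False = 0" "t3 True False False = 0"
    and a0: "a 0 \<noteq> 0" and z: "b 0 = z * a 0"
begin

abbreviation "E1 \<equiv> a 2 * a 3 * poly pA1 z + b 2 * a 3 * poly pB1 z + a 2 * b 3 * poly pC1 z + b 2 * b 3"
abbreviation "E2 \<equiv> a 1 * a 3 * poly pA2 z + b 1 * a 3 * poly pB2 z + a 1 * b 3 * poly pC2 z + b 1 * b 3"
abbreviation "E3 \<equiv> a 1 * a 2 * poly pA3 z + b 1 * a 2 * poly pB3 z + a 1 * b 2 * poly pC3 z + b 1 * b 2"
abbreviation "EL \<equiv> a 1 * a 2 * a 3 * poly pK0 z + b 1 * a 2 * a 3 * poly pK1 z + a 1 * b 2 * a 3 * poly pK2 z
  + a 1 * a 2 * b 3 * poly pK3 z"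

lemma Dh_E:
  "Dh 1 0 2 3 a b = a 0 * t1 False True True * E1"
  "Dh 2 0 1 3 a b = a 0 * t2 False True True * E2"
  "Dh 3 0 1 2 a b = a 0 * t3 False True True * E3"
  unfolding Dh_expand[OF tri_TTT(2)] Dh_expand[OF tri_TTT(3)] Dh_expand[OF tri_TTT(4)] z shift
  using nz by (simp_all add: p_defs N1_def N2_def N3_def field_simps)

lemma Dh_EL:
  "Dh 0 1 2 3 a b = EL + t0 True True False * a 3 * E3 + t0 True False True * a 2 * E2 + t0 False True True * a 1 * E1"
  unfolding Dh_expand[OF tri_TTT(1)] p_defs by (simp add: algebra_simps)

lemma Dh_iff:
  "Dh 0 1 2 3 a b = 0 \<and> Dh 1 0 2 3 a b = 0 \<and> Dh 2 0 1 3 a b = 0 \<and> Dh 3 0 1 2 a b = 0 \<longleftrightarrow>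
    E1 = 0 \<and> E2 = 0 \<and> E3 = 0 \<and> EL = 0"
proof -
  have "Dh 1 0 2 3 a b = 0 \<longleftrightarrow> E1 = 0" "Dh 2 0 1 3 a b = 0 \<longleftrightarrow> E2 = 0" "Dh 3 0 1 2 a b = 0 \<longleftrightarrow> E3 = 0"
    unfolding Dh_E using nz a0 by simp_all
  moreover have "Dh 0 1 2 3 a b = EL" if "E1 = 0" "E2 = 0" "E3 = 0"
    unfolding Dh_EL that by simp
  ultimately show ?thesis by auto
qed

end

text \<open>If \<open>a 0 = 0\<close>, then \<open>a 1\<close>, \<open>a 2\<close>,
  \<open>a 3\<close> vanish together; if none vanishes, \<open>dinf\<close> forces b1 = b2 = b3 = 0,
  against the nonzero coefficient of a1 a2 a3 in the equation of flag 0. If \<open>a 0\<close> is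
  nonzero and \<open>a i = 0\<close> for another i, then both \<open>pGi\<close> and
  \<open>pKi\<close> vanish at z; each term of the eliminant contains one of them, so z would be a
  common root of \<open>pR\<close> and \<open>pGi\<close>.\<close>

lemma no_solution_at_infinity:
  assumes gen: generic and shift: "t1 True False False = 0" "t2 True False False = 0" "t3 True False False = 0"
    and ab: "\<And>j. j < 4 \<Longrightarrow> a j \<noteq> 0 \<or> b j \<noteq> 0"
    and D: "Dh 0 1 2 3 a b = 0" "Dh 1 0 2 3 a b = 0" "Dh 2 0 1 3 a b = 0" "Dh 3 0 1 2 a b = 0"
  shows "(\<forall>j<4. a j = 0) \<or> (\<forall>j<4. a j \<noteq> 0)"
proof -
  have all4: "(\<forall>j<4. P j) \<longleftrightarrow> P 0 \<and> P 1 \<and> P 2 \<and> P (3::nat)" for P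
    by (auto simp: less_Suc_eq numeral_eq_Suc)
  have b: "a 0 = 0 \<Longrightarrow> b 0 \<noteq> 0" "a 1 = 0 \<Longrightarrow> b 1 \<noteq> 0" "a 2 = 0 \<Longrightarrow> b 2 \<noteq> 0" "a 3 = 0 \<Longrightarrow> b 3 \<noteq> 0"
    using ab[of 0] ab[of 1] ab[of 2] ab[of 3] by auto
  note nz = gen[unfolded generic_def]
  have delta: "t1 False True True \<noteq> 0" "t2 False True True \<noteq> 0" "t3 False True True \<noteq> 0" using nz by blast+
  show ?thesis
  proof (cases "a 0 = 0")
    case True
    note b0 = b(1)[OF True]
    have e3: "b 1 * a 2 * t3 True True False + a 1 * b 2 * t3 True False True = 0"
      using D(4) b0 unfolding Dh_expand[OF tri_TTT(4)] True shift by (simp add: mult.assoc flip: distrib_left)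
    have e2: "b 1 * a 3 * t2 True True False + a 1 * b 3 * t2 True False True = 0"
      using D(3) b0 unfolding Dh_expand[OF tri_TTT(3)] True shift by (simp add: mult.assoc flip: distrib_left)
    have e1: "b 2 * a 3 * t1 True True False + a 2 * b 3 * t1 True False True = 0"
      using D(2) b0 unfolding Dh_expand[OF tri_TTT(2)] True shift by (simp add: mult.assoc flip: distrib_left)
    have "a 1 = 0 \<longleftrightarrow> a 2 = 0" "a 1 = 0 \<longleftrightarrow> a 3 = 0"
      using e3 e2 b nz by auto
    moreover have False if a: "a 1 \<noteq> 0" "a 2 \<noteq> 0" "a 3 \<noteq> 0"
    proof -
      have "dinf * (b 1 * a 2 * a 3) = 0" "dinf * (b 2 * a 1 * a 3) = 0" "dinf * (b 3 * a 1 * a 2) = 0"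
        unfolding dinf_def using e1 e2 e3 by Groebner_Basis.algebra+
      then have "b 1 = 0" "b 2 = 0" "b 3 = 0" using a nz by auto
      then show False using D(1) a nz unfolding Dh_expand[OF tri_TTT(1)] by simp
    qed
    ultimately show ?thesis using True unfolding all4 by blast
  next
    case False
    define z where "z = b 0 / a 0"
    have ncr: "poly pR z = 0 \<Longrightarrow> poly pG1 z \<noteq> 0" "poly pR z = 0 \<Longrightarrow> poly pG2 z \<noteq> 0" "poly pR z = 0 \<Longrightarrow> poly pG3 z \<noteq> 0"
      using nz by blast+
    have z: "b 0 = z * a 0" using False by (simp add: z_def)
    have E: "E1 z a b = 0" "E2 z a b = 0" "E3 z a b = 0" "EL z a b = 0"
      using Dh_iff[where a = a and b = b and z = z, OF delta shift False z] D by blast+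
    have n1: "a 1 \<noteq> 0"
    proof
      assume a: "a 1 = 0"
      note b1 = b(2)[OF a]
      have "b 1 * (b 2 + a 2 * poly pB3 z) = 0" using E(3) a by Groebner_Basis.algebra
      then have 2: "b 2 = - a 2 * poly pB3 z" using b1 by (simp add: eq_neg_iff_add_eq_0)
      have "b 1 * (b 3 + a 3 * poly pB2 z) = 0" using E(2) a by Groebner_Basis.algebra
      then have 3: "b 3 = - a 3 * poly pB2 z" using b1 by (simp add: eq_neg_iff_add_eq_0)
      have "a 2 \<noteq> 0" "a 3 \<noteq> 0" using 2 3 b by auto
      have *: "a 2 * a 3 * poly pG1 z = 0" using E(1) unfolding 2 3 poly_pG elim_defs by Groebner_Basis.algebra
      have K: "poly pK1 z = 0" using E(4) b1 \<open>a 2 \<noteq> 0\<close> \<open>a 3 \<noteq> 0\<close> unfolding a by simp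
      have G: "poly pG1 z = 0" using * \<open>a 2 \<noteq> 0\<close> \<open>a 3 \<noteq> 0\<close> by simp
      have "poly pR z = 0" unfolding poly_pR elim.elim_res_def K G[unfolded poly_pG] by simp
      then show False using ncr(1) G by blast
    qed
    have n2: "a 2 \<noteq> 0"
    proof
      assume a: "a 2 = 0"
      note b1 = b(3)[OF a]
      have "b 2 * (b 1 + a 1 * poly pC3 z) = 0" using E(3) a by Groebner_Basis.algebra
      then have 2: "b 1 = - a 1 * poly pC3 z" using b1 by (simp add: eq_neg_iff_add_eq_0)
      have "b 2 * (b 3 + a 3 * poly pB1 z) = 0" using E(1) a by Groebner_Basis.algebra
      then have 3: "b 3 = - a 3 * poly pB1 z" using b1 by (simp add: eq_neg_iff_add_eq_0)
      have "a 1 \<noteq> 0" "a 3 \<noteq> 0" using 2 3 b by auto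
      have *: "a 1 * a 3 * poly pG2 z = 0" using E(2) unfolding 2 3 poly_pG elim_defs by Groebner_Basis.algebra
      have K: "poly pK2 z = 0" using E(4) b1 \<open>a 1 \<noteq> 0\<close> \<open>a 3 \<noteq> 0\<close> unfolding a by simp
      have G: "poly pG2 z = 0" using * \<open>a 1 \<noteq> 0\<close> \<open>a 3 \<noteq> 0\<close> by simp
      have "poly pR z = 0" unfolding poly_pR elim.elim_res_def K G[unfolded poly_pG] by simp
      then show False using ncr(2) G by blast
    qed
    have n3: "a 3 \<noteq> 0"
    proof
      assume a: "a 3 = 0"
      note b1 = b(4)[OF a]
      have "b 3 * (b 1 + a 1 * poly pC2 z) = 0" using E(2) a by Groebner_Basis.algebra
      then have 2: "b 1 = - a 1 * poly pC2 z" using b1 by (simp add: eq_neg_iff_add_eq_0)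
      have "b 3 * (b 2 + a 2 * poly pC1 z) = 0" using E(1) a by Groebner_Basis.algebra
      then have 3: "b 2 = - a 2 * poly pC1 z" using b1 by (simp add: eq_neg_iff_add_eq_0)
      have "a 1 \<noteq> 0" "a 2 \<noteq> 0" using 2 3 b by auto
      have *: "a 1 * a 2 * poly pG3 z = 0" using E(3) unfolding 2 3 poly_pG elim_defs by Groebner_Basis.algebra
      have K: "poly pK3 z = 0" using E(4) b1 \<open>a 1 \<noteq> 0\<close> \<open>a 2 \<noteq> 0\<close> unfolding a by simp
      have G: "poly pG3 z = 0" using * \<open>a 1 \<noteq> 0\<close> \<open>a 2 \<noteq> 0\<close> by simp
      have "poly pR z = 0" unfolding poly_pR elim.elim_res_def K G[unfolded poly_pG] by simp
      then show False using ncr(3) G by blast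
    qed
    show ?thesis using False n1 n2 n3 unfolding all4 by blast
  qed
qed

definition Xt where
  "Xt t = {v \<in> cspace 7. \<forall>j<4. 1 * ip (lam j) v + t j * ip (mu j) v = 0}"

lemma mu_0_Xt:
  assumes "v \<in> Xt t" "\<And>j. j < 4 \<Longrightarrow> ip (mu j) v = 0"
  shows "v = 0"
proof (rule inj)
  show "v \<in> cspace 7" using assms(1) by (simp add: Xt_def)
  show "ip (lam j) v = 0" if "j < 4" for j using assms that by (simp add: Xt_def)
qed (rule assms(2))

lemma S_dim: "X \<in> S \<Longrightarrow> cv.subspace X \<and> X \<subseteq> cspace 7 \<and> cv.dim X = 3"
  using mem_schubert_intersection_iff[where F = "\<lambda>j. flag_of_matrix 7 (g j)", OF K7, of X] by blast

lemma Xt_mem_S: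
  assumes "Dh 0 1 2 3 (\<lambda>_. 1) t = 0" "Dh 1 0 2 3 (\<lambda>_. 1) t = 0" "Dh 2 0 1 3 (\<lambda>_. 1) t = 0" "Dh 3 0 1 2 (\<lambda>_. 1) t = 0"
  shows "Xt t \<in> S"
proof (rule S_intro[of "\<lambda>_. 1" t _ mu])
  fix v assume v: "v \<in> Xt t" "\<forall>j<3. ip (mu j) v = 0"
  then have m: "ip (mu 0) v = 0" "ip (mu 1) v = 0" "ip (mu 2) v = 0" by simp_all
  then have "ip (mu 3) v = 0" using sum_mu[of v] by simp
  moreover have "j = 0 \<or> j = 1 \<or> j = 2 \<or> j = 3" if "j < 4" for j :: nat using that by auto
  ultimately have "ip (mu j) v = 0" if "j < 4" for j using m that by metis
  then show "v = 0" using mu_0_Xt v(1) by blast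
qed (use assms in \<open>auto simp: Xt_def\<close>)

text \<open>The coordinate z = \<open>t 0\<close> identifies the solutions with the roots of
  \<open>pR\<close>, which are simple: at a root the nonzero value of \<open>pm\<close> determines
  \<open>t 3\<close>, and the nonzero values of \<open>pG1\<close> and \<open>pG2\<close> then
  determine \<open>t 1\<close> and \<open>t 2\<close>.\<close>

theorem card_S:
  assumes gen: generic and shift: "t1 True False False = 0" "t2 True False False = 0" "t3 True False False = 0"
  shows "finite S" "card S = 8"
proof -
  note nz = gen[unfolded generic_def]
  have delta: "t1 False True True \<noteq> 0" "t2 False True True \<noteq> 0" "t3 False True True \<noteq> 0" using nz by blast+
  let ?Z = "{z. poly pR z = 0}"
  have DE: "Dh 0 1 2 3 (\<lambda>_. 1) t = 0 \<and> Dh 1 0 2 3 (\<lambda>_. 1) t = 0 \<and> Dh 2 0 1 3 (\<lambda>_. 1) t = 0 \<and> Dh 3 0 1 2 (\<lambda>_. 1) t = 0 \<longleftrightarrow>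
     E1 (t 0) (\<lambda>_. 1) t = 0 \<and> E2 (t 0) (\<lambda>_. 1) t = 0 \<and> E3 (t 0) (\<lambda>_. 1) t = 0 \<and> EL (t 0) (\<lambda>_. 1) t = 0" for t
    by (rule Dh_iff[where z = "t 0", OF delta shift]) simp_all
  have "\<forall>z\<in>?Z. \<exists>t. t 0 = z \<and> E1 z (\<lambda>_. 1) t = 0 \<and> E2 z (\<lambda>_. 1) t = 0 \<and> E3 z (\<lambda>_. 1) t = 0 \<and> EL z (\<lambda>_. 1) t = 0"
  proof
    fix z assume that: "z \<in> ?Z"
    interpret E: elim_field "poly pA1 z" "poly pB1 z" "poly pC1 z" "poly pA2 z" "poly pB2 z" "poly pC2 z"
      "poly pA3 z" "poly pB3 z" "poly pC3 z" .
    have gz: "poly pR z = 0" "poly pG1 z \<noteq> 0" "poly pG2 z \<noteq> 0" "poly pG3 z \<noteq> 0" "poly pm z \<noteq> 0"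
      using nz that by auto
    obtain y1 y2 y3 where
      "poly pA3 z + poly pB3 z * y1 + poly pC3 z * y2 + y1 * y2 = 0"
      "poly pA2 z + poly pB2 z * y1 + poly pC2 z * y3 + y1 * y3 = 0"
      "poly pA1 z + poly pB1 z * y2 + poly pC1 z * y3 + y2 * y3 = 0"
      "poly pK0 z + poly pK1 z * y1 + poly pK2 z * y2 + poly pK3 z * y3 = 0"
      by (rule E.elim_solve[OF gz[unfolded poly_pG poly_pR poly_pm]])
    then show "\<exists>t. t 0 = z \<and> E1 z (\<lambda>_. 1) t = 0 \<and> E2 z (\<lambda>_. 1) t = 0 \<and> E3 z (\<lambda>_. 1) t = 0 \<and> EL z (\<lambda>_. 1) t = 0"
      by (intro exI[of _ "\<lambda>j. if j = 0 then z else if j = 1 then y1 else if j = 2 then y2 else y3"])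
         (simp add: mult.commute)
  qed
  from bchoice[OF this] obtain t where "\<forall>z\<in>?Z. t z 0 = z \<and> E1 z (\<lambda>_. 1) (t z) = 0 \<and>
    E2 z (\<lambda>_. 1) (t z) = 0 \<and> E3 z (\<lambda>_. 1) (t z) = 0 \<and> EL z (\<lambda>_. 1) (t z) = 0" ..
  then have t: "\<And>z. z \<in> ?Z \<Longrightarrow> t z 0 = z"
    "\<And>z. z \<in> ?Z \<Longrightarrow> E1 z (\<lambda>_. 1) (t z) = 0 \<and> E2 z (\<lambda>_. 1) (t z) = 0 \<and> E3 z (\<lambda>_. 1) (t z) = 0 \<and> EL z (\<lambda>_. 1) (t z) = 0"
    by simp_all
  have XS: "Xt (t z) \<in> S" if "z \<in> ?Z" for z
    using DE[of "t z"] t[OF that] by (intro Xt_mem_S) simp_all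
  \<comment> \<open>Equal spaces with different z would make \<open>mu 0\<close> vanish on them.
    There each \<open>lam j\<close> is a multiple of \<open>mu j\<close> and the \<open>mu j\<close>
    sum to zero, so \<open>mu 1\<close> and \<open>mu 2\<close> alone would be injective on a
    3-dimensional space.\<close>
  have inj: "inj_on (\<lambda>z. Xt (t z)) ?Z"
  proof (rule inj_onI)
    fix z z' assume zz: "z \<in> ?Z" "z' \<in> ?Z" "Xt (t z) = Xt (t z')"
    have Xz: "cv.subspace (Xt (t z))" "Xt (t z) \<subseteq> cspace 7" "cv.dim (Xt (t z)) = 3"
      using S_dim[OF XS[OF zz(1)]] by simp_all
    have "\<exists>v\<in>Xt (t z). ip (mu 0) v \<noteq> 0"
    proof (rule ccontr)
      assume "\<not> ?thesis"
      then have c: "ip (mu 0) v = 0" if "v \<in> Xt (t z)" for v using that by blast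
      have "cv.dim (Xt (t z)) \<le> 2"
      proof (rule dim_le_if_injective[of _ 2 "\<lambda>j. mu (Suc j)"])
        show "cv.subspace (Xt (t z))" by (rule Xz(1))
        show "fd (Xt (t z))" using fd_cspace Xz(2) by (rule fd_subset)
        fix v assume v: "v \<in> Xt (t z)" "\<forall>j<2. ip (mu (Suc j)) v = 0"
        have m: "ip (mu 0) v = 0" "ip (mu 1) v = 0" "ip (mu 2) v = 0"
          using c[OF v(1)] v(2)[rule_format, of 0] v(2)[rule_format, of 1] by (simp_all add: numeral_2_eq_2)
        then have "ip (mu 3) v = 0" using sum_mu[of v] by simp
        moreover have "j = 0 \<or> j = 1 \<or> j = 2 \<or> j = 3" if "j < 4" for j :: nat using that by auto
        ultimately have "ip (mu j) v = 0" if "j < 4" for j using m that by metis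
        then show "v = 0" using mu_0_Xt v(1) by blast
      qed
      then show False using Xz(3) by simp
    qed
    then obtain v where v: "v \<in> Xt (t z)" "ip (mu 0) v \<noteq> 0" by blast
    have *: "ip (lam 0) v + s 0 * ip (mu 0) v = 0" if "v \<in> Xt s" for s
      using that by (simp add: Xt_def)
    have "ip (lam 0) v + z * ip (mu 0) v = 0" "ip (lam 0) v + z' * ip (mu 0) v = 0"
      using *[of "t z"] *[of "t z'"] v(1) zz(3) t(1)[OF zz(1)] t(1)[OF zz(2)] by simp_all
    then have "(z - z') * ip (mu 0) v = 0" by Groebner_Basis.algebra
    then show "z = z'" using v(2) by simp
  qed
  have "S \<subseteq> (\<lambda>z. Xt (t z)) ` ?Z"
  proof
    fix X assume X: "X \<in> S"
    obtain a b where ab: "\<And>j. j < 4 \<Longrightarrow> a j \<noteq> 0 \<or> b j \<noteq> 0"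
      "\<And>j v. j < 4 \<Longrightarrow> v \<in> X \<Longrightarrow> a j * ip (lam j) v + b j * ip (mu j) v = 0"
      "\<And>j i1 i2 i3. j < 4 \<Longrightarrow> i1 < 4 \<Longrightarrow> i2 < 4 \<Longrightarrow> i3 < 4 \<Longrightarrow> Dh j i1 i2 i3 a b = 0"
      by (rule S_dest[OF X]) (rule that; assumption)
    have D: "Dh 0 1 2 3 a b = 0" "Dh 1 0 2 3 a b = 0" "Dh 2 0 1 3 a b = 0" "Dh 3 0 1 2 a b = 0"
      by (intro ab(3); simp)+
    have "\<not> (\<forall>j<4. a j = 0)"
    proof
      assume "\<forall>j<4. a j = 0"
      then have "ip (mu j) v = 0" if "j < 4" "v \<in> X" for j v using ab(1)[OF that(1)] ab(2)[OF that] that(1) by auto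
      moreover have "det (mat 4 4 (\<lambda>(l,j). zmat L M j l)) \<noteq> 0" using nz by blast
      ultimately show False using mu_nonzero_on[OF X] by blast
    qed
    then have a: "\<forall>j<4. a j \<noteq> 0" using no_solution_at_infinity[OF gen shift ab(1) D] by blast
    define y where "y j = b j / a j" for j
    define z where "z = y 0"
    have y: "b j = y j * a j" if "j < 4" for j using a that by (simp add: y_def)
    have bya: "b 0 = z * a 0" "b 1 = y 1 * a 1" "b 2 = y 2 * a 2" "b 3 = y 3 * a 3"
      using y[of 0] y[of 1] y[of 2] y[of 3] by (simp_all add: z_def)
    have an: "a 0 \<noteq> 0" "a 1 \<noteq> 0" "a 2 \<noteq> 0" "a 3 \<noteq> 0" using a by simp_all
    have "E1 z a b = 0" "E2 z a b = 0" "E3 z a b = 0" "EL z a b = 0"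
      using Dh_iff[where a = a and b = b and z = z, OF delta shift an(1) bya(1)] D by blast+
    then have "a 2 * a 3 * (poly pA1 z + poly pB1 z * y 2 + poly pC1 z * y 3 + y 2 * y 3) = 0"
      "a 1 * a 3 * (poly pA2 z + poly pB2 z * y 1 + poly pC2 z * y 3 + y 1 * y 3) = 0"
      "a 1 * a 2 * (poly pA3 z + poly pB3 z * y 1 + poly pC3 z * y 2 + y 1 * y 2) = 0"
      "a 1 * a 2 * a 3 * (poly pK0 z + poly pK1 z * y 1 + poly pK2 z * y 2 + poly pK3 z * y 3) = 0"
      unfolding bya by (simp_all add: algebra_simps)
    then have Ey: "poly pA1 z + poly pB1 z * y 2 + poly pC1 z * y 3 + y 2 * y 3 = 0"
      "poly pA2 z + poly pB2 z * y 1 + poly pC2 z * y 3 + y 1 * y 3 = 0"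
      "poly pA3 z + poly pB3 z * y 1 + poly pC3 z * y 2 + y 1 * y 2 = 0"
      "poly pK0 z + poly pK1 z * y 1 + poly pK2 z * y 2 + poly pK3 z * y 3 = 0"
      using an by simp_all
    interpret E: elim_field "poly pA1 z" "poly pB1 z" "poly pC1 z" "poly pA2 z" "poly pB2 z" "poly pC2 z"
      "poly pA3 z" "poly pB3 z" "poly pC3 z" .
    have zZ: "z \<in> ?Z" using E.elim_res_eq_0[OF Ey(3,2,1,4)] by (simp add: poly_pR)
    have Et: "poly pA1 z + poly pB1 z * t z 2 + poly pC1 z * t z 3 + t z 2 * t z 3 = 0"
      "poly pA2 z + poly pB2 z * t z 1 + poly pC2 z * t z 3 + t z 1 * t z 3 = 0"
      "poly pA3 z + poly pB3 z * t z 1 + poly pC3 z * t z 2 + t z 1 * t z 2 = 0"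
      "poly pK0 z + poly pK1 z * t z 1 + poly pK2 z * t z 2 + poly pK3 z * t z 3 = 0"
      using t(2)[OF zZ] by (simp_all add: mult.commute)
    have g: "E.G1 \<noteq> 0" "E.G2 \<noteq> 0" "E.G3 \<noteq> 0" "E.elim_lin (poly pK1 z) (poly pK2 z) (poly pK3 z) \<noteq> 0"
      using nz zZ unfolding poly_pG[symmetric] poly_pm[symmetric] by auto
    have t3: "t z 3 = y 3"
      using E.elim_y3[OF Ey(3,2,1,4)] E.elim_y3[OF Et(3,2,1,4)] g(4) by (metis mult_left_cancel)
    have "t z 1 = y 1" "t z 2 = y 2"
      using E.G_y[OF Ey(3,2,1)] E.G_y[OF Et(3,2,1)] g(1,2) t3 by (metis mult_left_cancel)+
    moreover have "t z 0 = y 0" using t(1)[OF zZ] by (simp add: z_def)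
    moreover have "j = 0 \<or> j = 1 \<or> j = 2 \<or> j = 3" if "j < 4" for j :: nat using that by auto
    ultimately have ty: "t z j = y j" if "j < 4" for j using t3 that by metis
    have "X \<subseteq> Xt (t z)"
    proof
      fix v assume v: "v \<in> X"
      have "1 * ip (lam j) v + t z j * ip (mu j) v = 0" if "j < 4" for j
      proof -
        have "a j * (1 * ip (lam j) v + t z j * ip (mu j) v) = 0"
          using ab(2)[OF that v] y[OF that] ty[OF that] by (simp add: algebra_simps)
        then show ?thesis using a that by simp
      qed
      then show "v \<in> Xt (t z)" using v S_dim[OF X] unfolding Xt_def by auto
    qed
    then have "X = Xt (t z)"
      using S_dim[OF X] S_dim[OF XS[OF zZ]] by (intro subspace_eqI) (auto intro: fd_subset[OF fd_cspace])
    then show "X \<in> (\<lambda>z. Xt (t z)) ` ?Z" using zZ by blast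
  qed
  then have S: "S = (\<lambda>z. Xt (t z)) ` ?Z" using XS by auto
  have R0: "pR \<noteq> 0" using nz by auto
  show "finite S" unfolding S using poly_roots_finite[OF R0] by simp
  show "card S = 8" unfolding S card_image[OF inj]
    using card_roots_squarefree[OF R0] nz by simp
qed

end

section \<open>The osculating flags at \<open>0, 1, -1, 2\<close>\<close>

definition s0 :: "nat \<Rightarrow> real" where
  "s0 j = (if j = 0 then 0 else if j = 1 then 1 else if j = 2 then -1 else 2)"

text \<open>For deg p <= 6 the residues of p / prod (X - s_j)^2 sum to zero. In the partial
  fractions of 36 / prod (X - s_j)^2 the coefficient of (X - s_j)^(-2) is \<open>c0 j\<close> and
  that of (X - s_j)^(-1) is \<open>- 6 * d0 j\<close>. As \<open>oh 6\<close> is the value and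
  \<open>- 6 * oh 5\<close> the derivative at s_j, this is the relation between the eight
  functionals.\<close>

definition c0 :: "nat \<Rightarrow> complex" where
  "c0 j = (if j = 0 then 9 else if j = 1 then 9 else if j = 2 then 1 else 1)"

definition d0 :: "nat \<Rightarrow> complex" where
  "d0 j = (if j = 0 then - (3 / 2) else if j = 1 then 3 / 2 else if j = 2 then - (11 / 18) else 11 / 18)"

text \<open>The values at 1, 2, 3 solve the linear system \<open>kmat\<close>, which makes the three
  coefficients \<open>True False False\<close> in \<open>tri0\<close> vanish.\<close>

definition kap0 :: "nat \<Rightarrow> complex" where
  "kap0 j = (if j = 0 then 0 else if j = 1 then 10 / 27 else if j = 2 then - 126 else - (9 / 4))"

definition M0 :: "nat \<Rightarrow> nat \<Rightarrow> nat \<Rightarrow> complex" where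
  "M0 j i k = c0 i * (of_nat (5 choose k) * complex_of_real (s0 j - s0 i) ^ (5 - k))
    + d0 i * (of_nat (6 choose k) * complex_of_real (s0 j - s0 i) ^ (6 - k))"

definition L0 :: "nat \<Rightarrow> nat \<Rightarrow> nat \<Rightarrow> complex" where
  "L0 j i k = of_nat (6 choose k) * complex_of_real (s0 j - s0 i) ^ (6 - k) + kap0 i * M0 j i k"

lemma choose_5_6: "5 choose 0 = (1::nat)" "5 choose 1 = (5::nat)" "5 choose 2 = (10::nat)"
    "6 choose 0 = (1::nat)" "6 choose 1 = (6::nat)" "6 choose 2 = (15::nat)"
  by (simp_all add: numeral_eq_Suc)

lemma M0_values:
  "M0 0 1 0 = - (15 / 2)" "M0 0 1 1 = 36" "M0 0 1 2 = - (135 / 2)" "M0 0 2 0 = 7 / 18"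
  "M0 0 2 1 = 4 / 3" "M0 0 2 2 = 5 / 6" "M0 0 3 0 = 64 / 9" "M0 0 3 1 = - (112 / 3)"
  "M0 0 3 2 = 200 / 3" "M0 1 0 0 = 15 / 2" "M0 1 0 1 = 36" "M0 1 0 2 = 135 / 2"
  "M0 1 2 0 = - (64 / 9)" "M0 1 2 1 = - (112 / 3)" "M0 1 2 2 = - (200 / 3)" "M0 1 3 0 = - (7 / 18)"
  "M0 1 3 1 = 4 / 3" "M0 1 3 2 = - (5 / 6)" "M0 2 0 0 = - (21 / 2)" "M0 2 0 1 = 54"
  "M0 2 0 2 = - (225 / 2)" "M0 2 1 0 = - 192" "M0 2 1 1 = 432" "M0 2 1 2 = - 360"
  "M0 2 3 0 = 405 / 2" "M0 2 3 1 = - 486" "M0 2 3 2 = 945 / 2" "M0 3 0 0 = 192"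
  "M0 3 0 1 = 432" "M0 3 0 2 = 360" "M0 3 1 0 = 21 / 2" "M0 3 1 1 = 54"
  "M0 3 1 2 = 225 / 2" "M0 3 2 0 = - (405 / 2)" "M0 3 2 1 = - 486" "M0 3 2 2 = - (945 / 2)"
  by (simp_all add: M0_def c0_def d0_def s0_def choose_5_6 del: One_nat_def)

lemma L0_values:
  "L0 0 1 0 = - (16 / 9)" "L0 0 1 1 = 22 / 3" "L0 0 1 2 = - 10" "L0 0 2 0 = - 48"
  "L0 0 2 1 = - 162" "L0 0 2 2 = - 90" "L0 0 3 0 = 48" "L0 0 3 1 = - 108"
  "L0 0 3 2 = 90" "L0 1 0 0 = 1" "L0 1 0 1 = 6" "L0 1 0 2 = 15"
  "L0 1 2 0 = 960" "L0 1 2 1 = 4896" "L0 1 2 2 = 8640" "L0 1 3 0 = 15 / 8"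
  "L0 1 3 1 = - 9" "L0 1 3 2 = 135 / 8" "L0 2 0 0 = 1" "L0 2 0 1 = - 6"
  "L0 2 0 2 = 15" "L0 2 1 0 = - (64 / 9)" "L0 2 1 1 = - 32" "L0 2 1 2 = 320 / 3"
  "L0 2 3 0 = 2187 / 8" "L0 2 3 1 = - (729 / 2)" "L0 2 3 2 = 1215 / 8" "L0 3 0 0 = 64"
  "L0 3 0 1 = 192" "L0 3 0 2 = 240" "L0 3 1 0 = 44 / 9" "L0 3 1 1 = 26"
  "L0 3 1 2 = 170 / 3" "L0 3 2 0 = 26244" "L0 3 2 1 = 62694" "L0 3 2 2 = 60750"
  by (simp_all add: L0_def M0_values kap0_def s0_def choose_5_6 del: One_nat_def)

lemma tri0_0:
  "tri L0 M0 0 1 2 3 False False False = - 86400" "tri L0 M0 0 1 2 3 False False True = 43520 / 3" "tri L0 M0 0 1 2 3 False True False = 2170 / 3" "tri L0 M0 0 1 2 3 False True True = - 120"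
  "tri L0 M0 0 1 2 3 True False False = - 692550" "tri L0 M0 0 1 2 3 True False True = - 360" "tri L0 M0 0 1 2 3 True True False = 5760"
  by (simp_all add: tri_def d3_def L0_values M0_values del: One_nat_def)

lemma tri0_1:
  "tri L0 M0 1 0 2 3 False False False = - 106920" "tri L0 M0 1 0 2 3 False False True = 16800" "tri L0 M0 1 0 2 3 False True False = 750" "tri L0 M0 1 0 2 3 False True True = - 120"
  "tri L0 M0 1 0 2 3 True False False = 0" "tri L0 M0 1 0 2 3 True False True = 5760" "tri L0 M0 1 0 2 3 True True False = - 360"
  by (simp_all add: tri_def d3_def L0_values M0_values del: One_nat_def)

lemma tri0_2:
  "tri L0 M0 2 0 1 3 False False False = 22680" "tri L0 M0 2 0 1 3 False False True = 36000" "tri L0 M0 2 0 1 3 False True False = - 371790" "tri L0 M0 2 0 1 3 False True True = 9720"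
  "tri L0 M0 2 0 1 3 True False False = 0" "tri L0 M0 2 0 1 3 True False True = - 155520" "tri L0 M0 2 0 1 3 True True False = 2361960"
  by (simp_all add: tri_def d3_def L0_values M0_values del: One_nat_def)

lemma tri0_3:
  "tri L0 M0 3 0 1 2 False False False = 12026880" "tri L0 M0 3 0 1 2 False False True = - 90000" "tri L0 M0 3 0 1 2 False True False = 20820240" "tri L0 M0 3 0 1 2 False True True = - 155520"
  "tri L0 M0 3 0 1 2 True False False = 0" "tri L0 M0 3 0 1 2 True False True = 9720" "tri L0 M0 3 0 1 2 True True False = 2361960"
  by (simp_all add: tri_def d3_def L0_values M0_values del: One_nat_def)

lemmas tri0 = tri0_0 tri0_1 tri0_2 tri0_3

interpretation Z: system_coeffs L0 M0 .

lemma Z_values: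
  "Z.pA3 = [:- (232 / 3):]" "Z.pB3 = [:- (1071 / 8), - (243 / 16):]" "Z.pC3 = [:125 / 216, - (1 / 16):]" "Z.pA2 = [:7 / 3:]"
  "Z.pB2 = [:- (153 / 4), 243:]" "Z.pC2 = [:100 / 27, - 16:]" "Z.pA1 = [:891:]" "Z.pB1 = [:- (25 / 4), 3:]"
  "Z.pC1 = [:- 140, - 48:]" "Z.pK0 = [:466800:]" "Z.pK1 = [:64800, 174960:]" "Z.pK2 = [:- 3360, 720:]"
  "Z.pK3 = [:- 960, - 11520:]"
  by (simp_all add: Z.p_defs Z.N1_def Z.N2_def Z.N3_def tri0 del: One_nat_def)

interpretation ZE: elim Z.pA1 Z.pB1 Z.pC1 Z.pA2 Z.pB2 Z.pC2 Z.pA3 Z.pB3 Z.pC3 .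

lemma ZE_G1:
  "ZE.G1 = [:180, - 540, - 8019:]" "ZE.G2 = [:- 44, 252, - 63:]" "ZE.G3 = [:19, 9 / 2, - 522:]" "ZE.k1 = [:- (24219 / 4), 263655 / 8:]"
  "ZE.k2 = [:559 / 12, 2023 / 8:]" "ZE.f3 = [:- (21789 / 16), 12393 / 32, 341901 / 8:]" "ZE.f2 = [:- 830736, 4327344, 1116828:]" "ZE.f1 = [:- (10384 / 81), - (4880 / 27), 2828:]"
  unfolding ZE.G1_def ZE.G2_def ZE.G3_def ZE.k1_def ZE.k2_def ZE.f3_def ZE.f2_def ZE.f1_def  unfolding Z_values by simp_all

lemma ZE_e3:
  "ZE.e3 = [:- (27 / 2), - (729 / 4), 0, 1458:]"
  unfolding ZE.e3_def unfolding ZE_G1 unfolding Z_values by simp_all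

lemma ZE_e2:
  "ZE.e2 = [:12096, - 66096, 0, 1458:]" "ZE.e1 = [:- (320 / 3), - 688, 0, 1458:]" "ZE.h12 = [:- 696960, - 635904, 25769664, 8740224, - 93037896:]" "ZE.h13 = [:- 51120, 14364, 3095334, - (175203 / 2), - (179947089 / 4):]"
  "ZE.h23 = [:- 133488, - 656100, 9055638, 17616285 / 2, - (370676817 / 4):]"
  unfolding ZE.e2_def ZE.e1_def ZE.h12_def ZE.h13_def ZE.h23_def unfolding ZE_e3 unfolding ZE_G1 unfolding Z_values by simp_all

lemma Z_pR: "Z.pR = smult 241864704000 [:2048, 0, - 134784, 0, 2737800, 442260, - 16068618, - 12936105, 1535274:]"
  unfolding Z.pR_def ZE.elim_res_def unfolding ZE_e2 unfolding ZE_e3 unfolding ZE_G1 unfolding Z_values by simp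

lemma Z_pm: "Z.pm = smult 25920 [:- 2240, 8112, 81900, - 231444, - 479115, 113724:]"
  unfolding Z.pm_def ZE.elim_lin_def unfolding ZE_G1 unfolding Z_values by simp

lemma no_common_root_Bezout:
  fixes p q u v :: "complex poly"
  assumes "u * p + v * q = [:n:]" "n \<noteq> 0" "poly p z = 0"
  shows "poly q z \<noteq> 0"
  using arg_cong[OF assms(1), of "\<lambda>r. poly r z"] assms(2,3) by auto

definition R0 :: "complex poly" where "R0 = [:2048, 0, - 134784, 0, 2737800, 442260, - 16068618, - 12936105, 1535274:]"

text \<open>In this and the next four lemmas the second polynomial is proportional to
  \<open>Z.pG1\<close>, \<open>Z.pG2\<close>, \<open>Z.pG3\<close>, \<open>Z.pm\<close> and
  \<open>pderiv R0\<close> respectively. The two long lists are the Bezout cofactors of least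
  degree, scaled to integers, and the last number is the constant that they produce.\<close>

lemma R0_G1: "poly R0 z = 0 \<Longrightarrow> poly ([:20, - 60, - 891:]) z \<noteq> 0"
  by (rule no_common_root_Bezout[of "[:993282822674542, - 8278207264999485:]" R0 "[:- 101686211978564608, 542629788000253440, 3791700218923980480, - 20239236688101297120, - 27767950907158615356, 126277482271588721640, 122860343327731148763, - 14264103681890930790:]" _ "518981266169856"])
     (simp add: R0_def, simp, assumption)

lemma R0_G2: "poly R0 z = 0 \<Longrightarrow> poly ([:- 44, 252, - 63:]) z \<noteq> 0"
  by (rule no_common_root_Bezout[of "[:1043020774355938, - 273254750528151:]" R0 "[:48433897129747456, 264675371536697856, - 1748537589607204032, - 9556264833923660832, 12671850137004054108, 79739100698474945448, 54890335959683796117, - 6659062124799309498:]" _ "5015072172072960"])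
     (simp add: R0_def, simp, assumption)

lemma R0_G3: "poly R0 z = 0 \<Longrightarrow> poly ([:38, 9, - 1044:]) z \<noteq> 0"
  by (rule no_common_root_Bezout[of "[:- 36052935487838719, 182982190538227692:]" R0 "[:1943180176675177984, - 10322003889799129344, - 72046860982520419008, 382508454142022999328, 527532311199350537892, - 2379811439032378074612, - 2318013575703874632987, 269087930647880250582:]" _ "4434834563066880"])
     (simp add: R0_def, simp, assumption)

lemma R0_m: "poly R0 z = 0 \<Longrightarrow> poly ([:- 2240, 8112, 81900, - 231444, - 479115, 113724:]) z \<noteq> 0"
  by (rule no_common_root_Bezout[of "[:793108293157703034439840, - 7119598321163303176284720, 9128129541874691814609858, 33088570099029791272561635, - 7520718067623981807022332:]" R0 "[:725126321508039879715840, - 3883353857888047053917952, - 26927598056646360942086400, 144224928094122567964074960, 197136620914521846853959300, - 899385628740038030163341340, - 874436536433016147453977205, 101529693912923754394801482:]" _ "2824208966483969310720"])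
     (simp add: R0_def, simp, assumption)

lemma R0_deriv: "poly R0 z = 0 \<Longrightarrow> poly ([:0, - 3328, 0, 135200, 27300, - 1190268, - 1117935, 151632:]) z \<noteq> 0"
  by (rule no_common_root_Bezout[of "[:3047525349640499599444992, 163943866508246272984819628800, - 921013224738757104787731591888, - 1898653166586635938836160845860, 9463884143338862873193575748432, 10972608192451507338298095063075, - 1453421855912072960402276390928:]" R0 "[:100888533235843860298350540800, - 566900793846664812410843117184, - 3709531879546516270548495536160, 20924727870468247981974879457176, 27084537573295449076787835734220, - 131586505613659240803299866437342, - 126597039458883852354558113088765, 14715896291109738724073048458146:]" _ "6241331916063743179663343616"])
     (simp add: R0_def, simp, assumption)

lemma Z_pG: "Z.pG1 = smult 9 ([:20, - 60, - 891:])" "Z.pG2 = smult 1 ([:- 44, 252, - 63:])" "Z.pG3 = smult (1 / 2) ([:38, 9, - 1044:])"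
  unfolding Z.pG1_def Z.pG2_def Z.pG3_def ZE_G1 by simp_all

lemma pderiv_R0: "pderiv R0 = smult 81 ([:0, - 3328, 0, 135200, 27300, - 1190268, - 1117935, 151632:])"
  by (simp add: R0_def pderiv_pCons)

lemma L0_diag: "k < 3 \<Longrightarrow> L0 j j k = 0"
  by (auto simp: L0_def M0_def less_3_iff)

lemma zmat0:
  "zmat L0 M0 0 0 = 0" "zmat L0 M0 0 1 = - 120" "zmat L0 M0 0 2 = - 360" "zmat L0 M0 0 3 = 5760"
  "zmat L0 M0 1 0 = - 120" "zmat L0 M0 1 1 = 0" "zmat L0 M0 1 2 = 5760" "zmat L0 M0 1 3 = - 360"
  "zmat L0 M0 2 0 = 9720" "zmat L0 M0 2 1 = - 155520" "zmat L0 M0 2 2 = 0" "zmat L0 M0 2 3 = 2361960"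
  "zmat L0 M0 3 0 = - 155520" "zmat L0 M0 3 1 = 9720" "zmat L0 M0 3 2 = 2361960" "zmat L0 M0 3 3 = 0"
  by (simp_all add: zmat_def d3_def L0_values M0_values L0_diag del: One_nat_def)

lemma sum_less_4: "(\<Sum>k<(4::nat). f k) = f 0 + f 1 + f 2 + (f 3 :: 'a::comm_monoid_add)"
  by (simp add: numeral_eq_Suc)

lemma all_less_4: "(\<forall>j<4. P j) \<longleftrightarrow> P 0 \<and> P 1 \<and> P 2 \<and> P (3::nat)"
  by (auto simp: less_Suc_eq numeral_eq_Suc)

lemma det_zmat0: "det (mat 4 4 (\<lambda>(l,j). zmat L0 M0 j l)) \<noteq> 0"
proof (rule inj_det_nz)
  fix y :: "nat \<Rightarrow> complex"
  assume *: "\<And>i. i < 4 \<Longrightarrow> (\<Sum>j<4. zmat L0 M0 j i * y j) = 0"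
  have e: "- 120 * y 1 + 9720 * y 2 - 155520 * y 3 = 0" "- 120 * y 0 - 155520 * y 2 + 9720 * y 3 = 0"
    "- 360 * y 0 + 5760 * y 1 + 2361960 * y 3 = 0" "5760 * y 0 - 360 * y 1 + 2361960 * y 2 = 0"
    using *[of 0] *[of 1] *[of 2] *[of 3] by (simp_all add: sum_less_4 zmat0 del: One_nat_def)
  have "y 0 = 0" "y 1 = 0" "y 2 = 0" "y 3 = 0" using e by Groebner_Basis.algebra+
  then show "\<forall>j<4. y j = 0" unfolding all_less_4 by blast
qed

lemma generic0: "Z.generic"
proof -
  have R: "Z.pR = smult 241864704000 R0" unfolding Z_pR R0_def ..
  have r: "poly R0 z = 0" if "poly Z.pR z = 0" for z using that unfolding R by simp
  have "degree Z.pR = 8" unfolding R R0_def by simp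
  moreover have "poly (pderiv Z.pR) z \<noteq> 0" if "poly Z.pR z = 0" for z
    using R0_deriv[OF r[OF that]] unfolding R pderiv_smult pderiv_R0 poly_smult by (simp del: poly_pCons)
  moreover have "poly Z.pG1 z \<noteq> 0" "poly Z.pG2 z \<noteq> 0" "poly Z.pG3 z \<noteq> 0" "poly Z.pm z \<noteq> 0"
    if "poly Z.pR z = 0" for z
    using R0_G1[OF r[OF that]] R0_G2[OF r[OF that]] R0_G3[OF r[OF that]] R0_m[OF r[OF that]]
    unfolding Z_pG Z_pm poly_smult by (simp_all del: poly_pCons)
  moreover have "Z.dinf \<noteq> 0" unfolding Z.dinf_def tri0 by simp
  ultimately show ?thesis
    unfolding Z.generic_def tri0 using det_zmat0 by auto
qed

section \<open>Generic flags\<close>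

lemma zpoly_add_max: "zpoly x0 m F \<Longrightarrow> zpoly x0 n G \<Longrightarrow> zpoly x0 (max m n) (\<lambda>x. F x + G x)"
  by (intro zpoly_add) (auto elim: zpoly_weaken)

lemma zpoly_diff_max: "zpoly x0 m F \<Longrightarrow> zpoly x0 n G \<Longrightarrow> zpoly x0 (max m n) (\<lambda>x. F x - G x)"
  by (intro zpoly_diff) (auto elim: zpoly_weaken)

lemmas zpoly_rules = zpoly_add_max zpoly_diff_max zpoly_mult

context
  fixes x0 :: "'v \<Rightarrow> complex" and A1 B1 C1 A2 B2 C2 A3 B3 C3 K0 K1 K2 K3 :: "('v \<Rightarrow> complex) \<Rightarrow> complex poly"
  assumes A: "zpoly x0 0 A1" "zpoly x0 0 A2" "zpoly x0 0 A3" "zpoly x0 0 K0"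
    and B: "zpoly x0 1 B1" "zpoly x0 1 B2" "zpoly x0 1 B3" "zpoly x0 1 C1" "zpoly x0 1 C2" "zpoly x0 1 C3"
      "zpoly x0 1 K1" "zpoly x0 1 K2" "zpoly x0 1 K3"
begin

lemma zpoly_elim_G:
  "zpoly x0 2 (\<lambda>x. elim.G1 (A1 x) (B1 x) (C1 x) (B2 x) (B3 x))"
  "zpoly x0 2 (\<lambda>x. elim.G2 (B1 x) (A2 x) (B2 x) (C2 x) (C3 x))"
  "zpoly x0 2 (\<lambda>x. elim.G3 (C1 x) (C2 x) (A3 x) (B3 x) (C3 x))"
  unfolding elim.G1_def elim.G2_def elim.G3_def
  by (rule zpoly_weaken, (rule zpoly_rules A B)+, simp)+

lemma zpoly_elim_k:
  "zpoly x0 1 (\<lambda>x. elim.k1 (A1 x) (A2 x) (B2 x) (C2 x) (A3 x) (B3 x) (C3 x))"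
  "zpoly x0 1 (\<lambda>x. elim.k2 (A1 x) (B1 x) (C1 x) (A2 x) (A3 x) (B3 x) (C3 x))"
  unfolding elim.k1_def elim.k2_def
  by (rule zpoly_weaken, (rule zpoly_rules A B)+, simp)+

lemma zpoly_elim_e3:
  "zpoly x0 3 (\<lambda>x. elim.e3 (A1 x) (B1 x) (C1 x) (A2 x) (B2 x) (C2 x) (A3 x) (B3 x) (C3 x))"
  unfolding elim.e3_def
  by (rule zpoly_weaken, (rule zpoly_rules A B zpoly_elim_G zpoly_elim_k)+, simp)+

lemma zpoly_elim_e:
  "zpoly x0 3 (\<lambda>x. elim.e2 (A1 x) (B1 x) (C1 x) (A2 x) (B2 x) (C2 x) (A3 x) (B3 x) (C3 x))"
  "zpoly x0 3 (\<lambda>x. elim.e1 (A1 x) (B1 x) (C1 x) (A2 x) (B2 x) (C2 x) (A3 x) (B3 x) (C3 x))"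
  unfolding elim.e2_def elim.e1_def
  by (rule zpoly_weaken, (rule zpoly_rules A B zpoly_elim_e3 zpoly_elim_k)+, simp)+

lemma zpoly_elim_f:
  "zpoly x0 2 (\<lambda>x. elim.f1 (A1 x) (B1 x) (C1 x) (A2 x) (C2 x) (A3 x) (C3 x))"
  "zpoly x0 2 (\<lambda>x. elim.f2 (A1 x) (C1 x) (A2 x) (B2 x) (C2 x) (A3 x) (B3 x))"
  "zpoly x0 2 (\<lambda>x. elim.f3 (A1 x) (B1 x) (A2 x) (B2 x) (A3 x) (B3 x) (C3 x))"
  unfolding elim.f1_def elim.f2_def elim.f3_def
  by (rule zpoly_weaken, (rule zpoly_rules A B)+, simp)+

lemma zpoly_elim_h:
  "zpoly x0 4 (\<lambda>x. elim.h12 (A1 x) (B1 x) (C1 x) (A2 x) (B2 x) (C2 x) (A3 x) (B3 x) (C3 x))"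
  "zpoly x0 4 (\<lambda>x. elim.h13 (A1 x) (B1 x) (C1 x) (A2 x) (B2 x) (C2 x) (A3 x) (B3 x) (C3 x))"
  "zpoly x0 4 (\<lambda>x. elim.h23 (A1 x) (B1 x) (C1 x) (A2 x) (B2 x) (C2 x) (A3 x) (B3 x) (C3 x))"
  unfolding elim.h12_def elim.h13_def elim.h23_def
  by (rule zpoly_weaken, (rule zpoly_rules A B zpoly_elim_G zpoly_elim_f zpoly_elim_k zpoly_elim_e3)+, simp)+

text \<open>The bound 8 rests on the constancy of \<open>A1\<close>, \<open>A2\<close>,
  \<open>A3\<close>: with linear ones the terms containing \<open>f1\<close>, \<open>f2\<close> or
  \<open>f3\<close> would only be bounded by 9.\<close>

lemma zpoly_elim_res:
  "zpoly x0 8 (\<lambda>x. elim.elim_res (A1 x) (B1 x) (C1 x) (A2 x) (B2 x) (C2 x) (A3 x) (B3 x) (C3 x) (K0 x) (K1 x) (K2 x) (K3 x))"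
  unfolding elim.elim_res_def
  by (rule zpoly_weaken, (rule zpoly_rules A B zpoly_elim_G zpoly_elim_f zpoly_elim_h zpoly_elim_k zpoly_elim_e zpoly_elim_e3)+, simp)

lemma zpoly_elim_lin:
  "zpoly x0 5 (\<lambda>x. elim.elim_lin (A1 x) (B1 x) (C1 x) (A2 x) (B2 x) (C2 x) (A3 x) (B3 x) (C3 x) (K1 x) (K2 x) (K3 x))"
  unfolding elim.elim_lin_def
  by (rule zpoly_weaken, (rule zpoly_rules A B zpoly_elim_G)+, simp)

end

lemma zreg_d3:
  assumes "\<And>k. zreg x0 (\<lambda>x. u x k)" "\<And>k. zreg x0 (\<lambda>x. v x k)" "\<And>k. zreg x0 (\<lambda>x. w x k)"
  shows "zreg x0 (\<lambda>x. d3 (u x) (v x) (w x))"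
  unfolding d3_def by (intro zreg_intros assms)

lemma zreg_tri:
  assumes "\<And>j i k. zreg x0 (\<lambda>x. L x j i k)" "\<And>j i k. zreg x0 (\<lambda>x. M x j i k)"
  shows "zreg x0 (\<lambda>x. tri (L x) (M x) j i1 i2 i3 b1 b2 b3)"
  unfolding tri_def by (cases b1; cases b2; cases b3; simp; intro zreg_d3 assms)

text \<open>Every clause of \<open>generic\<close> is the nonvanishing of a regular function, the
  clauses on common roots by way of resultants. The hypotheses \<open>deg\<close> say that the
  degree bounds are attained at \<open>x0\<close>, as the resultants require.\<close>

lemma znear_generic:
  fixes L M :: "('v \<Rightarrow> complex) \<Rightarrow> nat \<Rightarrow> nat \<Rightarrow> nat \<Rightarrow> complex"
  assumes L: "\<And>j i k. zreg x0 (\<lambda>x. L x j i k)" and M: "\<And>j i k. zreg x0 (\<lambda>x. M x j i k)"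
    and gen: "system_coeffs.generic (L x0) (M x0)"
    and deg: "degree (system_coeffs.pG1 (L x0) (M x0)) = 2" "degree (system_coeffs.pG2 (L x0) (M x0)) = 2"
      "degree (system_coeffs.pG3 (L x0) (M x0)) = 2" "degree (system_coeffs.pm (L x0) (M x0)) = 5"
  shows "znear x0 (\<lambda>x. system_coeffs.generic (L x) (M x))"
proof -
  let ?R = "\<lambda>x. system_coeffs.pR (L x) (M x)"
  note t = zreg_tri[of x0 L M, OF L M]
  note g0 = gen[unfolded system_coeffs.generic_def]
  have nzt: "znear x0 (\<lambda>x. tri (L x) (M x) j i1 i2 i3 b1 b2 b3 \<noteq> 0)"
    if "tri (L x0) (M x0) j i1 i2 i3 b1 b2 b3 \<noteq> 0" for j i1 i2 i3 b1 b2 b3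
    by (rule znear_nonzero[OF t]) (rule that)
  have N: "zreg x0 (\<lambda>x. system_coeffs.N1 (L x) (M x) b1 b2 b3)" "zreg x0 (\<lambda>x. system_coeffs.N2 (L x) (M x) b1 b2 b3)"
    "zreg x0 (\<lambda>x. system_coeffs.N3 (L x) (M x) b1 b2 b3)" for b1 b2 b3
    unfolding system_coeffs.N1_def system_coeffs.N2_def system_coeffs.N3_def
    using g0 by (intro zreg_divide t; blast)+
  have p0: "zpoly x0 0 (\<lambda>x. system_coeffs.pA1 (L x) (M x))" "zpoly x0 0 (\<lambda>x. system_coeffs.pA2 (L x) (M x))"
    "zpoly x0 0 (\<lambda>x. system_coeffs.pA3 (L x) (M x))" "zpoly x0 0 (\<lambda>x. system_coeffs.pK0 (L x) (M x))"
    unfolding system_coeffs.p_defs by (intro zpoly_const zreg_intros t N)+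
  have p1: "zpoly x0 1 (\<lambda>x. system_coeffs.pB1 (L x) (M x))" "zpoly x0 1 (\<lambda>x. system_coeffs.pB2 (L x) (M x))"
    "zpoly x0 1 (\<lambda>x. system_coeffs.pB3 (L x) (M x))" "zpoly x0 1 (\<lambda>x. system_coeffs.pC1 (L x) (M x))"
    "zpoly x0 1 (\<lambda>x. system_coeffs.pC2 (L x) (M x))" "zpoly x0 1 (\<lambda>x. system_coeffs.pC3 (L x) (M x))"
    "zpoly x0 1 (\<lambda>x. system_coeffs.pK1 (L x) (M x))" "zpoly x0 1 (\<lambda>x. system_coeffs.pK2 (L x) (M x))"
    "zpoly x0 1 (\<lambda>x. system_coeffs.pK3 (L x) (M x))"
    unfolding system_coeffs.p_defs by (intro zpoly_linear zreg_intros t N)+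
  have R: "zpoly x0 8 (\<lambda>x. system_coeffs.pR (L x) (M x))"
    unfolding system_coeffs.pR_def by (rule zpoly_elim_res[OF p0 p1])
  have dR: "degree (?R x0) = 8" using g0 by blast
  have G: "zpoly x0 2 (\<lambda>x. system_coeffs.pG1 (L x) (M x))" "zpoly x0 2 (\<lambda>x. system_coeffs.pG2 (L x) (M x))"
    "zpoly x0 2 (\<lambda>x. system_coeffs.pG3 (L x) (M x))"
    unfolding system_coeffs.pG1_def system_coeffs.pG2_def system_coeffs.pG3_def by (rule zpoly_elim_G[OF p0 p1])+
  have m: "zpoly x0 5 (\<lambda>x. system_coeffs.pm (L x) (M x))"
    unfolding system_coeffs.pm_def by (rule zpoly_elim_lin[OF p0 p1])
  have dp: "degree (pderiv (?R x0)) = 8 - 1" using dR by (simp add: degree_pderiv)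
  have z: "znear x0 (\<lambda>x. det (mat 4 4 (\<lambda>(l,j). zmat (L x) (M x) j l)) \<noteq> 0)"
    by (rule znear_nonzero, rule zreg_det, unfold zmat_def, intro zreg_d3 L M, unfold zmat_def[symmetric]) (use g0 in blast)
  have di: "znear x0 (\<lambda>x. system_coeffs.dinf (L x) (M x) \<noteq> 0)"
    by (rule znear_nonzero, unfold system_coeffs.dinf_def, intro zreg_intros t, unfold system_coeffs.dinf_def[symmetric])
       (use g0 in blast)
  have c:
    "znear x0 (\<lambda>x. tri (L x) (M x) 1 0 2 3 False True True \<noteq> 0)"
    "znear x0 (\<lambda>x. tri (L x) (M x) 2 0 1 3 False True True \<noteq> 0)"
    "znear x0 (\<lambda>x. tri (L x) (M x) 3 0 1 2 False True True \<noteq> 0)"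
    "znear x0 (\<lambda>x. tri (L x) (M x) 3 0 1 2 True True False \<noteq> 0)"
    "znear x0 (\<lambda>x. tri (L x) (M x) 3 0 1 2 True False True \<noteq> 0)"
    "znear x0 (\<lambda>x. tri (L x) (M x) 2 0 1 3 True True False \<noteq> 0)"
    "znear x0 (\<lambda>x. tri (L x) (M x) 2 0 1 3 True False True \<noteq> 0)"
    "znear x0 (\<lambda>x. tri (L x) (M x) 1 0 2 3 True True False \<noteq> 0)"
    "znear x0 (\<lambda>x. tri (L x) (M x) 1 0 2 3 True False True \<noteq> 0)"
    "znear x0 (\<lambda>x. tri (L x) (M x) 0 1 2 3 False False False \<noteq> 0)"
    by (rule nzt; use g0 in blast)+
  have c10: "znear x0 (\<lambda>x. degree (?R x) = 8)"
    using znear_degree[where F = ?R and m = 8, OF R] dR by simp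
  have nc: "znear x0 (\<lambda>x. \<forall>z. poly (?R x) z = 0 \<longrightarrow> poly (G x) z \<noteq> 0)"
    if "zpoly x0 n G" "degree (G x0) = n" "n > 0" "\<And>z. poly (?R x0) z = 0 \<Longrightarrow> poly (G x0) z \<noteq> 0" for n G
    using znear_no_common_root[where F = ?R and m = 8 and G = G and n = n, OF R] dR that by simp
  have c11: "znear x0 (\<lambda>x. \<forall>z. poly (?R x) z = 0 \<longrightarrow> poly (pderiv (?R x)) z \<noteq> 0)"
    by (rule nc[where G = "\<lambda>x. pderiv (?R x)", OF zpoly_pderiv[where F = ?R, OF R]]) (use g0 dp in simp_all)
  have c12: "znear x0 (\<lambda>x. \<forall>z. poly (?R x) z = 0 \<longrightarrow> poly (system_coeffs.pG1 (L x) (M x)) z \<noteq> 0)"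
    "znear x0 (\<lambda>x. \<forall>z. poly (?R x) z = 0 \<longrightarrow> poly (system_coeffs.pG2 (L x) (M x)) z \<noteq> 0)"
    "znear x0 (\<lambda>x. \<forall>z. poly (?R x) z = 0 \<longrightarrow> poly (system_coeffs.pG3 (L x) (M x)) z \<noteq> 0)"
    "znear x0 (\<lambda>x. \<forall>z. poly (?R x) z = 0 \<longrightarrow> poly (system_coeffs.pm (L x) (M x)) z \<noteq> 0)"
    by (rule nc[OF G(1)] nc[OF G(2)] nc[OF G(3)] nc[OF m]; use g0 deg in simp)+
  show ?thesis
    unfolding system_coeffs.generic_def
    by (intro znear_conj c di z c10 c11 c12)
qed

section \<open>Functionals dual to the rows of a matrix\<close>

lemma lin_solve:
  fixes M :: "nat \<Rightarrow> nat \<Rightarrow> complex"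
  assumes "det (mat n n (\<lambda>(i,j). M i j)) \<noteq> 0"
  obtains y where "\<And>i. i < n \<Longrightarrow> (\<Sum>j<n. M i j * y j) = b i"
proof -
  let ?x = "\<lambda>_::nat. 0::complex"
  obtain y where "znear ?x (\<lambda>x. \<forall>i<n. (\<Sum>j<n. M i j * y x j) = b i)"
    by (rule zreg_solve[of n ?x "\<lambda>_. M" "\<lambda>_. b"]) (use assms in \<open>auto intro: zreg_const\<close>)
  from znear_at[OF this] that[of "y ?x"] show ?thesis by blast
qed

lemma det_transpose_mat:
  fixes M :: "nat \<Rightarrow> nat \<Rightarrow> complex"
  shows "det (mat n n (\<lambda>(i,j). M j i)) = det (mat n n (\<lambda>(i,j). M i j))"
proof -
  have "mat n n (\<lambda>(i,j). M j i) = transpose_mat (mat n n (\<lambda>(i,j). M i j))" by (intro eq_matI) auto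
  then show ?thesis by (simp add: det_transpose[of _ n])
qed

context
  fixes A :: "nat \<Rightarrow> nat \<Rightarrow> complex" and h5 h6 :: "nat \<Rightarrow> complex"
  assumes A: "det (mat 7 7 (\<lambda>(i,j). A i j)) \<noteq> 0"
    and h6: "\<And>r. r < 7 \<Longrightarrow> (\<Sum>c<7. A r c * h6 c) = (if r = 6 then 1 else 0)"
    and h5: "\<And>r. r < 7 \<Longrightarrow> (\<Sum>c<7. A r c * h5 c) = (if r = 5 then 1 else 0)"
begin

lemma ip_h_row:
  assumes "r < 7"
  shows "ip h6 (row_vec 7 A r) = (if r = 6 then 1 else 0)" "ip h5 (row_vec 7 A r) = (if r = 5 then 1 else 0)"
proof -
  have "ip h (row_vec 7 A r) = (\<Sum>c<7. A r c * h c)" for h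
    unfolding ip_def row_vec_def by (intro sum.cong) auto
  then show "ip h6 (row_vec 7 A r) = (if r = 6 then 1 else 0)" "ip h5 (row_vec 7 A r) = (if r = 5 then 1 else 0)"
    using h5 h6 assms by auto
qed

lemma sum_rows_apply: "(\<Sum>r<n. cscale (y r) (row_vec 7 A r)) i = (\<Sum>r<n. y r * (if i < 7 then A r i else 0))"
  by (induction n) (auto simp: cscale_def row_vec_def plus_fun_apply)

lemma rows_expand:
  assumes "v \<in> cspace 7"
  obtains y where "v = (\<Sum>r<7. cscale (y r) (row_vec 7 A r))"
proof -
  obtain y where y: "\<And>i. i < 7 \<Longrightarrow> (\<Sum>r<7. A r i * y r) = v i"
    by (rule lin_solve[of 7 "\<lambda>i r. A r i" v]) (use A det_transpose_mat[of 7 A] in auto)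
  have "v = (\<Sum>r<7. cscale (y r) (row_vec 7 A r))"
  proof
    fix i show "v i = (\<Sum>r<7. cscale (y r) (row_vec 7 A r)) i"
      using y[of i] assms by (cases "i < 7") (auto simp: sum_rows_apply mult.commute cspace_def)
  qed
  then show ?thesis by (rule that)
qed

lemma span_rows_subset: "flag_of_matrix 7 A n \<subseteq> cspace 7"
  unfolding flag_of_matrix_def
  by (rule cv.span_minimal[OF _ subspace_cspace]) (auto simp: row_vec_def cspace_def)

lemma flag_7: "flag_of_matrix 7 A 7 = cspace 7"
proof
  show "cspace 7 \<subseteq> flag_of_matrix 7 A 7"
  proof
    fix v assume "v \<in> cspace 7"
    then obtain y where v: "v = (\<Sum>r<7. cscale (y r) (row_vec 7 A r))" by (rule rows_expand)
    show "v \<in> flag_of_matrix 7 A 7"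
      unfolding v flag_of_matrix_def by (intro cv.span_sum cv.span_scale cv.span_base) auto
  qed
qed (rule span_rows_subset)

lemma ip_sum: "ip w (\<Sum>r<n. cscale (y r) (f r)) = (\<Sum>r<n. y r * ip w (f r))" for n :: nat
proof (induction n)
  case 0 show ?case by (simp only: lessThan_0 sum.empty ip_zero)
next
  case (Suc n) then show ?case by (simp only: sum.lessThan_Suc ip_add ip_cscale)
qed

text \<open>In coordinates with respect to the rows, \<open>h5\<close> and \<open>h6\<close> read
  off the last two coordinates.\<close>

lemma flag_5:
  assumes "v \<in> cspace 7"
  shows "v \<in> flag_of_matrix 7 A 5 \<longleftrightarrow> ip h5 v = 0 \<and> ip h6 v = 0"
proof
  assume "v \<in> flag_of_matrix 7 A 5"
  moreover have "flag_of_matrix 7 A 5 \<subseteq> {v. ip h5 v = 0 \<and> ip h6 v = 0}"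
    unfolding flag_of_matrix_def
    by (rule cv.span_minimal) (auto simp: ip_h_row cv.subspace_def ip_add ip_cscale)
  ultimately show "ip h5 v = 0 \<and> ip h6 v = 0" by blast
next
  assume *: "ip h5 v = 0 \<and> ip h6 v = 0"
  obtain y where v: "v = (\<Sum>r<7. cscale (y r) (row_vec 7 A r))" using assms by (rule rows_expand)
  have "ip h6 v = (\<Sum>r<7. if r = 6 then y r else 0)" "ip h5 v = (\<Sum>r<7. if r = 5 then y r else 0)"
    unfolding v ip_sum by (intro sum.cong; simp add: ip_h_row)+
  then have y: "y 5 = 0" "y 6 = 0" using * by simp_all
  have "v = (\<Sum>r<5. cscale (y r) (row_vec 7 A r))"
    unfolding v by (rule sum.mono_neutral_right) (use y in \<open>auto simp: numeral_eq_Suc less_Suc_eq\<close>)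
  moreover have "(\<Sum>r<5. cscale (y r) (row_vec 7 A r)) \<in> flag_of_matrix 7 A 5"
    unfolding flag_of_matrix_def by (intro cv.span_sum cv.span_scale cv.span_base) auto
  ultimately show "v \<in> flag_of_matrix 7 A 5" by simp
qed

lemma rows_indep_3:
  assumes "(\<Sum>k<3. cscale (z k) (row_vec 7 A k)) = 0" "k < 3"
  shows "z k = 0"
proof -
  have "(if k < 3 then z k else 0) = 0"
  proof (rule det_nz_inj[of 7 "\<lambda>i r. A r i"])
    fix i :: nat assume i: "i < 7"
    have "(\<Sum>r<7. A r i * (if r < 3 then z r else 0)) = (\<Sum>r<3. A r i * z r)"
      by (rule sum.mono_neutral_cong_right) auto
    also have "\<dots> = (\<Sum>k<3. cscale (z k) (row_vec 7 A k)) i" using i by (simp add: sum_rows_apply mult.commute)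
    finally show "(\<Sum>r<7. A r i * (if r < 3 then z r else 0)) = 0" using assms(1) by simp
  qed (use A det_transpose_mat[of 7 A] assms(2) in auto)
  then show ?thesis using assms(2) by simp
qed

end

section \<open>Functionals of osculating flags\<close>

definition osc_point :: "(nat \<Rightarrow> real) \<Rightarrow> nat \<times> nat \<times> nat \<Rightarrow> complex" where
  "osc_point s = (\<lambda>(j, r, c). osc_matrix (s j) r c)"

text \<open>The functional \<open>oh n a\<close> corresponds to the polynomial \<open>(X - a)^n\<close>: its value on the
  \<open>k\<close>-th row of the osculating flag at \<open>s\<close> is the \<open>k\<close>-th Taylor coefficient at \<open>s\<close>.\<close>

definition oh :: "nat \<Rightarrow> real \<Rightarrow> nat \<Rightarrow> complex" where
  "oh n a i = of_nat (n choose i) * (- complex_of_real a) ^ (n - i)"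

lemma sum_osc_oh:
  assumes "n \<le> 6"
  shows "(\<Sum>i<7. osc_matrix s k i * oh n a i) = of_nat (n choose k) * complex_of_real (s - a) ^ (n - k)"
proof (cases "k \<le> n")
  case False
  then have "osc_matrix s k i * oh n a i = 0" for i
    by (cases "i < k") (auto simp: osc_matrix_def oh_def)
  then have "(\<Sum>i<7. osc_matrix s k i * oh n a i) = 0" by (intro sum.neutral) blast
  then show ?thesis using False by (simp add: binomial_eq_0)
next
  case True
  have z: "osc_matrix s k i * oh n a i = 0" if "i \<notin> {k..n}" for i
    using that by (cases "i < k") (auto simp: osc_matrix_def oh_def)
  have "(\<Sum>i<7. osc_matrix s k i * oh n a i) = (\<Sum>i\<in>{k..n}. osc_matrix s k i * oh n a i)"
  proof (rule sum.mono_neutral_right)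
    show "{k..n} \<subseteq> {..<7}" using assms by auto
    show "\<forall>i\<in>{..<7} - {k..n}. osc_matrix s k i * oh n a i = 0" using z by blast
  qed simp
  also have "\<dots> = (\<Sum>i\<le>n-k. osc_matrix s k (i + k) * oh n a (i + k))"
    using sum.atLeastAtMost_shift_0[OF True, of "\<lambda>i. osc_matrix s k i * oh n a i"]
    by (simp add: atLeast0AtMost add.commute)
  also have "\<dots> = (\<Sum>i\<le>n-k. of_nat (n choose k) * (of_nat ((n - k) choose i) * complex_of_real s ^ i * (- complex_of_real a) ^ (n - k - i)))"
  proof (intro sum.cong refl)
    fix i assume i: "i \<in> {..n - k}"
    \<comment> \<open>This rearrangement of binomial coefficients pulls \<open>n choose k\<close>
      out of the sum and leaves the binomial expansion of (s - a)^(n - k).\<close>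
    have "((i + k) choose k) * (n choose (i + k)) = (n choose k) * ((n - k) choose i)"
      using choose_mult[of k "i + k" n] i True by (simp add: mult.commute)
    then have "of_nat ((i + k) choose k) * of_nat (n choose (i + k)) = (of_nat (n choose k) * of_nat ((n - k) choose i) :: complex)"
      by (metis of_nat_mult)
    then show "osc_matrix s k (i + k) * oh n a (i + k) =
        of_nat (n choose k) * (of_nat ((n - k) choose i) * complex_of_real s ^ i * (- complex_of_real a) ^ (n - k - i))"
      unfolding osc_matrix_def oh_def by (simp add: algebra_simps)
  qed
  also have "\<dots> = of_nat (n choose k) * (complex_of_real s + - complex_of_real a) ^ (n - k)"
    by (simp only: binomial_ring sum_distrib_left)
  finally show ?thesis by simp
qed

lemma ip_oh_row:
  assumes "n \<le> 6"
  shows "ip (oh n a) (row_vec 7 (osc_matrix s) k) = of_nat (n choose k) * complex_of_real (s - a) ^ (n - k)"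
proof -
  have "ip (oh n a) (row_vec 7 (osc_matrix s) k) = (\<Sum>i<7. osc_matrix s k i * oh n a i)"
    unfolding ip_def row_vec_def by (intro sum.cong) auto
  then show ?thesis using sum_osc_oh[OF assms] by simp
qed

lemma sum_osc_oh_dual:
  assumes "n \<le> 6"
  shows "(\<Sum>i<7. osc_matrix s r i * oh n s i) = (if r = n then 1 else 0)"
  unfolding sum_osc_oh[OF assms] by (cases r n rule: linorder_cases) (simp_all add: binomial_eq_0)

lemma det_osc: "det (mat 7 7 (\<lambda>(i,j). osc_matrix s i j)) \<noteq> 0"
proof -
  have "det (mat 7 7 (\<lambda>(i,j). osc_matrix s i j)) = prod_list (diag_mat (mat 7 7 (\<lambda>(i,j). osc_matrix s i j)))"
    by (rule det_upper_triangular[of _ 7]) (auto simp: osc_matrix_def)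
  also have "diag_mat (mat 7 7 (\<lambda>(i,j). osc_matrix s i j)) = map (\<lambda>i. 1) [0..<7]"
    unfolding diag_mat_def by (auto simp: osc_matrix_def)
  finally have d: "det (mat 7 7 (\<lambda>(i,j). osc_matrix s i j)) = prod_list (map (\<lambda>i. 1) [0..<7])" .
  show ?thesis unfolding d by auto
qed

lemma all_less_7: "(\<forall>j<7. P j) \<longleftrightarrow> P 0 \<and> P 1 \<and> P 2 \<and> P 3 \<and> P 4 \<and> P 5 \<and> P (6::nat)"
proof -
  have "j < 7 \<longleftrightarrow> j = 0 \<or> j = 1 \<or> j = 2 \<or> j = 3 \<or> j = 4 \<or> j = 5 \<or> j = 6" for j :: nat by linarith
  then show ?thesis by metis
qed

lemma sum_less_7: "(\<Sum>k<(7::nat). f k) = f 0 + f 1 + f 2 + f 3 + f 4 + f 5 + (f 6 :: 'a::comm_monoid_add)"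
  by (simp add: numeral_eq_Suc)

text \<open>Seven of the eight functionals, as columns; by \<open>det_W0\<close> they form a basis
  of the dual space. The missing \<open>oh 5\<close> at the fourth point is expressed by them in
  \<open>W0_relation\<close>, in accordance with \<open>c0 3 = 1\<close>.\<close>

definition W0 :: "nat \<Rightarrow> nat \<Rightarrow> complex" where
  "W0 i k = (if k < 4 then oh 6 (s0 k) i else oh 5 (s0 (k - 4)) i)"

lemma choose_values:
  "5 choose 0 = (1::nat)" "5 choose 1 = (5::nat)" "5 choose 2 = (10::nat)" "5 choose 3 = (10::nat)" "5 choose 4 = (5::nat)" "5 choose 5 = (1::nat)" "5 choose 6 = (0::nat)"
  "6 choose 0 = (1::nat)" "6 choose 1 = (6::nat)" "6 choose 2 = (15::nat)" "6 choose 3 = (20::nat)" "6 choose 4 = (15::nat)" "6 choose 5 = (6::nat)" "6 choose 6 = (1::nat)"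
  by (simp_all add: numeral_eq_Suc)

lemma W0_values:
  "W0 0 0 = 0" "W0 0 1 = 1" "W0 0 2 = 1" "W0 0 3 = 64" "W0 0 4 = 0" "W0 0 5 = - 1" "W0 0 6 = 1"
  "W0 1 0 = 0" "W0 1 1 = - 6" "W0 1 2 = 6" "W0 1 3 = - 192" "W0 1 4 = 0" "W0 1 5 = 5" "W0 1 6 = 5"
  "W0 2 0 = 0" "W0 2 1 = 15" "W0 2 2 = 15" "W0 2 3 = 240" "W0 2 4 = 0" "W0 2 5 = - 10" "W0 2 6 = 10"
  "W0 3 0 = 0" "W0 3 1 = - 20" "W0 3 2 = 20" "W0 3 3 = - 160" "W0 3 4 = 0" "W0 3 5 = 10" "W0 3 6 = 10"
  "W0 4 0 = 0" "W0 4 1 = 15" "W0 4 2 = 15" "W0 4 3 = 60" "W0 4 4 = 0" "W0 4 5 = - 5" "W0 4 6 = 5"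
  "W0 5 0 = 0" "W0 5 1 = - 6" "W0 5 2 = 6" "W0 5 3 = - 12" "W0 5 4 = 1" "W0 5 5 = 1" "W0 5 6 = 1"
  "W0 6 0 = 1" "W0 6 1 = 1" "W0 6 2 = 1" "W0 6 3 = 1" "W0 6 4 = 0" "W0 6 5 = 0" "W0 6 6 = 0"
  by (simp_all add: W0_def oh_def s0_def choose_values del: One_nat_def)

lemma det_W0: "det (mat 7 7 (\<lambda>(i,k). W0 i k)) \<noteq> 0"
proof (rule inj_det_nz)
  fix y :: "nat \<Rightarrow> complex"
  assume *: "\<And>i. i < 7 \<Longrightarrow> (\<Sum>k<7. W0 i k * y k) = 0"
  have e0: "(1) * y 1 + (1) * y 2 + (64) * y 3 + (- 1) * y 5 + (1) * y 6 = 0"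
    using *[of 0] by (simp add: sum_less_7 W0_values del: One_nat_def)
  have e1: "(- 6) * y 1 + (6) * y 2 + (- 192) * y 3 + (5) * y 5 + (5) * y 6 = 0"
    using *[of 1] by (simp add: sum_less_7 W0_values del: One_nat_def)
  have e2: "(15) * y 1 + (15) * y 2 + (240) * y 3 + (- 10) * y 5 + (10) * y 6 = 0"
    using *[of 2] by (simp add: sum_less_7 W0_values del: One_nat_def)
  have e3: "(- 20) * y 1 + (20) * y 2 + (- 160) * y 3 + (10) * y 5 + (10) * y 6 = 0"
    using *[of 3] by (simp add: sum_less_7 W0_values del: One_nat_def)
  have e4: "(15) * y 1 + (15) * y 2 + (60) * y 3 + (- 5) * y 5 + (5) * y 6 = 0"
    using *[of 4] by (simp add: sum_less_7 W0_values del: One_nat_def)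
  have e5: "(- 6) * y 1 + (6) * y 2 + (- 12) * y 3 + (1) * y 4 + (1) * y 5 + (1) * y 6 = 0"
    using *[of 5] by (simp add: sum_less_7 W0_values del: One_nat_def)
  have e6: "(1) * y 0 + (1) * y 1 + (1) * y 2 + (1) * y 3 = 0"
    using *[of 6] by (simp add: sum_less_7 W0_values del: One_nat_def)
  have "y 0 = 0" using e0 e1 e2 e3 e4 e5 e6 by Groebner_Basis.algebra
  moreover have "y 1 = 0" using e0 e1 e2 e3 e4 e5 e6 by Groebner_Basis.algebra
  moreover have "y 2 = 0" using e0 e1 e2 e3 e4 e5 e6 by Groebner_Basis.algebra
  moreover have "y 3 = 0" using e0 e1 e2 e3 e4 e5 e6 by Groebner_Basis.algebra
  moreover have "y 4 = 0" using e0 e1 e2 e3 e4 e5 e6 by Groebner_Basis.algebra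
  moreover have "y 5 = 0" using e0 e1 e2 e3 e4 e5 e6 by Groebner_Basis.algebra
  moreover have "y 6 = 0" using e0 e1 e2 e3 e4 e5 e6 by Groebner_Basis.algebra
  ultimately show "\<forall>k<7. y k = 0" unfolding all_less_7 by blast
qed

lemma W0_relation:
  assumes "i < 7"
  shows "(\<Sum>k<7. W0 i k * (if k < 4 then d0 k else c0 (k - 4))) = - oh 5 (s0 3) i"
proof -
  have "i = 0 \<or> i = 1 \<or> i = 2 \<or> i = 3 \<or> i = 4 \<or> i = 5 \<or> i = 6" using assms by auto
  then show ?thesis
    by (elim disjE; simp add: sum_less_7 W0_values c0_def d0_def oh_def s0_def choose_values del: One_nat_def)
qed

section \<open>Transfer from the base point to generic flags\<close>

definition Sol :: "(nat \<times> nat \<times> nat \<Rightarrow> complex) \<Rightarrow> (nat \<Rightarrow> complex) set set" where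
  "Sol x = schubert_intersection 3 7 (replicate 4 [1,3,5]) (\<lambda>j. flag_of_matrix 7 (\<lambda>r c. x (j, r, c)))"

abbreviation x0 where "x0 \<equiv> osc_point s0"

text \<open>Once the coefficient \<open>True True True\<close> is zero, the coefficients
  \<open>True True False\<close> and \<open>True False True\<close> are unaffected by the shift and
  \<open>True False False\<close> is affine in \<open>kap\<close>. Making the latter zero for flags
  1, 2, 3 is the linear system of \<open>kmat\<close> and \<open>kvec\<close>.\<close>

lemma tri_shift:
  assumes L: "L = (\<lambda>j i k. L' j i k + kap i * M j i k)"
  shows "tri L M j i1 i2 i3 True False False = tri L' M j i1 i2 i3 True False False
      + kap i2 * tri L' M j i1 i2 i3 True True False + kap i3 * tri L' M j i1 i2 i3 True False True
      + kap i2 * kap i3 * tri L' M j i1 i2 i3 True True True"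
    "tri L M j i1 i2 i3 True True False = tri L' M j i1 i2 i3 True True False + kap i3 * tri L' M j i1 i2 i3 True True True"
    "tri L M j i1 i2 i3 True False True = tri L' M j i1 i2 i3 True False True + kap i2 * tri L' M j i1 i2 i3 True True True"
    "tri L M j i1 i2 i3 True True True = tri L' M j i1 i2 i3 True True True"
  unfolding L tri_def d3_def by (simp_all add: algebra_simps)

lemma dual_family:
  assumes n: "n \<le> 6"
  shows "\<exists>H. (\<forall>j i. zreg x0 (\<lambda>x. H j x i)) \<and>
    (\<forall>j<4. znear x0 (\<lambda>x. \<forall>r<7. (\<Sum>c<7. x (j,r,c) * H j x c) = (if r = n then 1 else 0))) \<and>
    (\<forall>j. H j x0 = oh n (s0 j))"
proof -
  have "\<forall>j\<in>{..<4}. \<exists>y. (\<forall>i. zreg x0 (\<lambda>x. y x i)) \<and>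
      znear x0 (\<lambda>x. \<forall>r<7. (\<Sum>c<7. x (j,r,c) * y x c) = (if r = n then 1 else 0)) \<and>
      (\<forall>i<7. y x0 i = oh n (s0 j) i)"
  proof
    fix j :: nat
    have det: "det (mat 7 7 (\<lambda>(r,c). x0 (j,r,c))) \<noteq> 0" using det_osc[of "s0 j"] by (simp add: osc_point_def)
    obtain y where y: "\<And>i. zreg x0 (\<lambda>x. y x i)"
      "znear x0 (\<lambda>x. \<forall>r<7. (\<Sum>c<7. x (j,r,c) * y x c) = (if r = n then 1 else 0))"
      "\<And>y' i. (\<And>r. r < 7 \<Longrightarrow> (\<Sum>c<7. x0 (j,r,c) * y' c) = (if r = n then 1 else 0)) \<Longrightarrow> i < 7 \<Longrightarrow> y x0 i = y' i"
      by (rule zreg_solve[of 7 x0 "\<lambda>x r c. x (j,r,c)" "\<lambda>x r. if r = n then 1 else 0"])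
         (use det in \<open>auto intro: zreg_var zreg_const\<close>)
    have "y x0 i = oh n (s0 j) i" if "i < 7" for i
      using that by (intro y(3)) (simp_all add: osc_point_def sum_osc_oh_dual[OF n])
    with y(1,2) show "\<exists>y. (\<forall>i. zreg x0 (\<lambda>x. y x i)) \<and>
      znear x0 (\<lambda>x. \<forall>r<7. (\<Sum>c<7. x (j,r,c) * y x c) = (if r = n then 1 else 0)) \<and>
      (\<forall>i<7. y x0 i = oh n (s0 j) i)" by blast
  qed
  from bchoice[OF this] obtain y where y: "\<forall>j\<in>{..<4}. (\<forall>i. zreg x0 (\<lambda>x. y j x i)) \<and>
      znear x0 (\<lambda>x. \<forall>r<7. (\<Sum>c<7. x (j,r,c) * y j x c) = (if r = n then 1 else 0)) \<and>
      (\<forall>i<7. y j x0 i = oh n (s0 j) i)" ..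
  \<comment> \<open>Outside the relevant range the osculating value is the default, so that the
    equation at \<open>x0\<close> holds between whole functions.\<close>
  define H where "H j x i = (if j < 4 \<and> i < 7 then y j x i else oh n (s0 j) i)" for j x i
  have "zreg x0 (\<lambda>x. H j x i)" for j i
    using y unfolding H_def by (cases "j < 4 \<and> i < 7") (auto intro: zreg_const)
  moreover have "znear x0 (\<lambda>x. \<forall>r<7. (\<Sum>c<7. x (j,r,c) * H j x c) = (if r = n then 1 else 0))" if "j < 4" for j
    using y that by (simp add: H_def)
  moreover have "H j x0 = oh n (s0 j)" for j
    using y by (auto simp: H_def fun_eq_iff)
  ultimately show ?thesis by blast
qed

lemma zreg_row: "zreg x0 (\<lambda>x. row_vec 7 (\<lambda>r c. x (j,r,c)) k i)"
  unfolding row_vec_def by (intro zreg_intros)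

lemma zreg_ip:
  assumes "\<And>i. zreg x0 (\<lambda>x. w x i)" "\<And>i. zreg x0 (\<lambda>x. v x i)"
  shows "zreg x0 (\<lambda>x. ip (w x) (v x))"
  unfolding ip_def by (intro zreg_sum zreg_mult assms)

definition L1 :: "nat \<Rightarrow> nat \<Rightarrow> nat \<Rightarrow> complex" where
  "L1 j i k = of_nat (6 choose k) * complex_of_real (s0 j - s0 i) ^ (6 - k)"

lemma L0_L1: "L0 = (\<lambda>j i k. L1 j i k + kap0 i * M0 j i k)"
  by (simp add: fun_eq_iff L0_def L1_def)

lemma tri_TTT0: "tri L1 M0 1 0 2 3 True True True = 0" "tri L1 M0 2 0 1 3 True True True = 0"
    "tri L1 M0 3 0 1 2 True True True = 0"
  by (simp_all add: tri_def d3_def M0_values del: One_nat_def)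

text \<open>Row a belongs to flag 3 - a, and column b to the unknown
  \<open>kap (b + 1)\<close>.\<close>

definition kmat :: "(nat \<Rightarrow> nat \<Rightarrow> nat \<Rightarrow> complex) \<Rightarrow> (nat \<Rightarrow> nat \<Rightarrow> nat \<Rightarrow> complex) \<Rightarrow> nat \<Rightarrow> nat \<Rightarrow> complex" where
  "kmat L M a b = (if a = 0 then (if b = 0 then tri L M 3 0 1 2 True True False else if b = 1 then tri L M 3 0 1 2 True False True else 0)
    else if a = 1 then (if b = 0 then tri L M 2 0 1 3 True True False else if b = 1 then 0 else tri L M 2 0 1 3 True False True)
    else (if b = 0 then 0 else if b = 1 then tri L M 1 0 2 3 True True False else tri L M 1 0 2 3 True False True))"

definition kvec :: "(nat \<Rightarrow> nat \<Rightarrow> nat \<Rightarrow> complex) \<Rightarrow> (nat \<Rightarrow> nat \<Rightarrow> nat \<Rightarrow> complex) \<Rightarrow> nat \<Rightarrow> complex" where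
  "kvec L M a = (if a = 0 then tri L M 3 0 1 2 True False False else if a = 1 then tri L M 2 0 1 3 True False False
    else tri L M 1 0 2 3 True False False)"

lemma kmat_L1: "kmat L1 M0 = kmat L0 M0"
  by (simp add: fun_eq_iff kmat_def tri_shift[OF L0_L1] tri_TTT0 del: One_nat_def)

lemma det_kmat0: "det (mat 3 3 (\<lambda>(a,b). kmat L1 M0 a b)) \<noteq> 0"
  unfolding kmat_L1
proof (rule inj_det_nz)
  fix y :: "nat \<Rightarrow> complex"
  assume *: "\<And>i. i < 3 \<Longrightarrow> (\<Sum>k<3. kmat L0 M0 i k * y k) = 0"
  have e: "tri L0 M0 3 0 1 2 True True False * y 0 + tri L0 M0 3 0 1 2 True False True * y 1 = 0"
    "tri L0 M0 2 0 1 3 True True False * y 0 + tri L0 M0 2 0 1 3 True False True * y 2 = 0"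
    "tri L0 M0 1 0 2 3 True True False * y 1 + tri L0 M0 1 0 2 3 True False True * y 2 = 0"
    using *[of 0] *[of 1] *[of 2] by (simp_all add: sum_less_3 kmat_def del: One_nat_def)
  have "y 0 = 0" using e unfolding tri0 by Groebner_Basis.algebra
  moreover have "y 1 = 0" using e unfolding tri0 by Groebner_Basis.algebra
  moreover have "y 2 = 0" using e unfolding tri0 by Groebner_Basis.algebra
  ultimately show "\<forall>k<3. y k = 0" by (simp add: less_3_iff)
qed

lemma kap0_solves:
  assumes "i < 3"
  shows "(\<Sum>k<3. kmat L1 M0 i k * kap0 (k + 1)) = - kvec L1 M0 i"
proof -
  have "tri L1 M0 3 0 1 2 True True False * kap0 1 + tri L1 M0 3 0 1 2 True False True * kap0 2
      = - tri L1 M0 3 0 1 2 True False False"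
    using tri_shift(1)[OF L0_L1, of 3 0 1 2] unfolding tri0 tri_TTT0 by Groebner_Basis.algebra
  moreover have "tri L1 M0 2 0 1 3 True True False * kap0 1 + tri L1 M0 2 0 1 3 True False True * kap0 3
      = - tri L1 M0 2 0 1 3 True False False"
    using tri_shift(1)[OF L0_L1, of 2 0 1 3] unfolding tri0 tri_TTT0 by Groebner_Basis.algebra
  moreover have "tri L1 M0 1 0 2 3 True True False * kap0 2 + tri L1 M0 1 0 2 3 True False True * kap0 3
      = - tri L1 M0 1 0 2 3 True False False"
    using tri_shift(1)[OF L0_L1, of 1 0 2 3] unfolding tri0 tri_TTT0 by Groebner_Basis.algebra
  ultimately show ?thesis
    using assms unfolding less_3_iff
    by (elim disjE; simp add: sum_less_3 kmat_def kvec_def del: One_nat_def)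
qed

text \<open>The dual functionals, the relation between them and the shift all solve linear systems
  that are invertible at \<open>x0\<close>. They are therefore regular functions of the flag
  matrices, and at every nearby point they satisfy the assumptions of \<open>schubert_system\<close>
  and \<open>generic\<close>.\<close>

theorem znear_card_Sol: "znear x0 (\<lambda>x. finite (Sol x) \<and> card (Sol x) = 8)"
proof -
  obtain H6 where H6: "\<And>j i. zreg x0 (\<lambda>x. H6 j x i)"
    "\<And>j. j < 4 \<Longrightarrow> znear x0 (\<lambda>x. \<forall>r<7. (\<Sum>c<7. x (j,r,c) * H6 j x c) = (if r = 6 then 1 else 0))"
    "\<And>j. H6 j x0 = oh 6 (s0 j)" using dual_family[of 6] by auto
  obtain H5 where H5: "\<And>j i. zreg x0 (\<lambda>x. H5 j x i)"
    "\<And>j. j < 4 \<Longrightarrow> znear x0 (\<lambda>x. \<forall>r<7. (\<Sum>c<7. x (j,r,c) * H5 j x c) = (if r = 5 then 1 else 0))"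
    "\<And>j. H5 j x0 = oh 5 (s0 j)" using dual_family[of 5] by auto
  define W where "W x i k = (if k < 4 then H6 k x i else H5 (k - 4) x i)" for x i k
  have W0: "W x0 = W0" by (simp add: fun_eq_iff W_def W0_def H6(3) H5(3))
  have Wr: "zreg x0 (\<lambda>x. W x i k)" for i k unfolding W_def by (intro zreg_if H6 H5)
  obtain y where y: "\<And>k. zreg x0 (\<lambda>x. y x k)"
    "znear x0 (\<lambda>x. \<forall>i<7. (\<Sum>k<7. W x i k * y x k) = - H5 3 x i)"
    "\<And>y' k. (\<And>i. i < 7 \<Longrightarrow> (\<Sum>k<7. W x0 i k * y' k) = - H5 3 x0 i) \<Longrightarrow> k < 7 \<Longrightarrow> y x0 k = y' k"
    by (rule zreg_solve[of 7 x0 W "\<lambda>x i. - H5 3 x i"]) (use Wr H5(1) det_W0 W0 in \<open>auto intro: zreg_uminus\<close>)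
  have y0: "y x0 k = (if k < 4 then d0 k else c0 (k - 4))" if "k < 7" for k
    using that by (intro y(3)) (simp_all only: W0 W0_relation H5(3))
  define d where "d x j = (if j < 4 then y x j else d0 j)" for x j
  \<comment> \<open>The relation is normalised at the fourth point, where the coefficient of
    \<open>H5\<close> is \<open>c0 3 = 1\<close>.\<close>
  define c where "c x j = (if j < 3 then y x (4 + j) else c0 j)" for x j
  have dc0: "d x0 j = d0 j" "c x0 j = c0 j" for j by (simp_all add: d_def c_def y0)
  have dr: "zreg x0 (\<lambda>x. d x j)" and cr: "zreg x0 (\<lambda>x. c x j)" for j
    unfolding d_def c_def by (intro zreg_if zreg_const y(1))+
  define mu where "mu x j i = c x j * H5 j x i + d x j * H6 j x i" for x j i
  define M where "M x j i k = ip (mu x i) (row_vec 7 (\<lambda>r c. x (j,r,c)) k)" for x j i k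
  define K where "K x j i k = ip (H6 i x) (row_vec 7 (\<lambda>r c. x (j,r,c)) k)" for x j i k
  have Mr: "zreg x0 (\<lambda>x. M x j i k)" and Kr: "zreg x0 (\<lambda>x. K x j i k)" for j i k
    unfolding M_def K_def mu_def by (intro zreg_ip zreg_row zreg_intros cr dr H5 H6)+
  have row0: "row_vec 7 (\<lambda>r c. x0 (j,r,c)) k = row_vec 7 (osc_matrix (s0 j)) k" for j k
    by (simp add: osc_point_def)
  have mu0: "mu x0 i = (\<lambda>m. c0 i * oh 5 (s0 i) m + d0 i * oh 6 (s0 i) m)" for i
    by (simp add: fun_eq_iff mu_def H5(3) H6(3) dc0)
  have M0: "M x0 = M0"
    by (simp add: fun_eq_iff M_def row0 mu0 M0_def ip_lincomb ip_oh_row)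
  have K0: "K x0 = L1"
    by (simp add: fun_eq_iff K_def row0 H6(3) L1_def ip_oh_row)
  have kmr: "zreg x0 (\<lambda>x. kmat (K x) (M x) a b)" for a b
    unfolding kmat_def by (intro zreg_if zreg_const zreg_tri Kr Mr)
  have kvr: "zreg x0 (\<lambda>x. - kvec (K x) (M x) a)" for a
    unfolding kvec_def by (intro zreg_uminus zreg_if zreg_tri Kr Mr)
  obtain u where u: "\<And>k. zreg x0 (\<lambda>x. u x k)"
    "znear x0 (\<lambda>x. \<forall>i<3. (\<Sum>k<3. kmat (K x) (M x) i k * u x k) = - kvec (K x) (M x) i)"
    "\<And>y' k. (\<And>i. i < 3 \<Longrightarrow> (\<Sum>k<3. kmat (K x0) (M x0) i k * y' k) = - kvec (K x0) (M x0) i) \<Longrightarrow> k < 3 \<Longrightarrow> u x0 k = y' k"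
    by (rule zreg_solve[of 3 x0 "\<lambda>x. kmat (K x) (M x)" "\<lambda>x i. - kvec (K x) (M x) i"])
       (use kmr kvr det_kmat0 M0 K0 in auto)
  have u0: "u x0 k = kap0 (k + 1)" if "k < 3" for k
    using that by (intro u(3)) (simp_all only: M0 K0 kap0_solves)
  define kap where "kap x j = (if 0 < j \<and> j < 4 then u x (j - 1) else kap0 j)" for x j
  have kap0: "kap x0 j = kap0 j" for j by (auto simp: kap_def u0)
  have kr: "zreg x0 (\<lambda>x. kap x j)" for j unfolding kap_def by (intro zreg_if zreg_const u(1))
  define lam where "lam x j i = 1 * H6 j x i + kap x j * mu x j i" for x j i
  define L where "L x j i k = K x j i k + kap x i * M x j i k" for x j i k
  have Lr: "zreg x0 (\<lambda>x. L x j i k)" for j i k unfolding L_def by (intro zreg_intros Kr Mr kr)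
  have L0: "L x0 = L0" by (simp add: fun_eq_iff L_def K0 M0 kap0 L0_L1)
  have gen: "znear x0 (\<lambda>x. system_coeffs.generic (L x) (M x))"
    by (rule znear_generic[of x0 L M, OF Lr Mr]) (simp_all add: L0 M0 generic0 Z_pG Z_pm)
  have detr: "znear x0 (\<lambda>x. \<forall>j<4. det (mat 7 7 (\<lambda>(r,c). x (j,r,c))) \<noteq> 0)"
  proof (rule znear_all_less, rule znear_nonzero)
    fix j :: nat
    show "zreg x0 (\<lambda>x. det (mat 7 7 (\<lambda>(r,c). x (j,r,c))))" by (intro zreg_det zreg_var)
    show "det (mat 7 7 (\<lambda>(r,c). x0 (j,r,c))) \<noteq> 0" using det_osc[of "s0 j"] by (simp add: osc_point_def)
  qed
  have n6: "znear x0 (\<lambda>x. \<forall>j<4. \<forall>r<7. (\<Sum>c<7. x (j,r,c) * H6 j x c) = (if r = 6 then 1 else 0))"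
    by (rule znear_all_less) (rule H6(2))
  have n5: "znear x0 (\<lambda>x. \<forall>j<4. \<forall>r<7. (\<Sum>c<7. x (j,r,c) * H5 j x c) = (if r = 5 then 1 else 0))"
    by (rule znear_all_less) (rule H5(2))
  have nW: "znear x0 (\<lambda>x. det (mat 7 7 (\<lambda>(i,k). W x i k)) \<noteq> 0)"
  proof (rule znear_nonzero)
    show "zreg x0 (\<lambda>x. det (mat 7 7 (\<lambda>(i,k). W x i k)))" by (intro zreg_det Wr)
    show "det (mat 7 7 (\<lambda>(i,k). W x0 i k)) \<noteq> 0" using det_W0 by (simp add: W0)
  qed
  have nc: "znear x0 (\<lambda>x. \<forall>j<4. c x j \<noteq> 0)"
  proof (rule znear_all_less, rule znear_nonzero)
    fix j :: nat
    show "zreg x0 (\<lambda>x. c x j)" by (rule cr)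
    show "c x0 j \<noteq> 0" by (simp add: dc0 c0_def)
  qed
  show ?thesis
  proof (rule znear_mono[OF znear_conj[OF gen znear_conj[OF detr znear_conj[OF n6 znear_conj[OF n5
          znear_conj[OF nW znear_conj[OF nc znear_conj[OF y(2) u(2)]]]]]]]])
    fix x
    assume "system_coeffs.generic (L x) (M x) \<and>
         (\<forall>j<4. det (mat 7 7 (\<lambda>(r,c). x (j,r,c))) \<noteq> 0) \<and>
         (\<forall>j<4. \<forall>r<7. (\<Sum>c<7. x (j,r,c) * H6 j x c) = (if r = 6 then 1 else 0)) \<and>
         (\<forall>j<4. \<forall>r<7. (\<Sum>c<7. x (j,r,c) * H5 j x c) = (if r = 5 then 1 else 0)) \<and>
         det (mat 7 7 (\<lambda>(i,k). W x i k)) \<noteq> 0 \<and> (\<forall>j<4. c x j \<noteq> 0) \<and>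
         (\<forall>i<7. (\<Sum>k<7. W x i k * y x k) = - H5 3 x i) \<and>
         (\<forall>i<3. (\<Sum>k<3. kmat (K x) (M x) i k * u x k) = - kvec (K x) (M x) i)"
    then have gen: "system_coeffs.generic (L x) (M x)"
      and det: "\<And>j. j < 4 \<Longrightarrow> det (mat 7 7 (\<lambda>(r,c). x (j,r,c))) \<noteq> 0"
      and h6: "\<And>j r. j < 4 \<Longrightarrow> r < 7 \<Longrightarrow> (\<Sum>c<7. x (j,r,c) * H6 j x c) = (if r = 6 then 1 else 0)"
      and h5: "\<And>j r. j < 4 \<Longrightarrow> r < 7 \<Longrightarrow> (\<Sum>c<7. x (j,r,c) * H5 j x c) = (if r = 5 then 1 else 0)"
      and W: "det (mat 7 7 (\<lambda>(i,k). W x i k)) \<noteq> 0" and c: "\<And>j. j < 4 \<Longrightarrow> c x j \<noteq> 0"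
      and rel: "\<And>i. i < 7 \<Longrightarrow> (\<Sum>k<7. W x i k * y x k) = - H5 3 x i"
      and kap: "\<And>i. i < 3 \<Longrightarrow> (\<Sum>k<3. kmat (K x) (M x) i k * u x k) = - kvec (K x) (M x) i"
      by blast+
    let ?g = "\<lambda>j r c. x (j, r, c)"
    have ipmu: "ip (mu x j) v = c x j * ip (H5 j x) v + d x j * ip (H6 j x) v" for j v
      unfolding mu_def by (rule ip_lincomb)
    have iplam: "ip (lam x j) v = ip (H6 j x) v + kap x j * ip (mu x j) v" for j v
      using ip_lincomb[of 1 "H6 j x" "kap x j" "mu x j" v] unfolding lam_def by simp
    \<comment> \<open>As \<open>c x j\<close> is nonzero, the triangular change to
      \<open>lam\<close> and \<open>mu\<close> spans the same pencil as \<open>H5\<close> and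
      \<open>H6\<close>.\<close>
    have lm_iff: "ip (lam x j) v = 0 \<and> ip (mu x j) v = 0 \<longleftrightarrow> ip (H5 j x) v = 0 \<and> ip (H6 j x) v = 0" if "j < 4" for j v
      using c[OF that] by (auto simp: iplam ipmu)
    have sum_mu: "ip (mu x 0) v + ip (mu x 1) v + ip (mu x 2) v + ip (mu x 3) v = 0" for v
    proof -
      have s: "mu x 0 i + mu x 1 i + mu x 2 i + mu x 3 i = 0" if "i < 7" for i
        using rel[OF that] by (simp add: sum_less_7 W_def mu_def c_def d_def c0_def algebra_simps add_eq_0_iff2)
      have "ip (mu x 0) v + ip (mu x 1) v + ip (mu x 2) v + ip (mu x 3) v =
          (\<Sum>i<7. (mu x 0 i + mu x 1 i + mu x 2 i + mu x 3 i) * v i)"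
        by (simp add: ip_def distrib_right sum.distrib)
      also have "\<dots> = 0" using s by (intro sum.neutral) auto
      finally show ?thesis .
    qed
    interpret S: schubert_system ?g "lam x" "mu x"
    proof
      fix j :: nat assume j: "j < 4"
      show "flag_of_matrix 7 (?g j) 7 = cspace 7"
        by (rule flag_7[OF det[OF j] h6[OF j] h5[OF j]])
      show "v \<in> flag_of_matrix 7 (?g j) 5 \<longleftrightarrow> ip (lam x j) v = 0 \<and> ip (mu x j) v = 0" if "v \<in> cspace 7" for v
        unfolding lm_iff[OF j] by (rule flag_5[OF det[OF j] h6[OF j] h5[OF j] that])
      show "z k = 0" if "(\<Sum>k<3. cscale (z k) (row_vec 7 (?g j) k)) = 0" "k < 3" for z k
        by (rule rows_indep_3[OF det[OF j] h6[OF j] h5[OF j] that])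
    next
      show "ip (mu x 0) v + ip (mu x 1) v + ip (mu x 2) v + ip (mu x 3) v = 0" for v by (rule sum_mu)
    next
      fix v assume v: "v \<in> cspace 7" "\<And>j. j < 4 \<Longrightarrow> ip (lam x j) v = 0" "\<And>j. j < 4 \<Longrightarrow> ip (mu x j) v = 0"
      then have h: "ip (H5 j x) v = 0" "ip (H6 j x) v = 0" if "j < 4" for j using lm_iff[OF that, of v] that by auto
      have "v i = 0" if "i < 7" for i
      proof (rule det_nz_inj[of 7 "\<lambda>k i. W x i k"])
        show "det (mat 7 7 (\<lambda>(k,i). W x i k)) \<noteq> 0" using W det_transpose_mat[of 7 "W x"] by simp
        fix k :: nat assume "k < 7"
        then show "(\<Sum>i<7. W x i k * v i) = 0"
          using h(2)[of k] h(1)[of "k - 4"] by (cases "k < 4") (auto simp: W_def ip_def)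
      qed (rule that)
      moreover have "v i = 0" if "\<not> i < 7" for i using v(1) that by (simp add: cspace_def)
      ultimately show "v = 0" by (metis ext zero_fun_apply)
    qed
    have SM: "S.M = M x" by (simp add: fun_eq_iff S.M_def M_def)
    have SL: "S.L = L x" by (simp add: fun_eq_iff S.L_def L_def K_def M_def iplam)
    have LK: "L x = (\<lambda>j i k. K x j i k + kap x i * M x j i k)" by (simp add: fun_eq_iff L_def)
    note TTT = S.tri_TTT[unfolded SM SL tri_shift(4)[OF LK]]
    have ku: "kap x 1 = u x 0" "kap x 2 = u x 1" "kap x 3 = u x 2" by (simp_all add: kap_def)
    have "tri (L x) (M x) 1 0 2 3 True False False = 0" "tri (L x) (M x) 2 0 1 3 True False False = 0"
      "tri (L x) (M x) 3 0 1 2 True False False = 0"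
      using kap[of 0] kap[of 1] kap[of 2] TTT unfolding tri_shift(1)[OF LK] ku
      by (simp_all add: sum_less_3 kmat_def kvec_def eq_neg_iff_add_eq_0 algebra_simps del: One_nat_def)
    then show "finite (Sol x) \<and> card (Sol x) = 8"
      using S.card_S[unfolded SM SL, OF gen] unfolding Sol_def by blast
  qed
qed

section \<open>Real solutions for osculating flags\<close>

text \<open>The value of \<open>oh 5 a + u * oh 6 a\<close> on the k-th row of the osculating flag
  at s, with e = s - a.\<close>

definition orow :: "real \<Rightarrow> real \<Rightarrow> nat \<Rightarrow> real" where
  "orow e u k = of_nat (5 choose k) * e ^ (5 - k) + u * (of_nat (6 choose k) * e ^ (6 - k))"

lemma orow_values:
  "orow e u 0 = e ^ 5 + u * e ^ 6" "orow e u 1 = 5 * e ^ 4 + 6 * u * e ^ 5" "orow e u 2 = 10 * e ^ 3 + 15 * u * e ^ 4"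
  unfolding orow_def choose_5_6 by simp_all

text \<open>Multiplication by \<open>12 * Q\<close> turns u into the polynomial m, and
  \<open>- (B ^ 3)\<close> can then be taken out of all three entries. This leaves determinants of
  low degree.\<close>

lemma orow_scaled:
  assumes "12 * V * u = m" "V = B * Q"
  shows "12 * Q * orow (- B) u 0 = - (B ^ 3) * (B\<^sup>2 * (12 * Q - m))"
    "12 * Q * orow (- B) u 1 = - (B ^ 3) * (- B * (60 * Q - 6 * m))"
    "12 * Q * orow (- B) u 2 = - (B ^ 3) * (120 * Q - 15 * m)"
  unfolding orow_values assms(1)[symmetric] assms(2) by Groebner_Basis.algebra+

text \<open>In the two determinants below, \<open>B\<close>, \<open>C\<close>, \<open>D\<close> are the differences of three of the points
  from the fourth.\<close>

lemma d3_orow_eq_0: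
  fixes B C D :: real
  assumes dist: "B \<noteq> C" "B \<noteq> D" "C \<noteq> D" and nz: "B \<noteq> 0" "C \<noteq> 0" "D \<noteq> 0"
    and u: "12 * (B * ((B - C) * (B - D))) * u1 = m1" "12 * (C * ((C - B) * (C - D))) * u2 = m2"
      "12 * (D * ((D - B) * (D - C))) * u3 = m3"
    and Q: "q1 = (B - C) * (B - D)" "q2 = (C - B) * (C - D)" "q3 = (D - B) * (D - C)"
    and det: "B\<^sup>2 * (12 * q1 - m1) * ((- C * (60 * q2 - 6 * m2)) * (120 * q3 - 15 * m3) - (120 * q2 - 15 * m2) * (- D * (60 * q3 - 6 * m3)))
      - (- B * (60 * q1 - 6 * m1)) * ((C\<^sup>2 * (12 * q2 - m2)) * (120 * q3 - 15 * m3) - (120 * q2 - 15 * m2) * (D\<^sup>2 * (12 * q3 - m3)))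
      + (120 * q1 - 15 * m1) * ((C\<^sup>2 * (12 * q2 - m2)) * (- D * (60 * q3 - 6 * m3)) - (- C * (60 * q2 - 6 * m2)) * (D\<^sup>2 * (12 * q3 - m3))) = (X - Y) * K"
    and XY: "X = Y"
  shows "d3 (orow (- B) u1) (orow (- C) u2) (orow (- D) u3) = 0"
proof -
  have q: "q1 \<noteq> 0" "q2 \<noteq> 0" "q3 \<noteq> 0" using dist by (simp_all add: Q)
  note r1 = orow_scaled[OF u(1)[folded Q(1)], OF refl]
  note r2 = orow_scaled[OF u(2)[folded Q(2)], OF refl]
  note r3 = orow_scaled[OF u(3)[folded Q(3)], OF refl]
  have "(12 * q1) * (12 * q2) * (12 * q3) * d3 (orow (- B) u1) (orow (- C) u2) (orow (- D) u3) =
     (12 * q1 * orow (- B) u1 0) * ((12 * q2 * orow (- C) u2 1) * (12 * q3 * orow (- D) u3 2) - (12 * q2 * orow (- C) u2 2) * (12 * q3 * orow (- D) u3 1))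
   - (12 * q1 * orow (- B) u1 1) * ((12 * q2 * orow (- C) u2 0) * (12 * q3 * orow (- D) u3 2) - (12 * q2 * orow (- C) u2 2) * (12 * q3 * orow (- D) u3 0))
   + (12 * q1 * orow (- B) u1 2) * ((12 * q2 * orow (- C) u2 0) * (12 * q3 * orow (- D) u3 1) - (12 * q2 * orow (- C) u2 1) * (12 * q3 * orow (- D) u3 0))"
    unfolding d3_def by (simp add: algebra_simps)
  also have "\<dots> = - (B ^ 3 * C ^ 3 * D ^ 3) * (B\<^sup>2 * (12 * q1 - m1) * ((- C * (60 * q2 - 6 * m2)) * (120 * q3 - 15 * m3) - (120 * q2 - 15 * m2) * (- D * (60 * q3 - 6 * m3)))
      - (- B * (60 * q1 - 6 * m1)) * ((C\<^sup>2 * (12 * q2 - m2)) * (120 * q3 - 15 * m3) - (120 * q2 - 15 * m2) * (D\<^sup>2 * (12 * q3 - m3)))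
      + (120 * q1 - 15 * m1) * ((C\<^sup>2 * (12 * q2 - m2)) * (- D * (60 * q3 - 6 * m3)) - (- C * (60 * q2 - 6 * m2)) * (D\<^sup>2 * (12 * q3 - m3))))"
    unfolding r1 r2 r3 by Groebner_Basis.algebra
  also have "\<dots> = 0" unfolding det XY by simp
  finally show ?thesis using q by simp
qed

lemma selfdual_det:
  fixes B C D w :: real
  assumes dist: "B \<noteq> C" "B \<noteq> D" "C \<noteq> D" "B \<noteq> 0" "C \<noteq> 0" "D \<noteq> 0"
    and w: "w\<^sup>2 = 8 * ((B * (C - D))\<^sup>2 + (C * (D - B))\<^sup>2 + (D * (B - C))\<^sup>2)"
    and u: "12 * (B * ((B - C) * (B - D))) * u1 = 4 * (B * (B - D) + B * (B - C) + (B - C) * (B - D)) + w"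
      "12 * (C * ((C - B) * (C - D))) * u2 = 4 * (C * (C - D) + C * (C - B) + (C - B) * (C - D)) + w"
      "12 * (D * ((D - B) * (D - C))) * u3 = 4 * (D * (D - C) + D * (D - B) + (D - B) * (D - C)) + w"
  shows "d3 (orow (- B) u1) (orow (- C) u2) (orow (- D) u3) = 0"
  \<comment> \<open>\<open>K\<close> is the cofactor in a factorisation: cleared of denominators,
    the determinant is the product of \<open>K\<close> with the difference of the two sides of
    \<open>w\<close>.\<close>
  by (rule d3_orow_eq_0[OF dist u refl refl refl, where K = "90 * w * ((B - C) * (B - D) * (C - D))", OF _ w])
     Groebner_Basis.algebra

text \<open>The first of the three points is the partner of the fourth, which sits at the origin;
  the sign of w separates the two pairs.\<close>

lemma paired_det:
  fixes B C D w :: real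
  assumes dist: "B \<noteq> C" "B \<noteq> D" "C \<noteq> D" "B \<noteq> 0" "C \<noteq> 0" "D \<noteq> 0"
    and w: "w\<^sup>2 = 3 * (B * (C - D))\<^sup>2 + 2 * (C * (D - B))\<^sup>2 + 2 * (D * (B - C))\<^sup>2"
    and u: "12 * (B * ((B - C) * (B - D))) * u1 = 2 * ((B - C) * (B - D)) + 5 * (B * (B - D) + B * (B - C)) + w"
      "12 * (C * ((C - B) * (C - D))) * u2 = 2 * (C * (C - B)) + 5 * ((C - B) * (C - D) + C * (C - D)) - w"
      "12 * (D * ((D - B) * (D - C))) * u3 = 2 * (D * (D - B)) + 5 * ((D - B) * (D - C) + D * (D - C)) - w"
  shows "d3 (orow (- B) u1) (orow (- C) u2) (orow (- D) u3) = 0"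
  by (rule d3_orow_eq_0[OF dist u refl refl refl,
        where K = "(B - C) * (B - D) * (C - D) * (270 * B * C + 270 * B * D - 540 * C * D + 90 * w)", OF _ w])
     Groebner_Basis.algebra

section \<open>Spaces cut out by real hyperplanes through osculating subspaces\<close>

definition Xu :: "(nat \<Rightarrow> real) \<Rightarrow> (nat \<Rightarrow> real) \<Rightarrow> (nat \<Rightarrow> complex) set" where
  "Xu s u = {v \<in> cspace 7. \<forall>j<4. 1 * ip (oh 5 (s j)) v + complex_of_real (u j) * ip (oh 6 (s j)) v = 0}"

text \<open>The defining equations have real coefficients, so real and imaginary parts of a solution
  are again solutions.\<close>

lemma real_point_Xu: "real_point (Xu s u)"
proof -
  let ?B = "{v \<in> Xu s u. \<forall>i. v i \<in> \<real>}"
  have ohr: "oh n a i = complex_of_real (of_nat (n choose i) * (- a) ^ (n - i))" for n a i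
    by (simp add: oh_def)
  have sub: "cv.subspace (Xu s u)"
  proof -
    have "Xu s u = {v \<in> cspace 7. \<forall>j<4. ip (\<lambda>i. 1 * oh 5 (s j) i + complex_of_real (u j) * oh 6 (s j) i) v = 0}"
      unfolding Xu_def ip_lincomb ..
    then show ?thesis using subspace_kernel by simp
  qed
  have "Xu s u \<subseteq> cv.span ?B"
  proof
    fix v assume v: "v \<in> Xu s u"
    define a where "a i = complex_of_real (Re (v i))" for i
    define b where "b i = complex_of_real (Im (v i))" for i
    have ipa: "ip (oh n t) a = complex_of_real (Re (ip (oh n t) v))" "ip (oh n t) b = complex_of_real (Im (ip (oh n t) v))" for n t
      unfolding ip_def a_def b_def ohr by simp_all
    have "a \<in> cspace 7" "b \<in> cspace 7" using v by (auto simp: Xu_def cspace_def a_def b_def)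
    moreover have "1 * ip (oh 5 (s j)) a + complex_of_real (u j) * ip (oh 6 (s j)) a = 0"
      "1 * ip (oh 5 (s j)) b + complex_of_real (u j) * ip (oh 6 (s j)) b = 0" if "j < 4" for j
    proof -
      have "1 * ip (oh 5 (s j)) v + complex_of_real (u j) * ip (oh 6 (s j)) v = 0" using v that by (simp add: Xu_def)
      then have "Re (1 * ip (oh 5 (s j)) v + complex_of_real (u j) * ip (oh 6 (s j)) v) = 0"
        "Im (1 * ip (oh 5 (s j)) v + complex_of_real (u j) * ip (oh 6 (s j)) v) = 0" by simp_all
      then have "Re (ip (oh 5 (s j)) v) + u j * Re (ip (oh 6 (s j)) v) = 0"
        "Im (ip (oh 5 (s j)) v) + u j * Im (ip (oh 6 (s j)) v) = 0" by simp_all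
      then have "complex_of_real (Re (ip (oh 5 (s j)) v) + u j * Re (ip (oh 6 (s j)) v)) = 0"
        "complex_of_real (Im (ip (oh 5 (s j)) v) + u j * Im (ip (oh 6 (s j)) v)) = 0" by simp_all
      then show "1 * ip (oh 5 (s j)) a + complex_of_real (u j) * ip (oh 6 (s j)) a = 0"
        "1 * ip (oh 5 (s j)) b + complex_of_real (u j) * ip (oh 6 (s j)) b = 0"
        unfolding ipa by simp_all
    qed
    ultimately have "a \<in> ?B" "b \<in> ?B" by (auto simp: Xu_def a_def b_def)
    then have "a + cscale \<i> b \<in> cv.span ?B" by (intro cv.span_add cv.span_scale cv.span_base)
    also have "a + cscale \<i> b = v"
      by (simp add: fun_eq_iff a_def b_def cscale_def complex_eq[symmetric])
    finally show "v \<in> cv.span ?B" .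
  qed
  moreover have "cv.span ?B \<subseteq> Xu s u" by (rule cv.span_minimal[OF _ sub]) auto
  ultimately show ?thesis unfolding real_point_def by (intro exI[of _ ?B]) auto
qed

text \<open>A vector \<open>v\<close> corresponds to the polynomial \<open>pv v\<close>, on which \<open>oh 6 a\<close> and \<open>-6 oh 5 a\<close>
  evaluate the value and the derivative at \<open>a\<close>.\<close>

definition pv :: "(nat \<Rightarrow> complex) \<Rightarrow> complex poly" where
  "pv v = [:v 6, - 6 * v 5, 15 * v 4, - 20 * v 3, 15 * v 2, - 6 * v 1, v 0:]"

lemma oh_values:
  "oh 6 a 0 = complex_of_real a ^ 6" "oh 6 a 1 = - 6 * complex_of_real a ^ 5" "oh 6 a 2 = 15 * complex_of_real a ^ 4"
  "oh 6 a 3 = - 20 * complex_of_real a ^ 3" "oh 6 a 4 = 15 * complex_of_real a ^ 2" "oh 6 a 5 = - 6 * complex_of_real a"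
  "oh 6 a 6 = 1" "oh 5 a 0 = - (complex_of_real a ^ 5)" "oh 5 a 1 = 5 * complex_of_real a ^ 4"
  "oh 5 a 2 = - 10 * complex_of_real a ^ 3" "oh 5 a 3 = 10 * complex_of_real a ^ 2" "oh 5 a 4 = - 5 * complex_of_real a"
  "oh 5 a 5 = 1" "oh 5 a 6 = 0"
  unfolding oh_def choose_values by simp_all

lemma poly_pv: "poly (pv v) (complex_of_real a) = ip (oh 6 a) v"
  unfolding pv_def ip_def sum_less_7 oh_values poly_pCons poly_0 by Groebner_Basis.algebra

lemma pderiv_pv: "pderiv (pv v) = [:- 6 * v 5, 30 * v 4, - 60 * v 3, 60 * v 2, - 30 * v 1, 6 * v 0:]"
  by (simp add: pv_def pderiv_pCons)

lemma poly_pderiv_pv: "poly (pderiv (pv v)) (complex_of_real a) = - 6 * ip (oh 5 a) v"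
  unfolding pderiv_pv ip_def sum_less_7 oh_values poly_pCons poly_0 by Groebner_Basis.algebra

lemma pv_eq_0:
  assumes "v \<in> cspace 7" "pv v = 0"
  shows "v = 0"
proof -
  have "\<forall>j<7. v j = 0" unfolding all_less_7 using assms(2) by (simp add: pv_def)
  moreover have "v i = 0" if "\<not> i < 7" for i using assms(1) that by (simp add: cspace_def)
  ultimately show ?thesis by (metis ext zero_fun_apply)
qed

lemma double_root_factor:
  fixes A q :: "complex poly"
  assumes "poly (A * q) a = 0" "poly (pderiv (A * q)) a = 0" "poly A a \<noteq> 0"
  obtains r where "q = [:- a, 1:] ^ 2 * r"
proof -
  have q: "poly q a = 0" using assms(1,3) by simp
  then obtain q1 where q1: "q = [:- a, 1:] * q1" by (metis dvdE poly_eq_0_iff_dvd)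
  have "poly (pderiv q) a = 0" using assms(2,3) q by (simp add: pderiv_mult)
  moreover have "pderiv q = q1 + [:- a, 1:] * pderiv q1" unfolding q1 pderiv_mult by (simp add: pderiv_pCons)
  ultimately have "poly q1 a = 0" by simp
  then obtain r where r: "q1 = [:- a, 1:] * r" by (metis dvdE poly_eq_0_iff_dvd)
  have "q = [:- a, 1:] ^ 2 * r" unfolding q1 r power2_eq_square by (simp only: mult.assoc)
  then show ?thesis by (rule that)
qed

locale osculating =
  fixes s :: "nat \<Rightarrow> real"
  assumes distinct: "\<And>i j. i < 4 \<Longrightarrow> j < 4 \<Longrightarrow> i \<noteq> j \<Longrightarrow> s i \<noteq> s j"
begin

sublocale F: four_flags "\<lambda>j r c. osc_matrix (s j) r c" "\<lambda>j. oh 6 (s j)" "\<lambda>j. oh 5 (s j)"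
proof
  fix j
  note f = det_osc[of "s j"] sum_osc_oh_dual[of 6 "s j"] sum_osc_oh_dual[of 5 "s j"]
  have h6: "\<And>r. r < 7 \<Longrightarrow> (\<Sum>c<7. osc_matrix (s j) r c * oh 6 (s j) c) = (if r = 6 then 1 else 0)"
    and h5: "\<And>r. r < 7 \<Longrightarrow> (\<Sum>c<7. osc_matrix (s j) r c * oh 5 (s j) c) = (if r = 5 then 1 else 0)" using f by simp_all
  show "flag_of_matrix 7 (osc_matrix (s j)) 7 = cspace 7" by (rule flag_7[OF f(1) h6 h5])
  show "v \<in> flag_of_matrix 7 (osc_matrix (s j)) 5 \<longleftrightarrow> ip (oh 6 (s j)) v = 0 \<and> ip (oh 5 (s j)) v = 0"
    if "v \<in> cspace 7" for v using flag_5[OF f(1) h6 h5 that] by blast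
  show "z k = 0" if "(\<Sum>k<3. cscale (z k) (row_vec 7 (osc_matrix (s j)) k)) = 0" "k < 3" for z k
    by (rule rows_indep_3[OF f(1) h6 h5 that])
qed

text \<open>Where the value of \<open>pv v\<close> vanishes at one of the points, so does its
  derivative. Hence \<open>pv v\<close> is a constant times the product of the (X - s_j)^2 for j <
  3, and unless the constant is zero the condition at s_3 says that 6 \<open>u 3\<close> is twice
  the sum of the 1 / (s_3 - s_j), which \<open>u3\<close> excludes.\<close>

lemma Xu_injective:
  assumes v: "v \<in> Xu s u" and h: "\<And>j. j < 3 \<Longrightarrow> ip (oh 6 (s j)) v = 0"
    and u3: "u 3 \<noteq> (1 / (s 3 - s 0) + 1 / (s 3 - s 1) + 1 / (s 3 - s 2)) / 3"
  shows "v = 0"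
proof -
  let ?a = "\<lambda>j. complex_of_real (s j)"
  have X: "ip (oh 5 (s j)) v = - complex_of_real (u j) * ip (oh 6 (s j)) v" if "j < 4" for j
    using v that by (simp add: Xu_def eq_neg_iff_add_eq_0)
  have r: "poly (pv v) (?a j) = 0" "poly (pderiv (pv v)) (?a j) = 0" if "j < 3" for j
    using h[OF that] X[of j] that by (simp_all add: poly_pv poly_pderiv_pv)
  have ne: "?a 1 \<noteq> ?a 0" "?a 2 \<noteq> ?a 0" "?a 2 \<noteq> ?a 1" "?a 3 \<noteq> ?a 0" "?a 3 \<noteq> ?a 1" "?a 3 \<noteq> ?a 2"
    using distinct by simp_all
  obtain p1 where p1: "pv v = [:- ?a 0, 1:] ^ 2 * p1"
    using double_root_factor[of 1 "pv v" "?a 0"] r[of 0] by auto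
  obtain p2 where p2: "p1 = [:- ?a 1, 1:] ^ 2 * p2"
    using double_root_factor[of "[:- ?a 0, 1:] ^ 2" p1 "?a 1"] r[of 1] ne unfolding p1 by auto
  obtain p3 where p3: "p2 = [:- ?a 2, 1:] ^ 2 * p3"
    using double_root_factor[of "[:- ?a 0, 1:] ^ 2 * [:- ?a 1, 1:] ^ 2" p2 "?a 2"] r[of 2] ne
    unfolding p1 p2 by (auto simp: mult.assoc)
  have pv: "pv v = [:- ?a 0, 1:] ^ 2 * [:- ?a 1, 1:] ^ 2 * [:- ?a 2, 1:] ^ 2 * p3"
    unfolding p1 p2 p3 by (simp add: mult.assoc)
  have "p3 = 0"
  proof (rule ccontr)
    assume p3: "p3 \<noteq> 0"
    have "degree (pv v) = 6 + degree p3"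
      unfolding pv using p3 by (simp add: degree_mult_eq degree_power_eq)
    moreover have "degree (pv v) \<le> 6" unfolding pv_def by simp
    ultimately have "degree p3 = 0" by simp
    then obtain k where k: "p3 = [:k:]" by (rule degree_eq_zeroE)
    with p3 have k0: "k \<noteq> 0" by simp
    define d0 d1 d2 where "d0 = ?a 3 - ?a 0" and "d1 = ?a 3 - ?a 1" and "d2 = ?a 3 - ?a 2"
    have d: "d0 \<noteq> 0" "d1 \<noteq> 0" "d2 \<noteq> 0" using ne by (simp_all add: d0_def d1_def d2_def)
    have e1: "ip (oh 6 (s 3)) v = k * d0\<^sup>2 * d1\<^sup>2 * d2\<^sup>2"
      unfolding poly_pv[symmetric] pv k d0_def d1_def d2_def by (simp add: power2_eq_square algebra_simps)
    have e2: "- 6 * ip (oh 5 (s 3)) v = 2 * k * d0 * d1 * d2 * (d1 * d2 + d0 * d2 + d0 * d1)"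
      unfolding poly_pderiv_pv[symmetric] pv k d0_def d1_def d2_def
      by (simp add: pderiv_mult pderiv_power pderiv_pCons power2_eq_square algebra_simps)
    have "k * d0 * d1 * d2 * (3 * complex_of_real (u 3) * (d0 * d1 * d2) - (d1 * d2 + d0 * d2 + d0 * d1)) = 0"
      using X[of 3] e1 e2 by simp Groebner_Basis.algebra
    then have "3 * complex_of_real (u 3) * (d0 * d1 * d2) = d1 * d2 + d0 * d2 + d0 * d1" using k0 d by simp
    then have "complex_of_real (u 3) = (d1 * d2 + d0 * d2 + d0 * d1) / (3 * (d0 * d1 * d2))"
      using d by (simp add: nonzero_eq_divide_eq mult_ac)
    also have "\<dots> = (1 / d0 + 1 / d1 + 1 / d2) / 3" using d by (simp add: divide_simps distrib_right)
    finally have "complex_of_real (u 3) = (1 / d0 + 1 / d1 + 1 / d2) / 3" .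
    also have "\<dots> = complex_of_real ((1 / (s 3 - s 0) + 1 / (s 3 - s 1) + 1 / (s 3 - s 2)) / 3)"
      by (simp add: d0_def d1_def d2_def)
    finally show False using u3 unfolding of_real_eq_iff by simp
  qed
  then show ?thesis using v by (intro pv_eq_0) (simp_all add: Xu_def pv)
qed

end

section \<open>Explicit values of the parameters\<close>

lemma d3_perm: "d3 b a c = - d3 a b c" "d3 b c a = d3 a b c"
  unfolding d3_def by (simp_all add: algebra_simps)

lemma d3_zero_perm:
  assumes "d3 a b c = 0"
  shows "d3 b a c = 0" "d3 b c a = 0"
  using assms by (simp_all add: d3_perm(1)[of b a c] d3_perm(2)[of b c a])

text \<open>For distinct points this says that y is (p / (a - b) + q / (a - c) + q / (a - d)) / 12
  plus w / (12 (a - b) (a - c) (a - d)); b is the partner of a.\<close>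

definition root_eq :: "real \<Rightarrow> real \<Rightarrow> real \<Rightarrow> real \<Rightarrow> real \<Rightarrow> real \<Rightarrow> real \<Rightarrow> real \<Rightarrow> bool" where
  "root_eq p q w a b c d y \<longleftrightarrow>
    12 * ((a - b) * (a - c) * (a - d)) * y = p * ((a - c) * (a - d)) + q * ((a - b) * (a - d) + (a - b) * (a - c)) + w"

lemma selfdual_dets:
  fixes a b c d w ua ub uc ud :: real
  assumes dist: "a \<noteq> b" "a \<noteq> c" "a \<noteq> d" "b \<noteq> c" "b \<noteq> d" "c \<noteq> d"
    and w: "w\<^sup>2 = 8 * (((a - b) * (c - d))\<^sup>2 + ((a - c) * (d - b))\<^sup>2 + ((a - d) * (b - c))\<^sup>2)"
    and eqs: "root_eq 4 4 w a b c d ua" "root_eq 4 4 w b a c d ub" "root_eq 4 4 w c d a b uc" "root_eq 4 4 w d c a b ud"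
  shows "d3 (orow (a - b) ub) (orow (a - c) uc) (orow (a - d) ud) = 0"
    "d3 (orow (b - a) ua) (orow (b - c) uc) (orow (b - d) ud) = 0"
    "d3 (orow (c - a) ua) (orow (c - b) ub) (orow (c - d) ud) = 0"
    "d3 (orow (d - a) ua) (orow (d - b) ub) (orow (d - c) uc) = 0"
proof -
  note u = eqs[unfolded root_eq_def]
  have "d3 (orow (- (b - a)) ub) (orow (- (c - a)) uc) (orow (- (d - a)) ud) = 0"
    by (rule selfdual_det[of _ _ _ w]) ((use dist in \<open>simp; fail\<close>)+, use w in Groebner_Basis.algebra,
      use u(2) in Groebner_Basis.algebra, use u(3) in Groebner_Basis.algebra, use u(4) in Groebner_Basis.algebra)
  then show "d3 (orow (a - b) ub) (orow (a - c) uc) (orow (a - d) ud) = 0" by simp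
  have "d3 (orow (- (a - b)) ua) (orow (- (c - b)) uc) (orow (- (d - b)) ud) = 0"
    by (rule selfdual_det[of _ _ _ w]) ((use dist in \<open>simp; fail\<close>)+, use w in Groebner_Basis.algebra,
      use u(1) in Groebner_Basis.algebra, use u(3) in Groebner_Basis.algebra, use u(4) in Groebner_Basis.algebra)
  then show "d3 (orow (b - a) ua) (orow (b - c) uc) (orow (b - d) ud) = 0" by simp
  have "d3 (orow (- (a - c)) ua) (orow (- (b - c)) ub) (orow (- (d - c)) ud) = 0"
    by (rule selfdual_det[of _ _ _ w]) ((use dist in \<open>simp; fail\<close>)+, use w in Groebner_Basis.algebra,
      use u(1) in Groebner_Basis.algebra, use u(2) in Groebner_Basis.algebra, use u(4) in Groebner_Basis.algebra)
  then show "d3 (orow (c - a) ua) (orow (c - b) ub) (orow (c - d) ud) = 0" by simp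
  have "d3 (orow (- (a - d)) ua) (orow (- (b - d)) ub) (orow (- (c - d)) uc) = 0"
    by (rule selfdual_det[of _ _ _ w]) ((use dist in \<open>simp; fail\<close>)+, use w in Groebner_Basis.algebra,
      use u(1) in Groebner_Basis.algebra, use u(2) in Groebner_Basis.algebra, use u(3) in Groebner_Basis.algebra)
  then show "d3 (orow (d - a) ua) (orow (d - b) ub) (orow (d - c) uc) = 0" by simp
qed

text \<open>Each determinant is \<open>paired_det\<close> with a different point moved to the origin
  and its partner placed first. For the pair c, d the square root enters as - w.\<close>

lemma paired_dets:
  fixes a b c d w ua ub uc ud :: real
  assumes dist: "a \<noteq> b" "a \<noteq> c" "a \<noteq> d" "b \<noteq> c" "b \<noteq> d" "c \<noteq> d"
    and w: "w\<^sup>2 = 3 * ((a - b) * (c - d))\<^sup>2 + 2 * ((a - c) * (d - b))\<^sup>2 + 2 * ((a - d) * (b - c))\<^sup>2"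
    and eqs: "root_eq 2 5 w a b c d ua" "root_eq 2 5 w b a c d ub" "root_eq 2 5 (- w) c d a b uc" "root_eq 2 5 (- w) d c a b ud"
  shows "d3 (orow (a - b) ub) (orow (a - c) uc) (orow (a - d) ud) = 0"
    "d3 (orow (b - a) ua) (orow (b - c) uc) (orow (b - d) ud) = 0"
    "d3 (orow (c - d) ud) (orow (c - a) ua) (orow (c - b) ub) = 0"
    "d3 (orow (d - c) uc) (orow (d - a) ua) (orow (d - b) ub) = 0"
proof -
  note u = eqs[unfolded root_eq_def]
  have "d3 (orow (- (b - a)) ub) (orow (- (c - a)) uc) (orow (- (d - a)) ud) = 0"
    by (rule paired_det[of _ _ _ w]) ((use dist in \<open>simp; fail\<close>)+, use w in Groebner_Basis.algebra,
      use u(2) in Groebner_Basis.algebra, use u(3) in Groebner_Basis.algebra, use u(4) in Groebner_Basis.algebra)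
  then show "d3 (orow (a - b) ub) (orow (a - c) uc) (orow (a - d) ud) = 0" by simp
  have "d3 (orow (- (a - b)) ua) (orow (- (c - b)) uc) (orow (- (d - b)) ud) = 0"
    by (rule paired_det[of _ _ _ w]) ((use dist in \<open>simp; fail\<close>)+, use w in Groebner_Basis.algebra,
      use u(1) in Groebner_Basis.algebra, use u(3) in Groebner_Basis.algebra, use u(4) in Groebner_Basis.algebra)
  then show "d3 (orow (b - a) ua) (orow (b - c) uc) (orow (b - d) ud) = 0" by simp
  have "d3 (orow (- (d - c)) ud) (orow (- (a - c)) ua) (orow (- (b - c)) ub) = 0"
    by (rule paired_det[of _ _ _ "- w"]) ((use dist in \<open>simp; fail\<close>)+, use w in Groebner_Basis.algebra,
      use u(4) in Groebner_Basis.algebra, use u(1) in Groebner_Basis.algebra, use u(2) in Groebner_Basis.algebra)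
  then show "d3 (orow (c - d) ud) (orow (c - a) ua) (orow (c - b) ub) = 0" by simp
  have "d3 (orow (- (c - d)) uc) (orow (- (a - d)) ua) (orow (- (b - d)) ub) = 0"
    by (rule paired_det[of _ _ _ "- w"]) ((use dist in \<open>simp; fail\<close>)+, use w in Groebner_Basis.algebra,
      use u(3) in Groebner_Basis.algebra, use u(1) in Groebner_Basis.algebra, use u(2) in Groebner_Basis.algebra)
  then show "d3 (orow (d - c) uc) (orow (d - a) ua) (orow (d - b) ub) = 0" by simp
qed

text \<open>\<open>12 (s0 - s1) (s0 - s2) (s0 - s3) u0\<close> takes the values \<open>ratpart s k + w\<close> with \<open>w\<^sup>2 = disc s k\<close>,
  for \<open>k = 0\<close> (the self-dual solutions) and for the three pairings \<open>{0,k}\<close> of the points,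
  whose solutions are fixed by the involution exchanging the paired points.\<close>

definition disc :: "(nat \<Rightarrow> real) \<Rightarrow> nat \<Rightarrow> real" where
  "disc s k = (let x = ((s 0 - s 1) * (s 2 - s 3))\<^sup>2; y = ((s 0 - s 2) * (s 3 - s 1))\<^sup>2; z = ((s 0 - s 3) * (s 1 - s 2))\<^sup>2 in
     if k = 0 then 8 * (x + y + z) else if k = 1 then 3 * x + 2 * y + 2 * z
     else if k = 2 then 2 * x + 3 * y + 2 * z else 2 * x + 2 * y + 3 * z)"

definition ratpart :: "(nat \<Rightarrow> real) \<Rightarrow> nat \<Rightarrow> real" where
  "ratpart s k = (let a = (s 0 - s 2) * (s 0 - s 3); b = (s 0 - s 1) * (s 0 - s 3); c = (s 0 - s 1) * (s 0 - s 2) in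
     if k = 0 then 4 * (a + b + c) else if k = 1 then 2 * a + 5 * (b + c)
     else if k = 2 then 2 * b + 5 * (a + c) else 2 * c + 5 * (a + b))"

lemma disc_values:
  "disc s 0 = 8 * (((s 0 - s 1) * (s 2 - s 3))\<^sup>2 + ((s 0 - s 2) * (s 3 - s 1))\<^sup>2 + ((s 0 - s 3) * (s 1 - s 2))\<^sup>2)"
  "disc s 1 = 3 * ((s 0 - s 1) * (s 2 - s 3))\<^sup>2 + 2 * ((s 0 - s 2) * (s 3 - s 1))\<^sup>2 + 2 * ((s 0 - s 3) * (s 1 - s 2))\<^sup>2"
  "disc s 2 = 2 * ((s 0 - s 1) * (s 2 - s 3))\<^sup>2 + 3 * ((s 0 - s 2) * (s 3 - s 1))\<^sup>2 + 2 * ((s 0 - s 3) * (s 1 - s 2))\<^sup>2"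
  "disc s 3 = 2 * ((s 0 - s 1) * (s 2 - s 3))\<^sup>2 + 2 * ((s 0 - s 2) * (s 3 - s 1))\<^sup>2 + 3 * ((s 0 - s 3) * (s 1 - s 2))\<^sup>2"
  unfolding disc_def Let_def by simp_all

lemma ratpart_values:
  "ratpart s 0 = 4 * ((s 0 - s 2) * (s 0 - s 3) + (s 0 - s 1) * (s 0 - s 3) + (s 0 - s 1) * (s 0 - s 2))"
  "ratpart s 1 = 2 * ((s 0 - s 2) * (s 0 - s 3)) + 5 * ((s 0 - s 1) * (s 0 - s 3) + (s 0 - s 1) * (s 0 - s 2))"
  "ratpart s 2 = 2 * ((s 0 - s 1) * (s 0 - s 3)) + 5 * ((s 0 - s 2) * (s 0 - s 3) + (s 0 - s 1) * (s 0 - s 2))"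
  "ratpart s 3 = 2 * ((s 0 - s 1) * (s 0 - s 2)) + 5 * ((s 0 - s 2) * (s 0 - s 3) + (s 0 - s 1) * (s 0 - s 3))"
  unfolding ratpart_def Let_def by simp_all

lemma critical_ne:
  fixes p q r y :: real
  assumes nz: "p \<noteq> 0" "q \<noteq> 0" "r \<noteq> 0" and ne: "12 * (p * q * r) * y \<noteq> 4 * (p * q + p * r + q * r)"
  shows "y \<noteq> (1 / p + 1 / q + 1 / r) / 3"
proof
  assume "y = (1 / p + 1 / q + 1 / r) / 3"
  then have y: "3 * y = 1 / p + 1 / q + 1 / r" by simp
  have "p * (1 / p) = 1" "q * (1 / q) = 1" "r * (1 / r) = 1" using nz by simp_all
  then have "12 * (p * q * r) * y = 4 * (p * q + p * r + q * r)" using y by Groebner_Basis.algebra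
  with ne show False ..
qed

text \<open>The excluded value of y would determine w, and comparison with the prescribed square
  leaves 4 ((a - b) (c - d))^2 = 0.\<close>

lemma root_eq_critical_ne:
  fixes a b c d w y :: real
  assumes dist: "d \<noteq> a" "d \<noteq> b" "d \<noteq> c" "a \<noteq> b" and eq: "root_eq 2 5 w d c a b y"
    and w: "w\<^sup>2 = 3 * ((a - b) * (c - d))\<^sup>2 + 2 * ((a - c) * (d - b))\<^sup>2 + 2 * ((a - d) * (b - c))\<^sup>2"
  shows "y \<noteq> (1 / (d - a) + 1 / (d - b) + 1 / (d - c)) / 3"
proof (rule critical_ne)
  show "12 * ((d - a) * (d - b) * (d - c)) * y \<noteq> 4 * ((d - a) * (d - b) + (d - a) * (d - c) + (d - b) * (d - c))"
  proof
    assume "12 * ((d - a) * (d - b) * (d - c)) * y = 4 * ((d - a) * (d - b) + (d - a) * (d - c) + (d - b) * (d - c))"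
    with eq have "w = 2 * ((d - a) * (d - b)) - (d - c) * (d - a) - (d - c) * (d - b)"
      unfolding root_eq_def by Groebner_Basis.algebra
    then have "((a - b) * (c - d))\<^sup>2 = 0" using w by Groebner_Basis.algebra
    then show False using dist by simp
  qed
qed (use dist in simp_all)

lemma root_eq_solution:
  fixes p q v w a b c d :: real and i j k l :: nat
  assumes dist: "a \<noteq> b" "a \<noteq> c" "a \<noteq> d" "b \<noteq> c" "b \<noteq> d" "c \<noteq> d" and idx: "distinct [i, j, k, l]"
  obtains u where "root_eq p q v a b c d (u i)" "root_eq p q v b a c d (u j)" "root_eq p q w c d a b (u k)" "root_eq p q w d c a b (u l)"
proof -
  define y where "y w a b c d = (p * ((a - c) * (a - d)) + q * ((a - b) * (a - d) + (a - b) * (a - c)) + w) /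
    (12 * ((a - b) * (a - c) * (a - d)))" for w a b c d :: real
  have y: "root_eq p q w a b c d (y w a b c d)" if "a \<noteq> b" "a \<noteq> c" "a \<noteq> d" for w a b c d
    using that by (simp add: root_eq_def y_def)
  show ?thesis
    by (rule that[of "(\<lambda>_. 0)(i := y v a b c d, j := y v b a c d, k := y w c d a b, l := y w d c a b)"])
       (use dist idx in \<open>simp_all add: y\<close>)
qed

context osculating
begin

lemma Sol_eq: "Sol (osc_point s) = F.S"
  by (simp add: Sol_def osc_point_def)

lemma Dh_orow:
  "F.Dh j i1 i2 i3 (\<lambda>j. complex_of_real (u j)) (\<lambda>_. 1) =
    complex_of_real (d3 (orow (s j - s i1) (u i1)) (orow (s j - s i2) (u i2)) (orow (s j - s i3) (u i3)))"
proof -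
  have "complex_of_real (u i) * F.L j i k + 1 * F.M j i k = complex_of_real (orow (s j - s i) (u i) k)" for i k
    by (simp add: F.L_def F.M_def ip_oh_row orow_def)
  then show ?thesis unfolding F.Dh_def by (simp add: d3_def)
qed

lemma Xu_mem:
  assumes d: "d3 (orow (s 0 - s 1) (u 1)) (orow (s 0 - s 2) (u 2)) (orow (s 0 - s 3) (u 3)) = 0"
      "d3 (orow (s 1 - s 0) (u 0)) (orow (s 1 - s 2) (u 2)) (orow (s 1 - s 3) (u 3)) = 0"
      "d3 (orow (s 2 - s 0) (u 0)) (orow (s 2 - s 1) (u 1)) (orow (s 2 - s 3) (u 3)) = 0"
      "d3 (orow (s 3 - s 0) (u 0)) (orow (s 3 - s 1) (u 1)) (orow (s 3 - s 2) (u 2)) = 0"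
    and u3: "u 3 \<noteq> (1 / (s 3 - s 0) + 1 / (s 3 - s 1) + 1 / (s 3 - s 2)) / 3"
  shows "Xu s u \<in> Sol (osc_point s)"
  unfolding Sol_eq
proof (rule F.S_intro[of "\<lambda>j. complex_of_real (u j)" "\<lambda>_. 1" _ "\<lambda>j. oh 6 (s j)"])
  show "Xu s u = {v \<in> cspace 7. \<forall>j<4. complex_of_real (u j) * ip (oh 6 (s j)) v + 1 * ip (oh 5 (s j)) v = 0}"
    unfolding Xu_def by (simp add: add.commute)
  show "v = 0" if "v \<in> Xu s u" "\<forall>j<3. ip (oh 6 (s j)) v = 0" for v
    using Xu_injective[OF that(1) _ u3] that(2) by blast
qed (simp_all add: Dh_orow d del: One_nat_def)

text \<open>Two different values of \<open>u 0\<close> for the same space would make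
  \<open>oh 6 (s 0)\<close> vanish on it; by \<open>Xu_injective\<close> the two values at s_1 and
  s_2 would then determine its vectors, against dimension 3.\<close>

lemma Xu_inj:
  assumes mem: "Xu s u \<in> Sol (osc_point s)" and eq: "Xu s u = Xu s u'"
    and u3: "u 3 \<noteq> (1 / (s 3 - s 0) + 1 / (s 3 - s 1) + 1 / (s 3 - s 2)) / 3"
  shows "u 0 = u' 0"
proof (rule ccontr)
  assume ne: "u 0 \<noteq> u' 0"
  have X: "cv.subspace (Xu s u)" "cv.dim (Xu s u) = 3" "Xu s u \<subseteq> cspace 7"
    using mem mem_schubert_intersection_iff[where F = "\<lambda>j. flag_of_matrix 7 (osc_matrix (s j))", OF F.K7, of "Xu s u"]
    unfolding Sol_eq by blast+
  have h0: "ip (oh 6 (s 0)) v = 0" if "v \<in> Xu s u" for v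
  proof -
    have "1 * ip (oh 5 (s 0)) v + complex_of_real (u 0) * ip (oh 6 (s 0)) v = 0"
      "1 * ip (oh 5 (s 0)) v + complex_of_real (u' 0) * ip (oh 6 (s 0)) v = 0"
      using that that[unfolded eq] by (simp_all add: Xu_def)
    then have "complex_of_real (u 0 - u' 0) * ip (oh 6 (s 0)) v = 0" unfolding of_real_diff by Groebner_Basis.algebra
    then show ?thesis using ne by simp
  qed
  have "cv.dim (Xu s u) \<le> 2"
  proof (rule dim_le_if_injective[of _ 2 "\<lambda>j. oh 6 (s (Suc j))"])
    show "fd (Xu s u)" using fd_cspace X(3) by (rule fd_subset)
    fix v assume v: "v \<in> Xu s u" "\<forall>j<2. ip (oh 6 (s (Suc j))) v = 0"
    have "ip (oh 6 (s 0)) v = 0" "ip (oh 6 (s 1)) v = 0" "ip (oh 6 (s 2)) v = 0"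
      using h0[OF v(1)] v(2)[rule_format, of 0] v(2)[rule_format, of 1] by (simp_all add: numeral_2_eq_2)
    then show "v = 0" using v(1) u3 by (intro Xu_injective[of v u]) (auto simp: less_3_iff)
  qed (rule X(1))
  then show False using X(2) by simp
qed

lemma diff_nonzero:
  "s 0 - s 1 \<noteq> 0" "s 0 - s 2 \<noteq> 0" "s 0 - s 3 \<noteq> 0" "s 1 - s 0 \<noteq> 0" "s 1 - s 2 \<noteq> 0" "s 1 - s 3 \<noteq> 0"
  "s 2 - s 0 \<noteq> 0" "s 2 - s 1 \<noteq> 0" "s 2 - s 3 \<noteq> 0" "s 3 - s 0 \<noteq> 0" "s 3 - s 1 \<noteq> 0" "s 3 - s 2 \<noteq> 0"
  using distinct[of 0 1] distinct[of 0 2] distinct[of 0 3] distinct[of 1 2] distinct[of 1 3] distinct[of 2 3] by auto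

lemma disc_pos: "disc s k > 0"
proof -
  define x y z where "x = ((s 0 - s 1) * (s 2 - s 3))\<^sup>2" and "y = ((s 0 - s 2) * (s 3 - s 1))\<^sup>2"
    and "z = ((s 0 - s 3) * (s 1 - s 2))\<^sup>2"
  have "x > 0" "y > 0" "z > 0" using diff_nonzero by (simp_all add: x_def y_def z_def)
  then show ?thesis unfolding disc_def Let_def x_def[symmetric] y_def[symmetric] z_def[symmetric] by auto
qed

text \<open>The last conjunct records \<open>u 0\<close>, by which the eight solutions are told
  apart. Pairings of s_0 with s_2 or s_3 come from \<open>paired_dets\<close> by permuting the
  points.\<close>

lemma real_solution:
  assumes k: "k < 4" and w: "w\<^sup>2 = disc s k"
  shows "\<exists>u. Xu s u \<in> Sol (osc_point s) \<and> u 3 \<noteq> (1 / (s 3 - s 0) + 1 / (s 3 - s 1) + 1 / (s 3 - s 2)) / 3 \<and>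
    12 * ((s 0 - s 1) * (s 0 - s 2) * (s 0 - s 3)) * u 0 = ratpart s k + w"
proof -
  have w0: "w \<noteq> 0" using disc_pos[of k] w by auto
  have ds: "s 0 \<noteq> s 1" "s 0 \<noteq> s 2" "s 0 \<noteq> s 3" "s 1 \<noteq> s 2" "s 1 \<noteq> s 3" "s 2 \<noteq> s 3" using distinct by simp_all
  consider "k = 0" | "k = 1" | "k = 2" | "k = 3" using k by linarith
  then show ?thesis
  proof cases
    case 1
    obtain u :: "nat \<Rightarrow> real" where u:
      "root_eq 4 4 w (s 0) (s 1) (s 2) (s 3) (u 0)" "root_eq 4 4 w (s 1) (s 0) (s 2) (s 3) (u 1)"
      "root_eq 4 4 w (s 2) (s 3) (s 0) (s 1) (u 2)" "root_eq 4 4 w (s 3) (s 2) (s 0) (s 1) (u 3)"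
      by (rule root_eq_solution[of "s 0" "s 1" "s 2" "s 3" 0 1 2 3 4 4 w w]) (use ds in simp_all)
    \<comment> \<open>The value of \<open>u 3\<close> excluded in \<open>Xu_injective\<close> is the
      one at w = 0.\<close>
    have "12 * ((s 3 - s 0) * (s 3 - s 1) * (s 3 - s 2)) * u 3 =
        4 * ((s 3 - s 0) * (s 3 - s 1) + (s 3 - s 0) * (s 3 - s 2) + (s 3 - s 1) * (s 3 - s 2)) + w"
      using u(4) unfolding root_eq_def by Groebner_Basis.algebra
    then have u3: "u 3 \<noteq> (1 / (s 3 - s 0) + 1 / (s 3 - s 1) + 1 / (s 3 - s 2)) / 3"
      using w0 by (intro critical_ne diff_nonzero) linarith
    have w': "w\<^sup>2 = 8 * (((s 0 - s 1) * (s 2 - s 3))\<^sup>2 + ((s 0 - s 2) * (s 3 - s 1))\<^sup>2 + ((s 0 - s 3) * (s 1 - s 2))\<^sup>2)"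
      unfolding w 1 disc_values ..
    have "Xu s u \<in> Sol (osc_point s)"
      by (rule Xu_mem[OF selfdual_dets[OF ds w' u] u3])
    moreover have "12 * ((s 0 - s 1) * (s 0 - s 2) * (s 0 - s 3)) * u 0 = ratpart s k + w"
      using u(1) unfolding root_eq_def 1 ratpart_values by Groebner_Basis.algebra
    ultimately show ?thesis using u3 by blast
  next
    case 2
    obtain u :: "nat \<Rightarrow> real" where u:
      "root_eq 2 5 w (s 0) (s 1) (s 2) (s 3) (u 0)" "root_eq 2 5 w (s 1) (s 0) (s 2) (s 3) (u 1)"
      "root_eq 2 5 (- w) (s 2) (s 3) (s 0) (s 1) (u 2)" "root_eq 2 5 (- w) (s 3) (s 2) (s 0) (s 1) (u 3)"
      by (rule root_eq_solution[of "s 0" "s 1" "s 2" "s 3" 0 1 2 3 2 5 w "- w"]) (use ds in simp_all)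
    have w': "w\<^sup>2 = 3 * ((s 0 - s 1) * (s 2 - s 3))\<^sup>2 + 2 * ((s 0 - s 2) * (s 3 - s 1))\<^sup>2 + 2 * ((s 0 - s 3) * (s 1 - s 2))\<^sup>2"
      unfolding w 2 disc_values ..
    note dets = paired_dets[OF ds w' u]
    have u3: "u 3 \<noteq> (1 / (s 3 - s 0) + 1 / (s 3 - s 1) + 1 / (s 3 - s 2)) / 3"
      by (rule root_eq_critical_ne[OF _ _ _ _ u(4)]) ((use ds in \<open>simp; fail\<close>)+, use w' in Groebner_Basis.algebra)
    have "Xu s u \<in> Sol (osc_point s)"
      by (rule Xu_mem[OF dets(1) dets(2) dets(3)[THEN d3_zero_perm(2)] dets(4)[THEN d3_zero_perm(2)] u3])
    moreover have "12 * ((s 0 - s 1) * (s 0 - s 2) * (s 0 - s 3)) * u 0 = ratpart s k + w"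
      using u(1) unfolding root_eq_def 2 ratpart_values .
    ultimately show ?thesis using u3 by blast
  next
    case 3
    obtain u :: "nat \<Rightarrow> real" where u:
      "root_eq 2 5 w (s 0) (s 2) (s 1) (s 3) (u 0)" "root_eq 2 5 w (s 2) (s 0) (s 1) (s 3) (u 2)"
      "root_eq 2 5 (- w) (s 1) (s 3) (s 0) (s 2) (u 1)" "root_eq 2 5 (- w) (s 3) (s 1) (s 0) (s 2) (u 3)"
      by (rule root_eq_solution[of "s 0" "s 2" "s 1" "s 3" 0 2 1 3 2 5 w "- w"]) (use ds in simp_all)
    have w': "w\<^sup>2 = 3 * ((s 0 - s 2) * (s 1 - s 3))\<^sup>2 + 2 * ((s 0 - s 1) * (s 3 - s 2))\<^sup>2 + 2 * ((s 0 - s 3) * (s 2 - s 1))\<^sup>2"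
      unfolding w 3 disc_values by Groebner_Basis.algebra
    note dets = paired_dets[OF ds(2) ds(1) ds(3) ds(4)[symmetric] ds(6) ds(5) w' u]
    have u3: "u 3 \<noteq> (1 / (s 3 - s 0) + 1 / (s 3 - s 1) + 1 / (s 3 - s 2)) / 3"
    proof -
      have "u 3 \<noteq> (1 / (s 3 - s 0) + 1 / (s 3 - s 2) + 1 / (s 3 - s 1)) / 3"
        by (rule root_eq_critical_ne[OF _ _ _ _ u(4)]) ((use ds in \<open>simp; fail\<close>)+, use w' in Groebner_Basis.algebra)
      then show ?thesis by (simp only: add_ac not_False_eq_True)
    qed
    have "Xu s u \<in> Sol (osc_point s)"
      by (rule Xu_mem[OF dets(1)[THEN d3_zero_perm(1)] dets(3)[THEN d3_zero_perm(2)] dets(2) dets(4)[THEN d3_zero_perm(1)] u3])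
    moreover have "12 * ((s 0 - s 1) * (s 0 - s 2) * (s 0 - s 3)) * u 0 = ratpart s k + w"
      using u(1) unfolding root_eq_def 3 ratpart_values by Groebner_Basis.algebra
    ultimately show ?thesis using u3 by blast
  next
    case 4
    obtain u :: "nat \<Rightarrow> real" where u:
      "root_eq 2 5 w (s 0) (s 3) (s 1) (s 2) (u 0)" "root_eq 2 5 w (s 3) (s 0) (s 1) (s 2) (u 3)"
      "root_eq 2 5 (- w) (s 1) (s 2) (s 0) (s 3) (u 1)" "root_eq 2 5 (- w) (s 2) (s 1) (s 0) (s 3) (u 2)"
      by (rule root_eq_solution[of "s 0" "s 3" "s 1" "s 2" 0 3 1 2 2 5 w "- w"]) (use ds in simp_all)
    have w': "w\<^sup>2 = 3 * ((s 0 - s 3) * (s 1 - s 2))\<^sup>2 + 2 * ((s 0 - s 1) * (s 2 - s 3))\<^sup>2 + 2 * ((s 0 - s 2) * (s 3 - s 1))\<^sup>2"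
      unfolding w 4 disc_values by Groebner_Basis.algebra
    note dets = paired_dets[OF ds(3) ds(1) ds(2) ds(5)[symmetric] ds(6)[symmetric] ds(4) w' u]
    have u3: "u 3 \<noteq> (1 / (s 3 - s 0) + 1 / (s 3 - s 1) + 1 / (s 3 - s 2)) / 3"
    proof -
      have "u 3 \<noteq> (1 / (s 3 - s 1) + 1 / (s 3 - s 2) + 1 / (s 3 - s 0)) / 3"
        by (rule root_eq_critical_ne[OF _ _ _ _ u(2)]) ((use ds in \<open>simp; fail\<close>)+, use w' in Groebner_Basis.algebra)
      then show ?thesis by (simp only: add_ac not_False_eq_True)
    qed
    have "Xu s u \<in> Sol (osc_point s)"
      by (rule Xu_mem[OF dets(1)[THEN d3_zero_perm(2)] dets(3)[THEN d3_zero_perm(1)] dets(4)[THEN d3_zero_perm(1)] dets(2) u3])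
    moreover have "12 * ((s 0 - s 1) * (s 0 - s 2) * (s 0 - s 3)) * u 0 = ratpart s k + w"
      using u(1) unfolding root_eq_def 4 ratpart_values by Groebner_Basis.algebra
    ultimately show ?thesis using u3 by blast
  qed
qed

end

section \<open>Distinctness of the eight solutions and the final count\<close>

lemma poly_fun_disc: "poly_fun (\<lambda>s. disc s k)"
  unfolding disc_def Let_def
  by (cases "k = 0"; cases "k = 1"; cases "k = 2"; simp only: if_True if_False simp_thms) (intro poly_fun_intros)+

lemma poly_fun_ratpart: "poly_fun (\<lambda>s. ratpart s k)"
  unfolding ratpart_def Let_def
  by (cases "k = 0"; cases "k = 1"; cases "k = 2"; simp only: if_True if_False simp_thms) (intro poly_fun_intros)+

text \<open>The resultant of \<open>(t - ratpart s k)\<^sup>2 - disc s k\<close> and \<open>(t - ratpart s l)\<^sup>2 - disc s l\<close> with respect to \<open>t\<close>.\<close>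

definition separation :: "(nat \<Rightarrow> real) \<Rightarrow> nat \<Rightarrow> nat \<Rightarrow> real" where
  "separation s k l = ((ratpart s k - ratpart s l)\<^sup>2 - disc s k - disc s l)\<^sup>2 - 4 * disc s k * disc s l"

definition all_separations :: "(nat \<Rightarrow> real) \<Rightarrow> real" where
  "all_separations s = separation s 0 1 * separation s 0 2 * separation s 0 3 *
     separation s 1 2 * separation s 1 3 * separation s 2 3"

lemma poly_fun_all_separations: "poly_fun all_separations"
  unfolding all_separations_def[abs_def] separation_def
  by (intro poly_fun_intros poly_fun_disc poly_fun_ratpart)

lemma all_separations_s0: "all_separations s0 \<noteq> 0"
  by (simp add: all_separations_def separation_def disc_def ratpart_def s0_def)

lemma separation_commute: "separation s k l = separation s l k"
  unfolding separation_def by Groebner_Basis.algebra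

lemma separation_nonzero:
  assumes "all_separations s \<noteq> 0" "k < 4" "l < 4" "k \<noteq> l"
  shows "separation s k l \<noteq> 0"
proof -
  have "separation s k l \<noteq> 0" if "k < l" "l < 4" for k l
  proof -
    have "(k, l) = (0, 1) \<or> (k, l) = (0, 2) \<or> (k, l) = (0, 3) \<or> (k, l) = (1, 2) \<or> (k, l) = (1, 3) \<or> (k, l) = (2, 3)"
      using that by simp arith
    then show ?thesis using assms(1) unfolding all_separations_def by auto
  qed
  from this[of k l] this[of l k] show ?thesis
    using assms(2-) separation_commute[of s l k] by (metis linorder_neqE_nat)
qed

lemma separation_eq_0:
  assumes "ratpart s k + v = ratpart s l + w" "v\<^sup>2 = disc s k" "w\<^sup>2 = disc s l"
  shows "separation s k l = 0"
  using assms unfolding separation_def by Groebner_Basis.algebra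

text \<open>Solutions are indexed by the type k and the sign of the square root. Types are
  distinguished by the separations and signs by the positive discriminant, so the eight real
  solutions are distinct and fill a set of cardinality 8.\<close>

lemma (in osculating) Sol_real:
  assumes sep: "all_separations s \<noteq> 0" and fin: "finite (Sol (osc_point s))" and card: "card (Sol (osc_point s)) = 8"
    and X: "X \<in> Sol (osc_point s)"
  shows "real_point X"
proof -
  let ?I = "{..<4::nat} \<times> {-1, 1::real}"
  let ?w = "\<lambda>i. snd i * sqrt (disc s (fst i))"
  have w: "(?w i)\<^sup>2 = disc s (fst i)" if "i \<in> ?I" for i
    using that disc_pos[of "fst i"] by (auto simp: power_mult_distrib)
  have "\<forall>i\<in>?I. \<exists>u. Xu s u \<in> Sol (osc_point s) \<and> u 3 \<noteq> (1 / (s 3 - s 0) + 1 / (s 3 - s 1) + 1 / (s 3 - s 2)) / 3 \<and>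
      12 * ((s 0 - s 1) * (s 0 - s 2) * (s 0 - s 3)) * u 0 = ratpart s (fst i) + ?w i"
    by (intro ballI real_solution w) auto
  from bchoice[OF this] obtain U where U: "\<forall>i\<in>?I. Xu s (U i) \<in> Sol (osc_point s) \<and>
      U i 3 \<noteq> (1 / (s 3 - s 0) + 1 / (s 3 - s 1) + 1 / (s 3 - s 2)) / 3 \<and>
      12 * ((s 0 - s 1) * (s 0 - s 2) * (s 0 - s 3)) * U i 0 = ratpart s (fst i) + ?w i" ..
  have "inj_on (\<lambda>i. Xu s (U i)) ?I"
  proof (rule inj_onI)
    fix i j assume i: "i \<in> ?I" and j: "j \<in> ?I" and "Xu s (U i) = Xu s (U j)"
    then have "U i 0 = U j 0" using U by (intro Xu_inj) auto
    then have eq: "ratpart s (fst i) + ?w i = ratpart s (fst j) + ?w j" using bspec[OF U i] bspec[OF U j] by metis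
    have k: "fst i = fst j"
    proof (rule ccontr)
      assume "fst i \<noteq> fst j"
      then have "separation s (fst i) (fst j) \<noteq> 0" using i j by (intro separation_nonzero[OF sep]) auto
      then show False using separation_eq_0[OF eq w[OF i] w[OF j]] by blast
    qed
    moreover have "snd i = snd j" using eq disc_pos[of "fst j"] unfolding k by simp
    ultimately show "i = j" by (rule prod_eqI)
  qed
  then have "card ((\<lambda>i. Xu s (U i)) ` ?I) = card (Sol (osc_point s))"
    by (simp add: card_image card_cartesian_product card)
  moreover have "(\<lambda>i. Xu s (U i)) ` ?I \<subseteq> Sol (osc_point s)" using U by blast
  ultimately have "(\<lambda>i. Xu s (U i)) ` ?I = Sol (osc_point s)" by (intro card_subset_eq[OF fin])
  then obtain i where "X = Xu s (U i)" using X by blast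
  then show ?thesis by (simp add: real_point_Xu)
qed

text \<open>\<open>SG\<close> asks for a real polynomial, while the genericity condition is a
  complex one. The entries of osculating matrices are real polynomials in the parameters, so real
  and imaginary parts can be followed through the construction of \<open>P\<close>.\<close>

lemma poly_fun_Re_Im_osc_point:
  assumes "poly_fun P"
  shows "poly_fun (\<lambda>s. Re (P (osc_point s))) \<and> poly_fun (\<lambda>s. Im (P (osc_point s)))"
  using assms
proof induction
  case (pf_const c) show ?case by (simp add: poly_fun.pf_const)
next
  case (pf_var v)
  obtain j r c where v: "v = (j, r, c)" by (cases v)
  have "osc_point s v = complex_of_real (of_nat (c choose r) * s j ^ (c - r))" for s
    by (simp add: v osc_point_def osc_matrix_def)
  then have "Re (osc_point s v) = of_nat (c choose r) * s j ^ (c - r)" "Im (osc_point s v) = 0" for s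
    by (simp_all only: Re_complex_of_real Im_complex_of_real)
  moreover have "poly_fun (\<lambda>s. of_nat (c choose r) * s j ^ (c - r) :: real)" by (intro poly_fun_intros)
  ultimately show ?case by (simp add: poly_fun.pf_const)
next
  case (pf_add p q) then show ?case by (simp add: poly_fun.pf_add)
next
  case (pf_mult p q) then show ?case by (auto intro!: poly_fun_intros)
qed

theorem mainTheorem12:
  shows "schubert_number 4 3 (replicate 4 [1, 3, 5]) = 8 \<and> SG 4 3 (replicate 4 [1, 3, 5])"
proof -
  obtain P where P: "poly_fun P" "P x0 \<noteq> 0" "\<And>x. P x \<noteq> 0 \<Longrightarrow> finite (Sol x) \<and> card (Sol x) = 8"
    using znear_card_Sol unfolding znear_def by blast
  have P_nz: "P \<noteq> (\<lambda>_. 0)" using P(2) by auto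
  have Sol_g: "Sol (\<lambda>(j, r, c). g j r c) = schubert_intersection 3 (4 + 3) (replicate 4 [1, 3, 5]) (\<lambda>j. flag_of_matrix (4 + 3) (g j))"
    for g by (simp add: Sol_def)
  have gc: "generic_count 4 3 (replicate 4 [1, 3, 5]) 8"
    unfolding generic_count_def Let_def Sol_g[symmetric] using P P_nz by blast
  have number: "schubert_number 4 3 (replicate 4 [1, 3, 5]) = 8"
    unfolding schubert_number_def
  proof (rule the_equality)
    show "generic_count 4 3 (replicate 4 [1, 3, 5]) 8" by (rule gc)
  next
    fix d assume "generic_count 4 3 (replicate 4 [1, 3, 5]) d"
    then obtain Q where Q: "poly_fun Q" "Q \<noteq> (\<lambda>_. 0)"
      "\<And>g. Q (\<lambda>(j, r, c). g j r c) \<noteq> 0 \<Longrightarrow> card (Sol (\<lambda>(j, r, c). g j r c)) = d"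
      unfolding generic_count_def Let_def Sol_g[symmetric] by blast
    \<comment> \<open>At a common point of nonvanishing both counts describe the same
      intersection.\<close>
    obtain x where x: "P x \<noteq> 0" "Q x \<noteq> 0" by (rule poly_fun_common_nonzero[OF P(1) P_nz Q(1,2)])
    have "(\<lambda>(j, r, c). x (j, r, c)) = x" by auto
    then show "d = 8" using P(3)[OF x(1)] Q(3)[of "\<lambda>j r c. x (j, r, c)"] x(2) by simp
  qed
  \<comment> \<open>The sum of squares vanishes exactly where \<open>P\<close> does; the other
    factor keeps the eight explicit solutions apart.\<close>
  define f where "f s = ((Re (P (osc_point s)))\<^sup>2 + (Im (P (osc_point s)))\<^sup>2) * all_separations s" for s
  have "poly_fun f" unfolding f_def[abs_def]
    using poly_fun_Re_Im_osc_point[OF P(1)] by (intro poly_fun_intros poly_fun_all_separations) auto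
  moreover have "f s0 \<noteq> 0" using P(2) all_separations_s0 by (simp add: f_def sum_power2_eq_zero_iff complex_eq_iff)
  then have "f \<noteq> (\<lambda>_. 0)" by auto
  moreover have "finite (Sol (osc_point s)) \<and> card (Sol (osc_point s)) = 8 \<and> (\<forall>X\<in>Sol (osc_point s). real_point X)"
    if s: "inj_on s {..<4}" "f s \<noteq> 0" for s :: "nat \<Rightarrow> real"
  proof -
    interpret osculating s
      using s(1) by unfold_locales (auto simp: inj_on_def)
    have "P (osc_point s) \<noteq> 0" "all_separations s \<noteq> 0" using s(2) by (auto simp: f_def)
    then show ?thesis using P(3) Sol_real by blast
  qed
  moreover have "Sol (osc_point s) = schubert_intersection 3 (4 + 3) (replicate 4 [1, 3, 5]) (\<lambda>j. osc_flag (4 + 3) (s j))" for s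
    by (simp add: Sol_def osc_point_def osc_flag_def)
  ultimately have "SG 4 3 (replicate 4 [1, 3, 5])"
    unfolding SG_def Let_def number length_replicate by (intro exI[of _ f]) auto
  with number show ?thesis ..
qed

end
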